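(* Every transduction $\mathsf T$ (from graphs to graphs) is subsumed by the composition $\mathsf P\circ\mathsf T_{\mathrm{imm}}\circ\mathsf C$ of a copy operation $\mathsf C$, an immersive transduction $\mathsf T_{\mathrm{imm}}$ and a perturbation $\mathsf P$ (applied in this order). If $\mathsf T$ is non-copying, then there is such a composition $\mathsf P\circ\mathsf T_{\mathrm{imm}}$ subsuming $\mathsf T$ with no copy operation.
   Context: All graphs are finite, simple, undirected. For a finite set $\Sigma$ of unary relation symbols, a $\Sigma$-expansion $G^+$ of a graph $G$ is $G$ together with a subset of $V(G)$ for each symbol. A simple interpretation $\mathsf I=(\nu(x),\eta(x,y))$ is a pair of first-order formulas over $\{E\}\cup\Sigma$ with $\eta$ symmetric and antireflexive; $\mathsf I(G^+)$ has vertex set $\nu(G^+)$ and edges $uv$ ($u,v\in\nu(G^+)$) with $G^+\models\eta(u,v)$. A non-copying transduction $\mathsf T=(\Sigma_{\mathsf T},\mathsf I_{\mathsf T})$ maps $G$ to the set $\mathsf T(\{G\})$ of all $\mathsf I_{\mathsf T}(G^+)$, $G^+$ a $\Sigma_{\mathsf T}$-expansion of $G$. The $k$-copy operation maps $G$ to $k$ disjoint copies of $G$ with the copies of each vertex made pairwise adjacent. A transduction is a finite composition of copy operations and non-copying transductions. $\mathsf T'$ subsumes $\mathsf T$ if $\mathsf T(\{G\})\subseteq\mathsf T'(\{G\})$ for every graph $G$. For a set $U$ of vertices of a (expanded) graph $G$, $B_r^G(U)$ is the substructure induced on vertices at distance at most $r$ from $U$. A formula $\phi(x_1,\dots,x_k)$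 is $r$-local if for every $\Sigma$-expanded graph $G$ and $v_1,\dots,v_k$: $G\models\phi(\bar v)$ iff $B_r^G(\{v_1,\dots,v_k\})\models\phi(\bar v)$; it is strongly $r$-local if moreover $\phi$ implies $\mathrm{dist}(x_i,x_j)\le r$ for all $i<j$. A transduction is immersive if it is non-copying and its interpretation is strongly $r$-local for some $r$. A subset complementation is the non-copying transduction with one unary symbol $M$, $\nu(x)$ true and $\eta(x,y):=x\ne y\wedge\neg(E(x,y)\leftrightarrow(M(x)\wedge M(y)))$ (it complements adjacency inside $M$). A perturbation is a composition of finitely many subset complementations. *)

theory Defs
  imports "Graph_Theory.Graph_Theory" "HOL-Library.Nat_Bijection"
begin

section \<open>Graphs\<close>

text \<open>
  A finite simple undirected graph is a \<open>pair_pre_digraph\<close> satisfying \<open>pair_graph\<close> (finite,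
  symmetric, loop-free). The empty graph is allowed. The definitions below that quantify over all
  graphs use graphs with vertices in \<open>nat\<close>; up to isomorphism these are all finite graphs, and the
  vertex universe is closed under the copy operation via \<open>prod_encode\<close>.
\<close>

type_synonym ngraph = "nat pair_pre_digraph"

text \<open>The value is infinite if there is no walk from \<open>u\<close> to \<open>v\<close>.\<close>

definition gdist :: "'a pair_pre_digraph \<Rightarrow> 'a \<Rightarrow> 'a \<Rightarrow> ereal" where
  "gdist G u v = wf_digraph.\<mu> (with_proj G) (\<lambda>_. 1) u v"

definition induce :: "'a pair_pre_digraph \<Rightarrow> 'a set \<Rightarrow> 'a pair_pre_digraph" where
  "induce G W = \<lparr>pverts = pverts G \<inter> W, parcs = parcs G \<inter> W \<times> W\<rparr>"

definition ball_verts :: "'a pair_pre_digraph \<Rightarrow> nat \<Rightarrow> 'a set \<Rightarrow> 'a set" where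
  "ball_verts G r U = {v \<in> pverts G. \<exists>u\<in>U. gdist G u v \<le> ereal (real r)}"

section \<open>First-order formulas over an expanded graph\<close>

text \<open>
  Unary relation symbols and variables are natural numbers; the variables \<open>x\<^sub>1, ..., x\<^sub>k\<close> of
  a formula \<open>\<phi>(x\<^sub>1, ..., x\<^sub>k)\<close> are \<open>0, ..., k - 1\<close>.
\<close>

datatype fm =
    Eq nat nat
  | Adj nat nat
  | Col nat nat \<comment> \<open>\<open>Col s x\<close> is the atom \<open>s(x)\<close>\<close>
  | Neg fm
  | And fm fm
  | Ex nat fm

definition Iff :: "fm \<Rightarrow> fm \<Rightarrow> fm" where
  "Iff \<phi> \<psi> = And (Neg (And \<phi> (Neg \<psi>))) (Neg (And \<psi> (Neg \<phi>)))"

primrec fvars :: "fm \<Rightarrow> nat set" where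
  "fvars (Eq x y) = {x, y}"
| "fvars (Adj x y) = {x, y}"
| "fvars (Col s x) = {x}"
| "fvars (Neg \<phi>) = fvars \<phi>"
| "fvars (And \<phi> \<psi>) = fvars \<phi> \<union> fvars \<psi>"
| "fvars (Ex x \<phi>) = fvars \<phi> - {x}"

primrec symbols :: "fm \<Rightarrow> nat set" where
  "symbols (Eq x y) = {}"
| "symbols (Adj x y) = {}"
| "symbols (Col s x) = {s}"
| "symbols (Neg \<phi>) = symbols \<phi>"
| "symbols (And \<phi> \<psi>) = symbols \<phi> \<union> symbols \<psi>"
| "symbols (Ex x \<phi>) = symbols \<phi>"

text \<open>
  An expanded graph is given by a graph \<open>G\<close> and an assignment \<open>C\<close> of vertex sets to symbols.
  The values of \<open>C\<close> outside \<open>\<Sigma>\<close> play no role for formulas with symbols in \<open>\<Sigma>\<close>.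
\<close>

definition expansion :: "nat set \<Rightarrow> 'a pair_pre_digraph \<Rightarrow> (nat \<Rightarrow> 'a set) \<Rightarrow> bool" where
  "expansion \<Sigma> G C \<longleftrightarrow> (\<forall>s\<in>\<Sigma>. C s \<subseteq> pverts G)"

primrec sat :: "'a pair_pre_digraph \<Rightarrow> (nat \<Rightarrow> 'a set) \<Rightarrow> (nat \<Rightarrow> 'a) \<Rightarrow> fm \<Rightarrow> bool" where
  "sat G C e (Eq x y) \<longleftrightarrow> e x = e y"
| "sat G C e (Adj x y) \<longleftrightarrow> (e x, e y) \<in> parcs G"
| "sat G C e (Col s x) \<longleftrightarrow> e x \<in> C s"
| "sat G C e (Neg \<phi>) \<longleftrightarrow> \<not> sat G C e \<phi>"
| "sat G C e (And \<phi> \<psi>) \<longleftrightarrow> sat G C e \<phi> \<and> sat G C e \<psi>"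
| "sat G C e (Ex x \<phi>) \<longleftrightarrow> (\<exists>v\<in>pverts G. sat G C (e(x := v)) \<phi>)"

text \<open>
  \<open>models G C vs \<phi>\<close> means \<open>G\<^sup>+ \<Turnstile> \<phi>(vs)\<close>; it is used only if the free variables of \<open>\<phi>\<close> are below
  the length of \<open>vs\<close>.
\<close>

definition models :: "'a pair_pre_digraph \<Rightarrow> (nat \<Rightarrow> 'a set) \<Rightarrow> 'a list \<Rightarrow> fm \<Rightarrow> bool" where
  "models G C vs \<phi> \<longleftrightarrow> sat G C (\<lambda>i. vs ! i) \<phi>"

section \<open>Locality\<close>

definition local_fm :: "nat set \<Rightarrow> nat \<Rightarrow> nat \<Rightarrow> fm \<Rightarrow> bool" where
  "local_fm \<Sigma> k r \<phi> \<longleftrightarrow>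
     fvars \<phi> \<subseteq> {..<k} \<and> symbols \<phi> \<subseteq> \<Sigma> \<and>
     (\<forall>(G :: ngraph) C vs. pair_graph G \<longrightarrow> expansion \<Sigma> G C \<longrightarrow> length vs = k \<longrightarrow>
        set vs \<subseteq> pverts G \<longrightarrow>
        (models G C vs \<phi> \<longleftrightarrow>
         models (induce G (ball_verts G r (set vs))) (\<lambda>s. C s \<inter> ball_verts G r (set vs)) vs \<phi>))"

definition strongly_local_fm :: "nat set \<Rightarrow> nat \<Rightarrow> nat \<Rightarrow> fm \<Rightarrow> bool" where
  "strongly_local_fm \<Sigma> k r \<phi> \<longleftrightarrow>
     local_fm \<Sigma> k r \<phi> \<and>
     (\<forall>(G :: ngraph) C vs. pair_graph G \<longrightarrow> expansion \<Sigma> G C \<longrightarrow> length vs = k \<longrightarrow>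
        set vs \<subseteq> pverts G \<longrightarrow> models G C vs \<phi> \<longrightarrow>
        (\<forall>i j. i < j \<longrightarrow> j < k \<longrightarrow> gdist G (vs ! i) (vs ! j) \<le> ereal (real r)))"

section \<open>Transductions\<close>

text \<open>
  A transduction is represented by the map sending a graph \<open>G\<close> to the set \<open>T({G})\<close>; only the values
  at arguments satisfying \<open>pair_graph\<close> matter.
\<close>

type_synonym transd = "ngraph \<Rightarrow> ngraph set"

definition tcomp :: "transd \<Rightarrow> transd \<Rightarrow> transd" (infixr "\<circ>\<^sub>T" 55) where
  "(S \<circ>\<^sub>T T) G = (\<Union>H\<in>T G. S H)"

definition simple_interpretation :: "nat set \<Rightarrow> fm \<Rightarrow> fm \<Rightarrow> bool" where
  "simple_interpretation \<Sigma> \<nu> \<eta> \<longleftrightarrow>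
     fvars \<nu> \<subseteq> {..<1} \<and> symbols \<nu> \<subseteq> \<Sigma> \<and> fvars \<eta> \<subseteq> {..<2} \<and> symbols \<eta> \<subseteq> \<Sigma> \<and>
     (\<forall>(G :: ngraph) C. pair_graph G \<longrightarrow> expansion \<Sigma> G C \<longrightarrow>
        (\<forall>u\<in>pverts G. \<not> models G C [u, u] \<eta>) \<and>
        (\<forall>u\<in>pverts G. \<forall>v\<in>pverts G. models G C [u, v] \<eta> \<longrightarrow> models G C [v, u] \<eta>))"

definition interpret_graph ::
    "fm \<Rightarrow> fm \<Rightarrow> 'a pair_pre_digraph \<Rightarrow> (nat \<Rightarrow> 'a set) \<Rightarrow> 'a pair_pre_digraph" where
  "interpret_graph \<nu> \<eta> G C =
     (let W = {v \<in> pverts G. models G C [v] \<nu>}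
      in \<lparr>pverts = W, parcs = {(u, v). u \<in> W \<and> v \<in> W \<and> models G C [u, v] \<eta>}\<rparr>)"

definition noncopying_map :: "nat set \<Rightarrow> fm \<Rightarrow> fm \<Rightarrow> transd" where
  "noncopying_map \<Sigma> \<nu> \<eta> G = {interpret_graph \<nu> \<eta> G C | C. expansion \<Sigma> G C}"

definition noncopying :: "transd \<Rightarrow> bool" where
  "noncopying T \<longleftrightarrow>
     (\<exists>\<Sigma> \<nu> \<eta>. finite \<Sigma> \<and> simple_interpretation \<Sigma> \<nu> \<eta> \<and> T = noncopying_map \<Sigma> \<nu> \<eta>)"

text \<open>The \<open>i\<close>-th copy of the vertex \<open>v\<close> is \<open>prod_encode (v, i)\<close>, \<open>i < k\<close>.\<close>

definition copies :: "nat \<Rightarrow> ngraph \<Rightarrow> ngraph" where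
  "copies k G =
     \<lparr>pverts = {prod_encode (v, i) | v i. v \<in> pverts G \<and> i < k},
      parcs = {(prod_encode (u, i), prod_encode (v, i)) | u v i. (u, v) \<in> parcs G \<and> i < k}
            \<union> {(prod_encode (v, i), prod_encode (v, j)) | v i j.
                 v \<in> pverts G \<and> i < k \<and> j < k \<and> i \<noteq> j}\<rparr>"

definition copy_operation :: "transd \<Rightarrow> bool" where
  "copy_operation T \<longleftrightarrow> (\<exists>k\<ge>1. T = (\<lambda>G. {copies k G}))"

inductive transduction :: "transd \<Rightarrow> bool" where
  copy: "copy_operation T \<Longrightarrow> transduction T"
| noncopy: "noncopying T \<Longrightarrow> transduction T"
| comp: "transduction S \<Longrightarrow> transduction T \<Longrightarrow> transduction (S \<circ>\<^sub>T T)"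

definition immersive :: "transd \<Rightarrow> bool" where
  "immersive T \<longleftrightarrow>
     (\<exists>\<Sigma> \<nu> \<eta> r. finite \<Sigma> \<and> simple_interpretation \<Sigma> \<nu> \<eta> \<and>
        strongly_local_fm \<Sigma> 1 r \<nu> \<and> strongly_local_fm \<Sigma> 2 r \<eta> \<and> T = noncopying_map \<Sigma> \<nu> \<eta>)"

text \<open>The symbol \<open>M\<close> is \<open>0\<close>.\<close>

definition subset_complementation :: transd where
  "subset_complementation =
     noncopying_map {0} (Eq 0 0)
       (And (Neg (Eq 0 1)) (Neg (Iff (Adj 0 1) (And (Col 0 0) (Col 0 1)))))"

inductive perturbation :: "transd \<Rightarrow> bool" where
  none: "perturbation (\<lambda>G. {G})"
| step: "perturbation P \<Longrightarrow> perturbation (subset_complementation \<circ>\<^sub>T P)"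

section \<open>Subsumption\<close>

text \<open>
  The first notion is literal inclusion. It is too strict once copying is involved, because the
  vertices of \<open>copies k G\<close> are not those of \<open>G\<close>; then graphs are considered up to isomorphism.
\<close>

definition subsumes :: "transd \<Rightarrow> transd \<Rightarrow> bool" where
  "subsumes T' T \<longleftrightarrow> (\<forall>G. pair_graph G \<longrightarrow> T G \<subseteq> T' G)"

definition subsumes_up_to_iso :: "transd \<Rightarrow> transd \<Rightarrow> bool" where
  "subsumes_up_to_iso T' T \<longleftrightarrow>
     (\<forall>G. pair_graph G \<longrightarrow> (\<forall>H\<in>T G. \<exists>H'\<in>T' G. digraph_iso (with_proj H) (with_proj H')))"

section \<open>Well-formedness\<close>

lemma pair_graph_iff:
  "pair_graph G \<longleftrightarrow> finite (pverts G) \<and> parcs G \<subseteq> pverts G \<times> pverts G \<and>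
     sym (parcs G) \<and> irrefl (parcs G)"
proof
  assume "pair_graph G"
  then interpret pair_graph G .
  show "finite (pverts G) \<and> parcs G \<subseteq> pverts G \<times> pverts G \<and> sym (parcs G) \<and> irrefl (parcs G)"
    using pair_finite_verts pair_sym_arcs in_arcsD1 in_arcsD2 pair_no_loops
    by (fastforce simp: symmetric_def irrefl_def)
next
  assume *: "finite (pverts G) \<and> parcs G \<subseteq> pverts G \<times> pverts G \<and> sym (parcs G) \<and> irrefl (parcs G)"
  then have "finite (parcs G)" by (meson finite_SigmaI finite_subset)
  with * show "pair_graph G"
    by unfold_locales (auto simp: symmetric_def irrefl_def)
qed

lemma pair_graph_noncopying_map:
  assumes "simple_interpretation \<Sigma> \<nu> \<eta>" "pair_graph G" "H \<in> noncopying_map \<Sigma> \<nu> \<eta> G"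
  shows "pair_graph H"
  using assms
  by (auto simp: pair_graph_iff noncopying_map_def interpret_graph_def Let_def
      simple_interpretation_def sym_def irrefl_def)

lemma pair_graph_copies:
  assumes "pair_graph G"
  shows "pair_graph (copies k G)"
proof -
  have "{prod_encode (v, i) | v i. v \<in> pverts G \<and> i < k} = prod_encode ` (pverts G \<times> {..<k})"
    by auto
  moreover have "finite (pverts G)" using assms by (simp add: pair_graph_iff)
  ultimately have "finite (pverts (copies k G))" by (simp add: copies_def)
  with assms show ?thesis
    by (auto simp: pair_graph_iff copies_def sym_def irrefl_def)
qed

lemma transduction_pair_graph:
  assumes "transduction T" "pair_graph G" "H \<in> T G"
  shows "pair_graph H"
  using assms
proof (induction arbitrary: G H)
  case (copy T)
  then obtain k where "H = copies k G" by (auto simp: copy_operation_def)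
  with copy.prems show ?case using pair_graph_copies by simp
next
  case (noncopy T)
  then obtain \<Sigma> \<nu> \<eta> where "simple_interpretation \<Sigma> \<nu> \<eta>" "T = noncopying_map \<Sigma> \<nu> \<eta>"
    unfolding noncopying_def by blast
  with noncopy.prems show ?case using pair_graph_noncopying_map by blast
next
  case (comp S T)
  from comp.prems obtain K where "K \<in> T G" "H \<in> S K" unfolding tcomp_def by blast
  with comp.IH comp.prems show ?case by blast
qed

lemma noncopying_subset_complementation: "noncopying subset_complementation"
proof -
  let ?\<nu> = "Eq 0 0"
  let ?\<eta> = "And (Neg (Eq 0 1)) (Neg (Iff (Adj 0 1) (And (Col 0 0) (Col 0 1))))"
  have "simple_interpretation {0} ?\<nu> ?\<eta>"
    by (simp add: simple_interpretation_def models_def Iff_def pair_graph_iff sym_def) blast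
  then show ?thesis
    unfolding noncopying_def subset_complementation_def by - (rule exI, rule exI, rule exI, rule conjI, rule finite.insertI[OF finite.emptyI],
        rule conjI, assumption, rule refl)
qed

end

theory Submission
  imports Defs
begin

text \<open>
  Since the colours of an expansion may be guessed, a weak form of Gaifman's theorem suffices: for
  every formula there are finitely many strongly local formulas that, after a suitable recolouring of
  any given graph, determine its truth value there. In the inductive step for an existential
  quantifier, a witness near the free variables is found by a strongly local formula. A witness far
  from them matters only through its unary class, and whether the class has such a witness can be
  read off from boundedly many coloured balls.

  Consequently the adjacency that an interpretation defines between distant vertices depends only on
  the classes of the two vertices, out of finitely many. Flipping the adjacency between pairs of
  classes is a perturbation, and the difference to the given interpretation vanishes at large
  distance. Its truth value at close pairs is determined by strongly local formulas, the dependence on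
  the graph being encoded by colours that contain all vertices or none, so it is immersive.

  Copying reduces to this case: interpretations defining several copies of each vertex are closed
  under composition, and they are simulated by copying first.
\<close>

subsection \<open>Formulas\<close>

text \<open>The order of quantifiers shapes the proof: formulas, radii and the number of
  complementations are fixed before the graph, and only sets of vertices may depend on it. So
  everything that the graph decides globally (which classes have far witnesses, which pairs of
  classes are flipped, which local types mean adjacency) has to be cut down to boundedly many sets.
  Strong locality is needed rather than locality because a strongly local formula with two free
  variables is false once their values are far apart; at a far witness only formulas in one variable
  are left. An interpretation must be symmetric and loop-free under every colouring, also under
  those that were not intended, so the formulas are symmetrised and carry their distance bound
  inside. Truth values are only ever compared between assignments in one and the same graph, so
  sentences need no treatment of their own.\<close>

lemma finite_symbols: "finite (symbols \<phi>)"
  by (induction \<phi>) auto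

lemma finite_fvars: "finite (fvars \<phi>)"
  by (induction \<phi>) auto

lemma sat_iso:
  assumes "bij_betw f (pverts G) (pverts H)"
    and "\<And>u v. u \<in> pverts G \<Longrightarrow> v \<in> pverts G \<Longrightarrow> (u, v) \<in> parcs G \<longleftrightarrow> (f u, f v) \<in> parcs H"
    and "\<And>s v. s \<in> symbols \<phi> \<Longrightarrow> v \<in> pverts G \<Longrightarrow> v \<in> C s \<longleftrightarrow> f v \<in> D s"
    and "\<And>x. x \<in> fvars \<phi> \<Longrightarrow> e x \<in> pverts G \<and> e' x = f (e x)"
  shows "sat G C e \<phi> = sat H D e' \<phi>"
  using assms(3,4)
proof (induction \<phi> arbitrary: e e')
  case (Eq x y)
  then show ?case using assms(1) by (auto simp: bij_betw_def inj_on_def)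
next
  case (Adj x y)
  then show ?case using assms(2) by auto
next
  case (Ex x \<phi>)
  have "sat G C (e(x := v)) \<phi> = sat H D (e'(x := f v)) \<phi>" if "v \<in> pverts G" for v
    by (rule Ex.IH) (use Ex.prems that in auto)
  moreover have "pverts H = f ` pverts G" using assms(1) by (simp add: bij_betw_def)
  ultimately show ?case by auto
next
  case (And \<phi> \<psi>)
  have "sat G C e \<phi> = sat H D e' \<phi>" by (rule And.IH) (use And.prems in auto)
  moreover have "sat G C e \<psi> = sat H D e' \<psi>" by (rule And.IH) (use And.prems in auto)
  ultimately show ?case by simp
next
  case (Neg \<phi>)
  have "sat G C e \<phi> = sat H D e' \<phi>" by (rule Neg.IH) (use Neg.prems in auto)
  then show ?case by simp
qed auto

lemma sat_cong:
  assumes "\<And>s v. s \<in> symbols \<phi> \<Longrightarrow> v \<in> pverts G \<Longrightarrow> v \<in> C s \<longleftrightarrow> v \<in> D s"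
    and "\<And>x. x \<in> fvars \<phi> \<Longrightarrow> e x \<in> pverts G \<and> e' x = e x"
  shows "sat G C e \<phi> = sat G D e' \<phi>"
  by (rule sat_iso[where f = id]) (use assms in auto)

lemma models_Cons:
  assumes "fvars \<phi> \<subseteq> {..<1}" "v \<in> pverts G" "e 0 = v"
  shows "models G C [v] \<phi> = sat G C e \<phi>"
  unfolding models_def by (rule sat_cong) (use assms in auto)

lemma models_Cons2:
  assumes "fvars \<phi> \<subseteq> {..<2}" "u \<in> pverts G" "v \<in> pverts G" "e 0 = u" "e 1 = v"
  shows "models G C [u, v] \<phi> = sat G C e \<phi>"
  unfolding models_def
proof (rule sat_cong)
  fix x assume "x \<in> fvars \<phi>"
  then have "x = 0 \<or> x = 1" using assms(1) by fastforce
  then show "[u, v] ! x \<in> pverts G \<and> e x = [u, v] ! x" using assms by auto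
qed simp

text \<open>The syntax has no constant for truth, and \<open>Eq 0 0\<close> would add a free
  variable to every conjunction. The negated existential is closed and also true in the empty
  graph.\<close>

definition Tr :: fm where
  "Tr = Neg (Ex 0 (Neg (Eq 0 0)))"

definition Conj :: "fm set \<Rightarrow> fm" where
  "Conj S = foldr And (SOME \<phi>s. set \<phi>s = S) Tr"

definition Disj :: "fm set \<Rightarrow> fm" where
  "Disj S = Neg (Conj (Neg ` S))"

lemma Conj_props:
  assumes "finite S"
  shows sat_Conj: "sat G C e (Conj S) \<longleftrightarrow> (\<forall>\<phi>\<in>S. sat G C e \<phi>)"
    and fvars_Conj: "fvars (Conj S) = (\<Union>\<phi>\<in>S. fvars \<phi>)"
    and symbols_Conj: "symbols (Conj S) = (\<Union>\<phi>\<in>S. symbols \<phi>)"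
proof -
  define \<phi>s where "\<phi>s = (SOME \<phi>s. set \<phi>s = S)"
  have S: "set \<phi>s = S" unfolding \<phi>s_def by (rule someI_ex) (rule finite_list[OF assms])
  have *: "sat G C e (foldr And \<phi>s Tr) \<longleftrightarrow> (\<forall>\<phi>\<in>set \<phi>s. sat G C e \<phi>)"
    "fvars (foldr And \<phi>s Tr) = (\<Union>\<phi>\<in>set \<phi>s. fvars \<phi>)"
    "symbols (foldr And \<phi>s Tr) = (\<Union>\<phi>\<in>set \<phi>s. symbols \<phi>)"
    by (induction \<phi>s) (auto simp: Tr_def)
  show "sat G C e (Conj S) \<longleftrightarrow> (\<forall>\<phi>\<in>S. sat G C e \<phi>)"
    "fvars (Conj S) = (\<Union>\<phi>\<in>S. fvars \<phi>)" "symbols (Conj S) = (\<Union>\<phi>\<in>S. symbols \<phi>)"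
    unfolding Conj_def \<phi>s_def[symmetric] using * S by simp_all
qed

lemma Disj_props:
  assumes "finite S"
  shows sat_Disj: "sat G C e (Disj S) \<longleftrightarrow> (\<exists>\<phi>\<in>S. sat G C e \<phi>)"
    and fvars_Disj: "fvars (Disj S) = (\<Union>\<phi>\<in>S. fvars \<phi>)"
  using assms by (simp_all add: Disj_def sat_Conj fvars_Conj)

text \<open>Substitutes the variables \<open>x\<close>, \<open>y\<close> for \<open>0\<close>, \<open>1\<close>; the auxiliary quantifiers rule out variable
  capture without any renaming of bound variables.\<close>

definition inst2 :: "fm \<Rightarrow> nat \<Rightarrow> nat \<Rightarrow> fm" where
  "inst2 \<phi> x y =
     (let a = x + y + 2; b = x + y + 3 in
      Ex a (And (Eq a x) (Ex b (And (Eq b y)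
        (Ex 0 (And (Eq 0 a) (Ex 1 (And (Eq 1 b) \<phi>))))))))"

lemma inst2_props:
  assumes "fvars \<phi> \<subseteq> {..<2}"
  shows sat_inst2: "e x \<in> pverts G \<Longrightarrow> e y \<in> pverts G \<Longrightarrow>
      sat G C e (inst2 \<phi> x y) = models G C [e x, e y] \<phi>"
    and fvars_inst2: "fvars (inst2 \<phi> x y) \<subseteq> {x, y}"
    and symbols_inst2: "symbols (inst2 \<phi> x y) = symbols \<phi>"
proof -
  assume "e x \<in> pverts G" "e y \<in> pverts G"
  moreover define e' where "e' = e(x + y + 2 := e x, x + y + 3 := e y, 0 := e x, 1 := e y)"
  moreover have "e' 0 = e x" "e' 1 = e y" by (simp_all add: e'_def)
  ultimately show "sat G C e (inst2 \<phi> x y) = models G C [e x, e y] \<phi>"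
    using models_Cons2[OF assms, of "e x" G "e y" e']
    by (simp add: inst2_def Let_def e'_def)
next
  show "fvars (inst2 \<phi> x y) \<subseteq> {x, y}" 
  proof -
    have "fvars \<phi> \<subseteq> {0, 1}" using assms by fastforce
    then show ?thesis by (auto simp: inst2_def Let_def)
  qed
  show "symbols (inst2 \<phi> x y) = symbols \<phi>" by (simp add: inst2_def Let_def)
qed

definition sym_part :: "fm \<Rightarrow> fm" where
  "sym_part \<phi> = And (Neg (Eq 0 1)) (And \<phi> (inst2 \<phi> 1 0))"

lemma sym_part_props:
  assumes "fvars \<phi> \<subseteq> {..<2}"
  shows models_sym_part: "u \<in> pverts G \<Longrightarrow> v \<in> pverts G \<Longrightarrow>
      models G C [u, v] (sym_part \<phi>) \<longleftrightarrow> u \<noteq> v \<and> models G C [u, v] \<phi> \<and> models G C [v, u] \<phi>"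
    and fvars_sym_part: "fvars (sym_part \<phi>) \<subseteq> {..<2}"
    and symbols_sym_part: "symbols (sym_part \<phi>) = symbols \<phi>"
proof -
  assume "u \<in> pverts G" "v \<in> pverts G"
  then show "models G C [u, v] (sym_part \<phi>) \<longleftrightarrow> u \<noteq> v \<and> models G C [u, v] \<phi> \<and> models G C [v, u] \<phi>"
    using sat_inst2[OF assms, of "\<lambda>i. [u, v] ! i" 1 G 0 C]
    by (simp add: sym_part_def models_def)
next
  show "fvars (sym_part \<phi>) \<subseteq> {..<2}"
    using assms fvars_inst2[OF assms, of 1 0] by (auto simp: sym_part_def)
  show "symbols (sym_part \<phi>) = symbols \<phi>"
    by (simp add: sym_part_def symbols_inst2[OF assms])
qed

lemma simple_interpretation_sym_part:
  assumes "fvars \<nu> \<subseteq> {..<1}" "symbols \<nu> \<subseteq> \<Sigma>" "fvars \<eta> \<subseteq> {..<2}" "symbols \<eta> \<subseteq> \<Sigma>"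
  shows "simple_interpretation \<Sigma> \<nu> (sym_part \<eta>)"
  using assms fvars_sym_part[OF assms(3)]
  by (simp add: simple_interpretation_def models_sym_part symbols_sym_part)

subsection \<open>Distances\<close>

text \<open>A step may stay where it is, so \<open>n\<close> steps reach the vertices at distance at
  most \<open>n\<close>. The recursion is the one of the first-order formula \<open>Dle\<close>. At
  \<open>n = 0\<close> the vertex need not belong to \<open>G\<close>, hence the membership
  assumptions in the lemmas on padding.\<close>

primrec near :: "'a pair_pre_digraph \<Rightarrow> nat \<Rightarrow> 'a \<Rightarrow> 'a \<Rightarrow> bool" where
  "near G 0 u v \<longleftrightarrow> u = v"
| "near G (Suc n) u v \<longleftrightarrow> (\<exists>w\<in>pverts G. (w = u \<or> (u, w) \<in> parcs G) \<and> near G n w v)"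

text \<open>The bound variable \<open>x + y + 1\<close> exceeds both \<open>x\<close> and
  \<open>y\<close>, which excludes capture.\<close>

primrec Dle :: "nat \<Rightarrow> nat \<Rightarrow> nat \<Rightarrow> fm" where
  "Dle 0 x y = Eq x y"
| "Dle (Suc n) x y =
     (let z = x + y + 1 in Ex z (And (Neg (And (Neg (Eq z x)) (Neg (Adj x z)))) (Dle n z y)))"

lemma sat_Dle: "sat G C e (Dle n x y) \<longleftrightarrow> near G n (e x) (e y)"
  by (induction n arbitrary: x e) (auto simp: Let_def)

lemma fvars_Dle: "fvars (Dle n x y) = {x, y}"
  by (induction n arbitrary: x) (auto simp: Let_def)

lemma symbols_Dle: "symbols (Dle n x y) = {}"
  by (induction n arbitrary: x) (auto simp: Let_def)

lemma near_refl: "u \<in> pverts G \<Longrightarrow> near G n u u"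
  by (induction n) auto

lemma near_trans: "near G m u v \<Longrightarrow> near G n v w \<Longrightarrow> near G (m + n) u w"
  by (induction m arbitrary: u) auto

lemma near_mono: "near G m u v \<Longrightarrow> m \<le> n \<Longrightarrow> v \<in> pverts G \<Longrightarrow> near G n u v"
  using near_trans[OF _ near_refl, of G m u v "n - m"] by auto

lemma near_verts: "near G n u v \<Longrightarrow> u \<in> pverts G \<Longrightarrow> v \<in> pverts G"
  by (induction n arbitrary: u) auto

lemma near_sym:
  assumes "pair_graph G"
  shows "near G n u v \<Longrightarrow> u \<in> pverts G \<Longrightarrow> near G n v u"
proof (induction n arbitrary: u)
  case (Suc n)
  then obtain w where w: "w \<in> pverts G" "w = u \<or> (u, w) \<in> parcs G" "near G n v w" by auto
  have "near G (Suc 0) w u"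
    using w assms Suc.prems by (auto simp: pair_graph_iff sym_def)
  with near_trans[OF w(3) this] show ?case by simp
qed simp

lemma near_induce_mono: "near (induce G W) n u v \<Longrightarrow> near G n u v"
  by (induction n arbitrary: u) (auto simp: induce_def)

text \<open>A walk of length at most \<open>n\<close> from \<open>u\<close> never leaves the
  \<open>n\<close>-ball around \<open>u\<close>, so it survives in every induced subgraph containing
  this ball.\<close>

lemma near_induce:
  assumes "pair_graph G"
  shows "near G n u v \<Longrightarrow> u \<in> pverts G \<Longrightarrow> (\<And>w. near G n u w \<Longrightarrow> w \<in> W) \<Longrightarrow> near (induce G W) n u v"
proof (induction n arbitrary: u)
  case (Suc n)
  then obtain w where w: "w \<in> pverts G" "w = u \<or> (u, w) \<in> parcs G" "near G n w v" by auto
  have "near (induce G W) n w v"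
    by (rule Suc.IH) (use w Suc.prems in auto)
  moreover have "u \<in> W" using Suc.prems near_refl by metis
  moreover have "w \<in> W" using w Suc.prems(3)[of w] near_refl[of w G n] by auto
  ultimately show ?case using w by (auto simp: induce_def)
qed simp

lemma (in pair_wf_digraph) awalk_iff_near:
  assumes "u \<in> pverts G"
  shows "(\<exists>p. awalk u p v \<and> length p \<le> n) \<longleftrightarrow> near G n u v"
  using assms
proof (induction n arbitrary: u)
  case 0
  then show ?case by (auto simp: awalk_Nil_iff)
next
  case (Suc n)
  have arc: "w \<in> pverts G" if "(u, w) \<in> parcs G" for w
    using that in_arcsD2 by blast
  show ?case
  proof
    assume "\<exists>p. awalk u p v \<and> length p \<le> Suc n"
    then obtain p where p: "awalk u p v" "length p \<le> Suc n" by blast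
    show "near G (Suc n) u v"
    proof (cases p)
      case Nil
      then have "u = v" using p by (simp add: awalk_Nil_iff)
      then show ?thesis using Suc.prems near_refl by metis
    next
      case (Cons a q)
      then obtain w where "a = (u, w)" "(u, w) \<in> parcs G" "awalk w q v"
        using p by (cases a) (auto simp: awalk_Cons_iff)
      moreover from this have "near G n w v" using Suc.IH[of w] p Cons arc by auto
      ultimately show ?thesis using arc by auto
    qed
  next
    assume "near G (Suc n) u v"
    then obtain w where w: "w \<in> pverts G" "w = u \<or> (u, w) \<in> parcs G" "near G n w v" by auto
    then obtain p where p: "awalk w p v" "length p \<le> n" using Suc.IH by blast
    from w(2) show "\<exists>p. awalk u p v \<and> length p \<le> Suc n"
    proof
      assume "(u, w) \<in> parcs G"
      then have "awalk u ((u, w) # p) v" using p by (simp add: awalk_Cons_iff)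
      then show ?thesis using p by (intro exI[of _ "(u, w) # p"]) simp
    next
      assume "w = u"
      then show ?thesis using p by (intro exI[of _ p]) simp
    qed
  qed
qed

lemma gdist_le_iff:
  assumes "pair_graph G" "u \<in> pverts G"
  shows "gdist G u v \<le> ereal (real n) \<longleftrightarrow> near G n u v"
proof -
  interpret pair_graph G by fact
  have cost: "awalk_cost (\<lambda>_. 1) p = real (length p)" for p :: "('a \<times> 'a) list"
    by (induction p) auto
  have "gdist G u v \<le> ereal (real n) \<longleftrightarrow> (\<exists>p. awalk u p v \<and> length p \<le> n)"
  proof
    assume "gdist G u v \<le> ereal (real n)"
    \<comment> \<open>The distance is an infimum. The strict bound \<open>n + 1\<close> yields an
      actual walk, and its length, being an integer, is then at most \<open>n\<close>.\<close>
    then have "gdist G u v < ereal (real (Suc n))"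
      by (rule le_less_trans) simp
    then show "\<exists>p. awalk u p v \<and> length p \<le> n"
      unfolding gdist_def \<mu>_def by (auto simp: INF_less_iff cost)
  next
    assume "\<exists>p. awalk u p v \<and> length p \<le> n"
    then show "gdist G u v \<le> ereal (real n)"
      unfolding gdist_def \<mu>_def by (auto intro: INF_lower2 simp: cost)
  qed
  then show ?thesis using awalk_iff_near[OF assms(2)] by simp
qed

subsection \<open>Strongly local formulas\<close>

text \<open>Truth is preserved in every \<open>W\<close> that contains the balls, not only in their
  union. This makes the notion monotone in the radius, so formulas of different radii can be
  collected in one set.\<close>

definition strongly_local :: "nat \<Rightarrow> fm \<Rightarrow> bool" where
  "strongly_local r \<phi> \<longleftrightarrow>
     (\<forall>(G :: ngraph) C e. pair_graph G \<longrightarrow> e ` fvars \<phi> \<subseteq> pverts G \<longrightarrow>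
        (sat G C e \<phi> \<longrightarrow> (\<forall>i\<in>fvars \<phi>. \<forall>j\<in>fvars \<phi>. near G r (e i) (e j))) \<and>
        (\<forall>W\<subseteq>pverts G. (\<forall>i\<in>fvars \<phi>. \<forall>v. near G r (e i) v \<longrightarrow> v \<in> W) \<longrightarrow>
           sat (induce G W) C e \<phi> = sat G C e \<phi>))"

lemma strongly_local_near:
  fixes G :: ngraph
  assumes "strongly_local r \<phi>" "pair_graph G" "e ` fvars \<phi> \<subseteq> pverts G" "sat G C e \<phi>"
    "i \<in> fvars \<phi>" "j \<in> fvars \<phi>"
  shows "near G r (e i) (e j)"
  using assms(1)[unfolded strongly_local_def, THEN spec[of _ G], THEN spec[of _ C],
      THEN spec[of _ e], THEN mp, OF assms(2), THEN mp, OF assms(3), THEN conjunct1] assms(4-6)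
  by simp

lemma strongly_local_induce:
  fixes G :: ngraph
  assumes "strongly_local r \<phi>" "pair_graph G" "e ` fvars \<phi> \<subseteq> pverts G" "W \<subseteq> pverts G"
    "\<And>i v. i \<in> fvars \<phi> \<Longrightarrow> near G r (e i) v \<Longrightarrow> v \<in> W"
  shows "sat (induce G W) C e \<phi> = sat G C e \<phi>"
  using assms(1)[unfolded strongly_local_def, THEN spec[of _ G], THEN spec[of _ C],
      THEN spec[of _ e], THEN mp, OF assms(2), THEN mp, OF assms(3), THEN conjunct2] assms(4,5)
  by simp

lemma strongly_local_mono:
  assumes "strongly_local r \<phi>" "r \<le> r'"
  shows "strongly_local r' \<phi>"
  unfolding strongly_local_def
proof (intro allI impI conjI ballI)
  fix G :: ngraph and C e
  assume G: "pair_graph G" and e: "e ` fvars \<phi> \<subseteq> pverts G"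
  {
    fix i j assume *: "sat G C e \<phi>" "i \<in> fvars \<phi>" "j \<in> fvars \<phi>"
    then have "e j \<in> pverts G" using e by blast
    then show "near G r' (e i) (e j)"
      using near_mono[OF strongly_local_near[OF assms(1) G e *] assms(2)] by blast
  next
    fix W assume W: "W \<subseteq> pverts G" "\<forall>i\<in>fvars \<phi>. \<forall>v. near G r' (e i) v \<longrightarrow> v \<in> W"
    show "sat (induce G W) C e \<phi> = sat G C e \<phi>"
    proof (rule strongly_local_induce[OF assms(1) G e W(1)])
      fix i v assume i: "i \<in> fvars \<phi>" "near G r (e i) v"
      then have "v \<in> pverts G" using near_verts[OF i(2)] e by blast
      then show "v \<in> W" using W(2) i(1) near_mono[OF i(2) assms(2)] by blast
    qed
  }
qed

lemma strongly_local_atoms: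
  shows strongly_local_Eq: "strongly_local 1 (Eq x y)"
    and strongly_local_Adj: "strongly_local 1 (Adj x y)"
    and strongly_local_Col: "strongly_local 1 (Col s x)"
proof -
  show "strongly_local 1 (Eq x y)"
    by (auto simp: strongly_local_def)
  show "strongly_local 1 (Col s x)"
    by (auto simp: strongly_local_def)
  show "strongly_local 1 (Adj x y)"
    unfolding strongly_local_def
  proof (intro allI impI conjI ballI)
    fix G :: ngraph and C e
    assume G: "pair_graph G" and e: "e ` fvars (Adj x y) \<subseteq> pverts G"
    {
      fix i j assume "sat G C e (Adj x y)" "i \<in> fvars (Adj x y)" "j \<in> fvars (Adj x y)"
      then show "near G 1 (e i) (e j)" using G e by (auto simp: pair_graph_iff sym_def)
    next
      fix W assume "\<forall>i\<in>fvars (Adj x y). \<forall>v. near G 1 (e i) v \<longrightarrow> v \<in> W"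
      then have "e x \<in> W" "e y \<in> W" using near_refl e by auto
      then show "sat (induce G W) C e (Adj x y) = sat G C e (Adj x y)" by (simp add: induce_def)
    }
  qed
qed

lemma strongly_local_Dle: "strongly_local n (Dle n x y)"
  unfolding strongly_local_def fvars_Dle sat_Dle
proof (intro allI impI conjI ballI)
  fix G :: ngraph and e :: "nat \<Rightarrow> nat"
  assume G: "pair_graph G" and e: "e ` {x, y} \<subseteq> pverts G"
  {
    fix i j assume "near G n (e x) (e y)" "i \<in> {x, y}" "j \<in> {x, y}"
    then show "near G n (e i) (e j)" using near_sym[OF G] near_refl e by auto
  next
    fix W assume "\<forall>i\<in>{x, y}. \<forall>v. near G n (e i) v \<longrightarrow> v \<in> W"
    then show "near (induce G W) n (e x) (e y) = near G n (e x) (e y)"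
      using near_induce[OF G, of n "e x" "e y" W] near_induce_mono[of G W n "e x" "e y"] e by auto
  }
qed

section \<open>Witnesses close to a free variable\<close>

definition Nearby :: "nat \<Rightarrow> nat \<Rightarrow> nat \<Rightarrow> nat set \<Rightarrow> fm set \<Rightarrow> fm set \<Rightarrow> fm" where
  "Nearby R x y J \<tau> \<sigma> =
     And (Conj (Dle (2 * R) y ` J)) (Ex x (And (Dle R x y) (And (Conj \<tau>) (Conj (Neg ` \<sigma>)))))"

lemma sat_Nearby:
  assumes "finite J" "finite \<tau>" "finite \<sigma>" "x \<noteq> y"
  shows "sat G C e (Nearby R x y J \<tau> \<sigma>) \<longleftrightarrow>
    (\<forall>j\<in>J. near G (2 * R) (e y) (e j)) \<and>
    (\<exists>v\<in>pverts G. near G R v (e y) \<and> (\<forall>\<psi>\<in>\<tau>. sat G C (e(x := v)) \<psi>) \<and>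
       (\<forall>\<psi>\<in>\<sigma>. \<not> sat G C (e(x := v)) \<psi>))"
  using assms by (simp add: Nearby_def sat_Conj sat_Dle)

lemma fvars_Nearby:
  assumes "finite J" "finite \<tau>" "finite \<sigma>" "x \<notin> J" "y \<in> J"
    "\<And>\<psi>. \<psi> \<in> \<tau> \<union> \<sigma> \<Longrightarrow> fvars \<psi> \<subseteq> insert x J"
  shows "fvars (Nearby R x y J \<tau> \<sigma>) = J"
proof -
  have "fvars (Nearby R x y J \<tau> \<sigma>) =
      J \<union> {y} \<union> ((\<Union>\<psi>\<in>\<tau> \<union> \<sigma>. fvars \<psi>) \<union> {x, y} - {x})"
    using assms(4,5) by (auto simp: Nearby_def fvars_Conj assms(1-3) fvars_Dle)
  moreover have "(\<Union>\<psi>\<in>\<tau> \<union> \<sigma>. fvars \<psi>) \<subseteq> insert x J"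
    using assms(6) by (rule UN_least)
  ultimately show ?thesis using assms(4,5) by blast
qed

lemma symbols_Nearby:
  assumes "finite J" "finite \<tau>" "finite \<sigma>"
  shows "symbols (Nearby R x y J \<tau> \<sigma>) = (\<Union>\<psi>\<in>\<tau> \<union> \<sigma>. symbols \<psi>)"
  using assms by (simp add: Nearby_def symbols_Conj symbols_Dle image_image)

text \<open>Any two variables in \<open>J\<close> are linked through \<open>y\<close>, which gives
  2R + 2R. The witness lies within \<open>R\<close> of \<open>y\<close>, so the
  \<open>R\<close>-ball that the subformulas inspect around it lies within 2R of \<open>y\<close>;
  as \<open>y\<close> is itself in \<open>J\<close>, this ball is contained in
  \<open>W\<close>.\<close>

lemma strongly_local_Nearby:
  assumes fin: "finite J" "finite \<tau>" "finite \<sigma>" and x: "x \<notin> J" "y \<in> J"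
    and fv: "\<And>\<psi>. \<psi> \<in> \<tau> \<union> \<sigma> \<Longrightarrow> fvars \<psi> \<subseteq> insert x J"
    and loc: "\<And>\<psi>. \<psi> \<in> \<tau> \<union> \<sigma> \<Longrightarrow> strongly_local R \<psi>"
  shows "strongly_local (4 * R) (Nearby R x y J \<tau> \<sigma>)" (is "strongly_local _ ?N")
proof -
  have xy: "x \<noteq> y" using x by auto
  note sat = sat_Nearby[OF fin xy]
  have fvN: "fvars ?N = J" by (rule fvars_Nearby[OF fin x fv])
  show ?thesis
    unfolding strongly_local_def fvN
  proof (intro allI impI conjI ballI)
    fix G :: ngraph and C e
    assume G: "pair_graph G" and e: "e ` J \<subseteq> pverts G"
    {
      fix i j assume *: "sat G C e ?N" "i \<in> J" "j \<in> J"
      then have "near G (2 * R) (e i) (e y)" "near G (2 * R) (e y) (e j)"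
        using near_sym[OF G] e x unfolding sat by blast+
      from near_trans[OF this] show "near G (4 * R) (e i) (e j)" by simp
    next
      fix W assume W: "W \<subseteq> pverts G" "\<forall>i\<in>J. \<forall>v. near G (4 * R) (e i) v \<longrightarrow> v \<in> W"
      have W': "v \<in> W" if "near G m (e i) v" "m \<le> 4 * R" "i \<in> J" for m i v
      proof -
        have "v \<in> pverts G" using near_verts[OF that(1)] that(3) e by blast
        then show ?thesis using W(2) that near_mono[OF that(1,2)] by blast
      qed
      have D: "near (induce G W) (2 * R) (e y) (e j) = near G (2 * R) (e y) (e j)" for j
      proof
        assume "near G (2 * R) (e y) (e j)"
        then show "near (induce G W) (2 * R) (e y) (e j)"
          by (rule near_induce[OF G]) (use W' e x in auto)
      qed (rule near_induce_mono)
      have I: "near (induce G W) R v (e y) \<longleftrightarrow> near G R v (e y)"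
        and T: "\<psi> \<in> \<tau> \<union> \<sigma> \<Longrightarrow> sat (induce G W) C (e(x := v)) \<psi> = sat G C (e(x := v)) \<psi>"
        if v: "v \<in> pverts G" "near G R v (e y)" for v \<psi>
      proof -
        have ball: "w \<in> W" if "near G R v w" for w
          using W'[OF near_trans[OF near_sym[OF G v(2,1)] that]] x by auto
        show "near (induce G W) R v (e y) \<longleftrightarrow> near G R v (e y)"
          using near_induce_mono[of G W R v "e y"] near_induce[OF G v(2,1), of W] ball by auto
        assume \<psi>: "\<psi> \<in> \<tau> \<union> \<sigma>"
        show "sat (induce G W) C (e(x := v)) \<psi> = sat G C (e(x := v)) \<psi>"
        proof (rule strongly_local_induce[OF loc[OF \<psi>] G _ W(1)])
          show "(e(x := v)) ` fvars \<psi> \<subseteq> pverts G" using fv[OF \<psi>] v e by auto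
          fix i w assume i: "i \<in> fvars \<psi>" "near G R ((e(x := v)) i) w"
          show "w \<in> W"
          proof (cases "i = x")
            case True
            then show ?thesis using ball i by simp
          next
            case False
            then show ?thesis using W'[of R i w] i fv[OF \<psi>] by auto
          qed
        qed
      qed
      have V: "v \<in> W" if "v \<in> pverts G" "near G R v (e y)" for v
        using W'[OF near_sym[OF G that(2,1)]] x by auto
      have P: "pverts (induce G W) = W" using W(1) by (auto simp: induce_def)
      show "sat (induce G W) C e ?N = sat G C e ?N"
      proof
        assume "sat (induce G W) C e ?N"
        then obtain v where v: "v \<in> W" "near (induce G W) R v (e y)"
          "\<forall>\<psi>\<in>\<tau>. sat (induce G W) C (e(x := v)) \<psi>" "\<forall>\<psi>\<in>\<sigma>. \<not> sat (induce G W) C (e(x := v)) \<psi>"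
          and J: "\<forall>j\<in>J. near (induce G W) (2 * R) (e y) (e j)"
          unfolding sat P by blast
        have v': "v \<in> pverts G" "near G R v (e y)" using v(1) W(1) near_induce_mono[OF v(2)] by auto
        show "sat G C e ?N"
          unfolding sat using J v v'(1) by (intro conjI bexI[of _ v]) (auto simp: D v'(2) T[OF v'])
      next
        assume "sat G C e ?N"
        then obtain v where v: "v \<in> pverts G" "near G R v (e y)"
          "\<forall>\<psi>\<in>\<tau>. sat G C (e(x := v)) \<psi>" "\<forall>\<psi>\<in>\<sigma>. \<not> sat G C (e(x := v)) \<psi>"
          and J: "\<forall>j\<in>J. near G (2 * R) (e y) (e j)"
          unfolding sat by blast
        show "sat (induce G W) C e ?N"
          unfolding sat P using J v
          by (intro conjI bexI[of _ v]) (auto simp: D V I[OF v(1,2)] T[OF v(1,2)])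
      qed
    }
  qed
qed

text \<open>Either \<open>A\<close> contains more than \<open>k\<close> vertices pairwise at distance more than \<open>2r\<close>, so that one
  of them avoids the balls of radius \<open>r\<close> around any \<open>k\<close> vertices, or the balls of radius \<open>2r\<close>
  around at most \<open>k\<close> vertices cover \<open>A\<close>. The sets \<open>N j\<close> are the balls of radius \<open>3r\<close> around
  these.\<close>

lemma far_vertex_transfer:
  fixes G :: "'a pair_pre_digraph"
  assumes G: "pair_graph G" and A: "A \<subseteq> pverts G"
  shows "\<exists>N :: nat \<Rightarrow> 'a set. \<forall>U U' v.
    U \<subseteq> pverts G \<longrightarrow> U' \<subseteq> pverts G \<longrightarrow> card U' \<le> k \<longrightarrow>
    (\<forall>j<k. U \<inter> N j = {} \<longrightarrow> U' \<inter> N j = {}) \<longrightarrow>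
    v \<in> A \<longrightarrow> (\<forall>u\<in>U. \<not> near G (5 * r) v u) \<longrightarrow> (\<exists>v'\<in>A. \<forall>u\<in>U'. \<not> near G r v' u)"
proof -
  define scat where "scat S \<longleftrightarrow> S \<subseteq> A \<and> (\<forall>a\<in>S. \<forall>b\<in>S. a \<noteq> b \<longrightarrow> \<not> near G (2 * r) a b)" for S
  have finV: "finite (pverts G)" using G by (simp add: pair_graph_iff)
  show ?thesis
  proof (cases "\<exists>S. scat S \<and> card S = Suc k")
    case True
    then obtain S where S: "scat S" "card S = Suc k" by blast
    have *: "\<exists>v'\<in>A. \<forall>u\<in>U'. \<not> near G r v' u" if U': "U' \<subseteq> pverts G" "card U' \<le> k" for U'
    proof (rule ccontr)
      assume "\<not> ?thesis"
      then have "\<forall>a\<in>S. \<exists>u. u \<in> U' \<and> near G r a u" using S(1) unfolding scat_def by blast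
      then obtain f where f: "\<forall>a\<in>S. f a \<in> U' \<and> near G r a (f a)" by metis
      \<comment> \<open>Two members of \<open>S\<close> with the same image would be within r + r of
        each other, but \<open>S\<close> is scattered at distance 2r.\<close>
      have "inj_on f S"
      proof (rule inj_onI, rule ccontr)
        fix a b assume ab: "a \<in> S" "b \<in> S" "f a = f b" "a \<noteq> b"
        have "b \<in> pverts G" using S(1) A ab unfolding scat_def by blast
        then have "near G r (f a) b" using near_sym[OF G, of r b "f b"] f ab by auto
        then have "near G (2 * r) a b" using near_trans[of G r a "f b" r b] f ab
          by (metis mult_2)
        then show False using S(1) ab unfolding scat_def by blast
      qed
      moreover have "finite U'" using U' finV finite_subset by blast
      ultimately have "card S \<le> card U'" using f by (intro card_inj_on_le[of f]) auto
      then show False using S(2) U' by simp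
    qed
    show ?thesis by (intro exI[of _ "\<lambda>_. {}"] allI impI) (rule *; assumption)
  next
    case False
    have le: "card S \<le> k" if "scat S" for S
    proof (rule ccontr)
      assume "\<not> card S \<le> k"
      then have "Suc k \<le> card S" by simp
      then obtain S' where "S' \<subseteq> S" "card S' = Suc k" by (meson obtain_subset_with_card_n)
      moreover have "scat S'" using \<open>S' \<subseteq> S\<close> that unfolding scat_def by blast
      ultimately show False using False by blast
    qed
    \<comment> \<open>A scattered set of maximal size: every vertex of \<open>A\<close> is then
      within 2r of it, for otherwise it could be added.\<close>
    have "scat {}" by (simp add: scat_def)
    then have "\<exists>S. scat S \<and> (\<forall>S'. scat S' \<longrightarrow> card S' \<le> card S)"
      by (rule ex_has_greatest_nat[of scat "{}" card "Suc k"]) (use le in \<open>auto simp: less_Suc_eq_le\<close>)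
    then obtain S where S: "scat S" and max: "\<And>S'. scat S' \<Longrightarrow> card S' \<le> card S"
      by blast
    have finS: "finite S" using S A finV finite_subset unfolding scat_def by metis
    obtain z where z: "z ` {..<card S} = S"
      using ex_bij_betw_nat_finite[OF finS] by (auto simp: bij_betw_def atLeast0LessThan)
    \<comment> \<open>The sets beyond the size of \<open>S\<close> are empty, so that the number of
      sets is \<open>k\<close> for every graph.\<close>
    define N where "N j = (if j < card S then {v. near G (3 * r) (z j) v} else {})" for j
    have *: "\<exists>v'\<in>A. \<forall>u\<in>U'. \<not> near G r v' u"
      if U: "U \<subseteq> pverts G" "U' \<subseteq> pverts G" and UN: "\<forall>j<k. U \<inter> N j = {} \<longrightarrow> U' \<inter> N j = {}"
        and v: "v \<in> A" and far: "\<forall>u\<in>U. \<not> near G (5 * r) v u" for U U' v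
    proof -
      have "\<exists>s\<in>S. near G (2 * r) s v"
      proof (cases "v \<in> S")
        case True
        moreover have "near G (2 * r) v v" using near_refl[of v G] v A by blast
        ultimately show ?thesis by blast
      next
        case vS: False
        then have "\<not> scat (insert v S)" using max[of "insert v S"] finS by auto
        then obtain s where "s \<in> S" "near G (2 * r) s v \<or> near G (2 * r) v s"
          using S v unfolding scat_def by blast
        moreover have "v \<in> pverts G" using v A by blast
        ultimately show ?thesis using near_sym[OF G, of "2 * r" v s] by blast
      qed
      then obtain s where s: "s \<in> z ` {..<card S}" "near G (2 * r) s v" unfolding z by blast
      then obtain j where j: "j < card S" "near G (2 * r) (z j) v" by blast
      have zj: "z j \<in> pverts G" using z j S A unfolding scat_def by blast
      \<comment> \<open>A common element would be within 2r + 3r = 5r of \<open>v\<close>.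
        Conversely the \<open>r\<close>-ball around \<open>v\<close> is contained in
        \<open>N j\<close>, since 2r + r = 3r; once \<open>U'\<close> avoids \<open>N j\<close>, the
        vertex \<open>v\<close> itself is the required far vertex.\<close>
      have "U \<inter> N j = {}"
      proof (rule ccontr)
        assume "U \<inter> N j \<noteq> {}"
        then obtain u where u: "u \<in> U" "near G (3 * r) (z j) u" using j by (auto simp: N_def)
        have "near G (5 * r) v u" using near_trans[OF near_sym[OF G j(2) zj] u(2)] by simp
        then show False using far u by blast
      qed
      then have "U' \<inter> N j = {}" using UN j le[OF S] by simp
      moreover have "near G (3 * r) (z j) u" if "near G r v u" for u
        using near_trans[OF j(2) that] by (simp add: algebra_simps)
      ultimately show ?thesis using v j by (auto simp: N_def)
    qed
    show ?thesis by (intro exI[of _ N] allI impI) (rule *; assumption)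
  qed
qed

subsection \<open>Local determination of formulas\<close>

text \<open>Both assignments live in the same coloured graph: the Boolean function that computes
  \<open>\<phi>\<close> from \<open>L\<close> may differ from graph to graph. This is what is weaker
  than in Gaifman's theorem. The implication suffices because the assignments can be
  exchanged.\<close>

definition determines :: "ngraph \<Rightarrow> (nat \<Rightarrow> nat set) \<Rightarrow> fm set \<Rightarrow> fm \<Rightarrow> bool" where
  "determines G C L \<phi> \<longleftrightarrow>
     (\<forall>e e'. e ` fvars \<phi> \<subseteq> pverts G \<longrightarrow> e' ` fvars \<phi> \<subseteq> pverts G \<longrightarrow>
        (\<forall>\<psi>\<in>L. sat G C e \<psi> = sat G C e' \<psi>) \<longrightarrow> sat G C e \<phi> \<longrightarrow> sat G C e' \<phi>)"

lemma determinesD: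
  assumes "determines G C L \<phi>" "e ` fvars \<phi> \<subseteq> pverts G" "e' ` fvars \<phi> \<subseteq> pverts G"
    "\<And>\<psi>. \<psi> \<in> L \<Longrightarrow> sat G C e \<psi> = sat G C e' \<psi>"
  shows "sat G C e \<phi> = sat G C e' \<phi>"
  using assms(1)[unfolded determines_def, THEN spec[of _ e], THEN spec[of _ e']]
    assms(1)[unfolded determines_def, THEN spec[of _ e'], THEN spec[of _ e]] assms(2-)
  by metis

lemma sat_agree:
  assumes "symbols \<phi> \<subseteq> {..<n}" "\<forall>s<n. C' s = C s" "e ` fvars \<phi> \<subseteq> pverts G"
  shows "sat G C' e \<phi> = sat G C e \<phi>"
  by (rule sat_cong) (use assms in auto)

text \<open>Symbols from \<open>n\<close> on may be recoloured later without harm; this lets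
  colourings be built up in stages.\<close>

lemma determines_agree:
  assumes "determines G C L \<phi>" "symbols \<phi> \<subseteq> {..<n}" "\<And>\<psi>. \<psi> \<in> L \<Longrightarrow> symbols \<psi> \<subseteq> {..<n}"
    "\<And>\<psi>. \<psi> \<in> L \<Longrightarrow> fvars \<psi> \<subseteq> fvars \<phi>" "\<forall>s<n. C' s = C s"
  shows "determines G C' L \<phi>"
  unfolding determines_def
proof (intro allI impI)
  fix e e'
  assume e: "e ` fvars \<phi> \<subseteq> pverts G" "e' ` fvars \<phi> \<subseteq> pverts G"
    and L: "\<forall>\<psi>\<in>L. sat G C' e \<psi> = sat G C' e' \<psi>" and "sat G C' e \<phi>"
  have "sat G C e \<psi> = sat G C e' \<psi>" if "\<psi> \<in> L" for \<psi>
  proof -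
    have e\<psi>: "e ` fvars \<psi> \<subseteq> pverts G" "e' ` fvars \<psi> \<subseteq> pverts G" using e assms(4)[OF that] by blast+
    show ?thesis
      using sat_agree[OF assms(3)[OF that] assms(5) e\<psi>(1)]
        sat_agree[OF assms(3)[OF that] assms(5) e\<psi>(2)] L that by simp
  qed
  from determinesD[OF assms(1) e this] have "sat G C e \<phi> = sat G C e' \<phi>" by blast
  then show "sat G C' e' \<phi>"
    using \<open>sat G C' e \<phi>\<close> sat_agree[OF assms(2,5) e(1)] sat_agree[OF assms(2,5) e(2)] by simp
qed

lemma determines_self: "determines G C {\<phi>} \<phi>"
  unfolding determines_def by simp

text \<open>Given a witness for \<open>e\<close>, a witness for \<open>e'\<close> is found that
  gives all formulas in \<open>L\<close> the same values. The threshold between near and far is 5r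
  because \<open>far_vertex_transfer\<close> consumes distance 5r to produce distance r; variables
  are then compared at 10r, twice this threshold. The assumptions \<open>eL\<close> to
  \<open>eB\<close> are what agreement on the new set of local formulas provides.\<close>

lemma determines_Ex:
  fixes G :: ngraph
  assumes G: "pair_graph G" and det: "determines G C L \<phi>" and fin: "finite L"
    and loc: "\<And>\<psi>. \<psi> \<in> L \<Longrightarrow> strongly_local r \<psi>" and fv: "\<And>\<psi>. \<psi> \<in> L \<Longrightarrow> fvars \<psi> \<subseteq> fvars \<phi>"
    and F: "F = fvars \<phi> - {x}"
    and idx: "inj_on idx (Pow {\<psi> \<in> L. fvars \<psi> \<subseteq> {x}})"
    and N: "\<And>t U U' v. U \<subseteq> pverts G \<Longrightarrow> U' \<subseteq> pverts G \<Longrightarrow> card U' \<le> card F \<Longrightarrow>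
        \<forall>j<card F. U \<inter> N t j = {} \<longrightarrow> U' \<inter> N t j = {} \<Longrightarrow> v \<in> pverts G \<Longrightarrow>
        idx {\<psi> \<in> L. fvars \<psi> \<subseteq> {x} \<and> sat G C (\<lambda>_. v) \<psi>} = t \<Longrightarrow>
        \<forall>u\<in>U. \<not> near G (5 * r) v u \<Longrightarrow>
        \<exists>v'\<in>pverts G. idx {\<psi> \<in> L. fvars \<psi> \<subseteq> {x} \<and> sat G C (\<lambda>_. v') \<psi>} = t \<and>
          (\<forall>u\<in>U'. \<not> near G r v' u)"
    and e: "e ` F \<subseteq> pverts G" "e' ` F \<subseteq> pverts G"
    and eL: "\<And>\<psi>. \<psi> \<in> L \<Longrightarrow> x \<notin> fvars \<psi> \<Longrightarrow> sat G C e \<psi> = sat G C e' \<psi>"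
    and eD: "\<And>y j. y \<in> F \<Longrightarrow> j \<in> F \<Longrightarrow> near G (10 * r) (e y) (e j) = near G (10 * r) (e' y) (e' j)"
    and eN: "\<And>y t j. y \<in> F \<Longrightarrow> t \<in> idx ` Pow {\<psi> \<in> L. fvars \<psi> \<subseteq> {x}} \<Longrightarrow> j < card F \<Longrightarrow>
        e y \<in> N t j \<longleftrightarrow> e' y \<in> N t j"
    and eB: "\<And>y J \<tau>. y \<in> J \<Longrightarrow> J \<subseteq> F \<Longrightarrow> \<tau> \<subseteq> {\<psi> \<in> L. fvars \<psi> \<subseteq> insert x J} \<Longrightarrow>
        sat G C e (Nearby (5 * r) x y J \<tau> ({\<psi> \<in> L. fvars \<psi> \<subseteq> insert x J} - \<tau>)) \<Longrightarrow>
        sat G C e' (Nearby (5 * r) x y J \<tau> ({\<psi> \<in> L. fvars \<psi> \<subseteq> insert x J} - \<tau>))"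
    and sat: "sat G C e (Ex x \<phi>)"
  shows "sat G C e' (Ex x \<phi>)"
proof -
  from sat obtain v where v: "v \<in> pverts G" "sat G C (e(x := v)) \<phi>" by auto
  have finF: "finite F" using F finite_fvars by simp
  have ev: "e(x := w) ` fvars \<psi> \<subseteq> pverts G" "e'(x := w) ` fvars \<psi> \<subseteq> pverts G"
    if "w \<in> pverts G" "fvars \<psi> \<subseteq> fvars \<phi>" for w \<psi>
    using that e F by auto
  have unary: "sat G C (d(x := w)) \<psi> = sat G C (\<lambda>_. w) \<psi>"
    if "fvars \<psi> \<subseteq> {x}" "w \<in> pverts G" for d w \<psi>
    by (rule sat_cong) (use that in auto)
  have free: "sat G C (e(x := w)) \<psi> = sat G C (e'(x := w')) \<psi>"
    if "\<psi> \<in> L" "x \<notin> fvars \<psi>" "w \<in> pverts G" "w' \<in> pverts G" for w w' \<psi>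
  proof -
    have "sat G C (e(x := w)) \<psi> = sat G C e \<psi>"
      by (rule sat_cong) (use that e fv F in \<open>auto simp: image_subset_iff\<close>)
    moreover have "sat G C (e'(x := w')) \<psi> = sat G C e' \<psi>"
      by (rule sat_cong) (use that e fv F in \<open>auto simp: image_subset_iff\<close>)
    ultimately show ?thesis using eL[OF that(1,2)] by simp
  qed
  have "\<exists>v'\<in>pverts G. \<forall>\<psi>\<in>L. sat G C (e(x := v)) \<psi> = sat G C (e'(x := v')) \<psi>"
  proof (cases "\<exists>y\<in>F. near G (5 * r) v (e y)")
    case True
    then obtain y where y: "y \<in> F" "near G (5 * r) v (e y)" by blast
    have vy: "near G (5 * r) (e y) v" using near_sym[OF G y(2) v(1)] .
    \<comment> \<open>Only the variables within 10r of \<open>y\<close> can interact with a witness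
      within 5r of \<open>y\<close>; they are the ones that a strongly local formula around
      \<open>y\<close> may mention. \<open>\<tau>\<close> is the exact type of the witness over
      them.\<close>
    define J where "J = {j \<in> F. near G (10 * r) (e y) (e j)}"
    define LJ where "LJ = {\<psi> \<in> L. fvars \<psi> \<subseteq> insert x J}"
    define \<tau> where "\<tau> = {\<psi> \<in> LJ. sat G C (e(x := v)) \<psi>}"
    have J: "y \<in> J" "J \<subseteq> F" "finite J"
      using y near_refl[of "e y" G "10 * r"] e finF unfolding J_def by auto
    have \<tau>: "\<tau> \<subseteq> LJ" "finite \<tau>" "finite (LJ - \<tau>)" using fin by (auto simp: \<tau>_def LJ_def)
    have "x \<noteq> y" using y F by blast
    note satN = sat_Nearby[OF J(3) \<tau>(2,3) this, of G C _ "5 * r"]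
    have "sat G C e (Nearby (5 * r) x y J \<tau> (LJ - \<tau>))"
      unfolding satN using v y(2) by (auto simp: J_def \<tau>_def)
    then have "sat G C e' (Nearby (5 * r) x y J \<tau> (LJ - \<tau>))"
      using eB[OF J(1,2)] \<tau>(1) unfolding LJ_def by blast
    then obtain v' where v': "v' \<in> pverts G" "near G (5 * r) v' (e' y)"
      "\<forall>\<psi>\<in>\<tau>. sat G C (e'(x := v')) \<psi>" "\<forall>\<psi>\<in>LJ - \<tau>. \<not> sat G C (e'(x := v')) \<psi>"
      unfolding satN by blast
    have vy': "near G (5 * r) (e' y) v'" using near_sym[OF G v'(2,1)] .
    have "sat G C (e(x := v)) \<psi> = sat G C (e'(x := v')) \<psi>" if \<psi>: "\<psi> \<in> L" for \<psi>
    proof -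
      consider "x \<notin> fvars \<psi>" | "\<psi> \<in> LJ" | j where "x \<in> fvars \<psi>" "j \<in> fvars \<psi>" "j \<notin> insert x J"
        using \<psi> unfolding LJ_def by blast
      then show ?thesis
      proof cases
        case 1
        then show ?thesis using free \<psi> v v' by blast
      next
        case 2
        then show ?thesis using v'(3,4) unfolding \<tau>_def by blast
      next
        case 3
        then have j: "j \<in> F" "j \<noteq> x" using fv[OF \<psi>] F by auto
        then have far: "\<not> near G (10 * r) (e y) (e j)" "\<not> near G (10 * r) (e' y) (e' j)"
          using 3 eD[OF y(1)] unfolding J_def by blast+
        \<comment> \<open>If it held, strong locality would put \<open>w\<close> within r, hence 5r,
          of the value of \<open>j\<close>; with 5r from \<open>y\<close> to \<open>w\<close> this
          places \<open>j\<close> within 10r of \<open>y\<close>. Stated for arbitrary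
          \<open>d\<close> and \<open>w\<close> to serve both assignments.\<close>
        have "\<not> sat G C (d(x := w)) \<psi>"
          if d: "d(x := w) ` fvars \<psi> \<subseteq> pverts G" "near G (5 * r) (d y) w"
            "\<not> near G (10 * r) (d y) (d j)" "d j \<in> pverts G" for d w
        proof
          assume "sat G C (d(x := w)) \<psi>"
          from strongly_local_near[OF loc[OF \<psi>] G d(1) this 3(1,2)]
          have "near G r w (d j)" using j by simp
          then have "near G (5 * r) w (d j)" by (rule near_mono) (use d in auto)
          from near_trans[OF d(2) this] show False using d(3) by simp
        qed
        moreover have "e j \<in> pverts G" "e' j \<in> pverts G" using e j by blast+
        ultimately show ?thesis
          using ev(1)[OF v(1) fv[OF \<psi>]] ev(2)[OF v'(1) fv[OF \<psi>]] vy vy' far by blast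
      qed
    qed
    then show ?thesis using v'(1) by blast
  next
    case False
    define cls where "cls w = {\<psi> \<in> L. fvars \<psi> \<subseteq> {x} \<and> sat G C (\<lambda>_. w) \<psi>}" for w
    have cls: "cls w \<in> Pow {\<psi> \<in> L. fvars \<psi> \<subseteq> {x}}" for w by (auto simp: cls_def)
    have "card (e' ` F) \<le> card F" using finF by (rule card_image_le)
    moreover have "\<forall>j<card F. e ` F \<inter> N (idx (cls v)) j = {} \<longrightarrow> e' ` F \<inter> N (idx (cls v)) j = {}"
      using eN cls by blast
    moreover have "\<forall>u\<in>e ` F. \<not> near G (5 * r) v u" using False by blast
    ultimately obtain v' where v': "v' \<in> pverts G" "idx (cls v') = idx (cls v)"
      "\<forall>u\<in>e' ` F. \<not> near G r v' u"
      using N[OF e _ _ v(1) refl] unfolding cls_def by blast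
    \<comment> \<open>Injectivity of \<open>idx\<close> turns equal class numbers into equal sets of
      unary formulas.\<close>
    then have same: "cls v' = cls v" using idx cls by (meson inj_onD)
    have "sat G C (e(x := v)) \<psi> = sat G C (e'(x := v')) \<psi>" if \<psi>: "\<psi> \<in> L" for \<psi>
    proof -
      consider "x \<notin> fvars \<psi>" | "fvars \<psi> \<subseteq> {x}" | y where "x \<in> fvars \<psi>" "y \<in> fvars \<psi>" "y \<noteq> x"
        by blast
      then show ?thesis
      proof cases
        case 1
        then show ?thesis using free \<psi> v v' by blast
      next
        case 2
        then show ?thesis
          using unary[OF 2 v(1)] unary[OF 2 v'(1)] same \<psi> unfolding cls_def by blast
      next
        case 3
        then have y: "y \<in> F" using fv[OF \<psi>] F by auto
        have "\<not> sat G C (e(x := v)) \<psi>"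
        proof
          assume "sat G C (e(x := v)) \<psi>"
          from strongly_local_near[OF loc[OF \<psi>] G ev(1)[OF v(1) fv[OF \<psi>]] this 3(1,2)]
          have "near G r v (e y)" using 3 by simp
          then have "near G (5 * r) v (e y)" by (rule near_mono) (use e y in auto)
          then show False using False y by blast
        qed
        \<comment> \<open>The new witness is only known to be farther than r from the values of
          \<open>e'\<close>, which is enough since all formulas in \<open>L\<close> have radius
          r.\<close>
        moreover have "\<not> sat G C (e'(x := v')) \<psi>"
        proof
          assume "sat G C (e'(x := v')) \<psi>"
          from strongly_local_near[OF loc[OF \<psi>] G ev(2)[OF v'(1) fv[OF \<psi>]] this 3(1,2)]
          show False using v'(3) y 3 by simp
        qed
        ultimately show ?thesis by blast
      qed
    qed
    then show ?thesis using v'(1) by blast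
  qed
  then obtain v' where v': "v' \<in> pverts G"
    "\<And>\<psi>. \<psi> \<in> L \<Longrightarrow> sat G C (e(x := v)) \<psi> = sat G C (e'(x := v')) \<psi>" by blast
  have "sat G C (e'(x := v')) \<phi>"
    using determinesD[OF det ev(1)[OF v(1) subset_refl] ev(2)[OF v'(1) subset_refl] v'(2)] v(2)
    by simp
  then show ?thesis using v'(1) by auto
qed

section \<open>Local bases by induction on formulas\<close>

definition local_base :: "fm \<Rightarrow> nat \<Rightarrow> nat \<Rightarrow> fm set \<Rightarrow> nat \<Rightarrow> bool" where
  "local_base \<phi> n n' L r \<longleftrightarrow> n \<le> n' \<and> finite L \<and>
     (\<forall>\<psi>\<in>L. strongly_local r \<psi> \<and> fvars \<psi> \<subseteq> fvars \<phi> \<and> symbols \<psi> \<subseteq> {..<n'}) \<and>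
     (\<forall>(G :: ngraph) C. pair_graph G \<longrightarrow> (\<exists>C'. (\<forall>s<n. C' s = C s) \<and> determines G C' L \<phi>))"

lemma local_base_self:
  assumes "symbols \<phi> \<subseteq> {..<n}" "strongly_local r \<phi>"
  shows "local_base \<phi> n n {\<phi>} r"
  using assms determines_self by (auto simp: local_base_def)

text \<open>The base of the second formula is taken above \<open>n1\<close>, where the new symbols
  of the first one end. Its recolouring therefore leaves the first base intact.\<close>

lemma local_base_And:
  assumes 1: "local_base \<phi> n n1 L1 r1" and 2: "local_base \<psi> n1 n2 L2 r2"
    and sym: "symbols \<phi> \<subseteq> {..<n}"
  shows "local_base (And \<phi> \<psi>) n n2 (L1 \<union> L2) (max r1 r2)"
  unfolding local_base_def
proof (intro conjI ballI allI impI)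
  show "n \<le> n2" "finite (L1 \<union> L2)" using 1 2 by (simp_all add: local_base_def)
next
  fix \<chi> assume "\<chi> \<in> L1 \<union> L2"
  then consider "\<chi> \<in> L1" | "\<chi> \<in> L2" by blast
  then have "strongly_local (max r1 r2) \<chi> \<and> fvars \<chi> \<subseteq> fvars (And \<phi> \<psi>) \<and> symbols \<chi> \<subseteq> {..<n2}"
  proof cases
    case 1
    then have "strongly_local r1 \<chi>" "fvars \<chi> \<subseteq> fvars \<phi>" "symbols \<chi> \<subseteq> {..<n1}" "n1 \<le> n2"
      using assms(1,2) by (auto simp: local_base_def)
    then show ?thesis
      using strongly_local_mono[of r1 \<chi> "max r1 r2"] by auto
  next
    case 2
    then have "strongly_local r2 \<chi>" "fvars \<chi> \<subseteq> fvars \<psi>" "symbols \<chi> \<subseteq> {..<n2}"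
      using assms(1,2) by (auto simp: local_base_def)
    then show ?thesis
      using strongly_local_mono[of r2 \<chi> "max r1 r2"] by auto
  qed
  then show "strongly_local (max r1 r2) \<chi>" "fvars \<chi> \<subseteq> fvars (And \<phi> \<psi>)" "symbols \<chi> \<subseteq> {..<n2}"
    by simp_all
next
  fix G :: ngraph and C assume G: "pair_graph G"
  obtain C1 where C1: "\<forall>s<n. C1 s = C s" "determines G C1 L1 \<phi>"
    using 1 G unfolding local_base_def by metis
  obtain C2 where C2: "\<forall>s<n1. C2 s = C1 s" "determines G C2 L2 \<psi>"
    using 2 G unfolding local_base_def by metis
  have n: "n \<le> n1" using 1 by (simp add: local_base_def)
  have d1: "determines G C2 L1 \<phi>"
    by (rule determines_agree[OF C1(2) _ _ _ C2(1)])
      (use 1 sym n in \<open>auto simp: local_base_def\<close>)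
  have "determines G C2 (L1 \<union> L2) (And \<phi> \<psi>)"
    unfolding determines_def
  proof (intro allI impI)
    fix e e' assume e: "e ` fvars (And \<phi> \<psi>) \<subseteq> pverts G" "e' ` fvars (And \<phi> \<psi>) \<subseteq> pverts G"
      and L: "\<forall>\<chi>\<in>L1 \<union> L2. sat G C2 e \<chi> = sat G C2 e' \<chi>" and sat: "sat G C2 e (And \<phi> \<psi>)"
    have e': "e ` fvars \<phi> \<subseteq> pverts G" "e' ` fvars \<phi> \<subseteq> pverts G"
      "e ` fvars \<psi> \<subseteq> pverts G" "e' ` fvars \<psi> \<subseteq> pverts G"
      using e by (simp_all add: image_Un)
    show "sat G C2 e' (And \<phi> \<psi>)"
      using determinesD[OF d1 e'(1,2)] determinesD[OF C2(2) e'(3,4)] L sat by simp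
  qed
  moreover have "\<forall>s<n. C2 s = C s" using C1 C2 n by simp
  ultimately show "\<exists>C'. (\<forall>s<n. C' s = C s) \<and> determines G C' (L1 \<union> L2) (And \<phi> \<psi>)" by blast
qed

lemma determines_Neg:
  assumes "determines G C L \<phi>"
  shows "determines G C L (Neg \<phi>)"
  unfolding determines_def
proof (intro allI impI)
  fix e e'
  assume "e ` fvars (Neg \<phi>) \<subseteq> pverts G" "e' ` fvars (Neg \<phi>) \<subseteq> pverts G"
    and "\<forall>\<psi>\<in>L. sat G C e \<psi> = sat G C e' \<psi>" and "sat G C e (Neg \<phi>)"
  then show "sat G C e' (Neg \<phi>)" using determinesD[OF assms, of e e'] by simp
qed

lemma local_base_Neg:
  assumes "local_base \<phi> n n' L r"
  shows "local_base (Neg \<phi>) n n' L r"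
proof -
  have "\<exists>C'. (\<forall>s<n. C' s = C s) \<and> determines G C' L (Neg \<phi>)"
    if "pair_graph G" for G :: ngraph and C
  proof -
    obtain C' where "\<forall>s<n. C' s = C s" "determines G C' L \<phi>"
      using assms \<open>pair_graph G\<close> unfolding local_base_def by metis
    then show ?thesis using determines_Neg by (intro exI[of _ C']) simp
  qed
  then show ?thesis using assms by (simp add: local_base_def)
qed

text \<open>Choosing a witness of \<open>Ex x\<close> near one of the free variables is a strongly local condition.
  A witness far from all of them satisfies only those members of \<open>L\<close> containing \<open>x\<close> that have no
  other variable, so it matters only through its unary class \<open>t\<close>; the new symbols name the sets
  that \<open>far_vertex_transfer\<close> provides for each class.\<close>

lemma local_base_Ex:
  assumes base: "local_base \<phi> n n1 L r" and sym: "symbols \<phi> \<subseteq> {..<n}"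
  shows "\<exists>n' L' r'. local_base (Ex x \<phi>) n n' L' r'"
proof -
  have fin: "finite L" and n: "n \<le> n1"
    and loc: "\<And>\<psi>. \<psi> \<in> L \<Longrightarrow> strongly_local r \<psi>" and fv: "\<And>\<psi>. \<psi> \<in> L \<Longrightarrow> fvars \<psi> \<subseteq> fvars \<phi>"
    and symL: "\<And>\<psi>. \<psi> \<in> L \<Longrightarrow> symbols \<psi> \<subseteq> {..<n1}"
    using base by (auto simp: local_base_def)
  define F where "F = fvars \<phi> - {x}"
  define U where "U = {\<psi> \<in> L. fvars \<psi> \<subseteq> {x}}"
  define LJ where "LJ J = {\<psi> \<in> L. fvars \<psi> \<subseteq> insert x J}" for J
  have finF: "finite F" using finite_fvars by (simp add: F_def)
  have finU: "finite (Pow U)" using fin by (simp add: U_def)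
  obtain idx :: "fm set \<Rightarrow> nat" where idx: "inj_on idx (Pow U)"
    using finite_imp_inj_to_nat_seg[OF finU] by auto
  \<comment> \<open>One symbol for each class and each of the \<open>card F\<close> sets, as the
    values of an assignment on \<open>F\<close> form a set of at most \<open>card F\<close>
    vertices.\<close>
  define S where "S = (\<lambda>(t, j). n1 + prod_encode (t, j)) ` (idx ` Pow U \<times> {..<card F})"
  define LE where "LE = {\<psi> \<in> L. x \<notin> fvars \<psi>}"
  define LD where "LD = (\<lambda>(y, j). Dle (10 * r) y j) ` (F \<times> F)"
  define LN where "LN = (\<lambda>(s, y). Col s y) ` (S \<times> F)"
  \<comment> \<open>With the complement of \<open>\<tau>\<close> as the negated part, the formula
    fixes the exact type of the witness over \<open>J\<close>.\<close>
  define NB where "NB y J \<tau> = Nearby (5 * r) x y J \<tau> (LJ J - \<tau>)" for y J \<tau>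
  define LB where "LB = (\<lambda>(y, J, \<tau>). NB y J \<tau>) ` {(y, J, \<tau>). y \<in> J \<and> J \<subseteq> F \<and> \<tau> \<subseteq> LJ J}"
  define L' where "L' = LE \<union> LD \<union> LN \<union> LB"
  have finS: "finite S" using fin by (simp add: S_def U_def)
  then obtain n' where n': "\<And>s. s \<in> S \<union> {..<n1} \<Longrightarrow> s < n'"
    using finite_nat_set_iff_bounded[of "S \<union> {..<n1}"] by auto
  have "n1 \<le> n'" using n' by (meson UnI2 lessThan_iff not_le_imp_less order_less_irrefl)
  have finLJ: "finite (LJ J)" for J using fin by (simp add: LJ_def)
  have "{(y, J, \<tau>). y \<in> J \<and> J \<subseteq> F \<and> \<tau> \<subseteq> LJ J} \<subseteq> F \<times> Pow F \<times> Pow L"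
    by (auto simp: LJ_def)
  then have finLB: "finite LB"
    unfolding LB_def using fin finF by (meson finite_Pow_iff finite_SigmaI finite_imageI finite_subset)
  have NB: "strongly_local (20 * r) (NB y J \<tau>)" "fvars (NB y J \<tau>) \<subseteq> F"
    "symbols (NB y J \<tau>) \<subseteq> {..<n1}" if "y \<in> J" "J \<subseteq> F" "\<tau> \<subseteq> LJ J" for y J \<tau>
  proof -
    have fins: "finite J" "finite \<tau>" "finite (LJ J - \<tau>)"
      using that finF finLJ finite_subset by blast+
    have J: "x \<notin> J" "y \<in> J" using that by (auto simp: F_def)
    have sub: "\<tau> \<union> (LJ J - \<tau>) = LJ J" using that by blast
    have fvLJ: "fvars \<psi> \<subseteq> insert x J" if "\<psi> \<in> LJ J" for \<psi> using that by (simp add: LJ_def)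
    have "strongly_local (5 * r) \<psi>" if "\<psi> \<in> LJ J" for \<psi>
      using that loc strongly_local_mono[of r \<psi> "5 * r"] by (simp add: LJ_def)
    then show "strongly_local (20 * r) (NB y J \<tau>)"
      using strongly_local_Nearby[OF fins J, of "5 * r"] fvLJ unfolding NB_def sub by simp
    show "fvars (NB y J \<tau>) \<subseteq> F"
      using fvars_Nearby[OF fins J] fvLJ that(2) unfolding NB_def sub by simp
    show "symbols (NB y J \<tau>) \<subseteq> {..<n1}"
      unfolding NB_def symbols_Nearby[OF fins] sub using symL by (auto simp: LJ_def)
  qed
  \<comment> \<open>\<open>Nearby\<close> quadruples its parameter 5r; the summand 1 covers the
    colour atoms when r = 0.\<close>
  have "local_base (Ex x \<phi>) n n' L' (20 * r + 1)"
    unfolding local_base_def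
  proof (intro conjI ballI allI impI)
    show "n \<le> n'" using n \<open>n1 \<le> n'\<close> by simp
    show "finite L'"
      using fin finF finS finLB by (simp add: L'_def LE_def LD_def LN_def)
  next
    fix \<psi> assume "\<psi> \<in> L'"
    then consider "\<psi> \<in> L" "x \<notin> fvars \<psi>" | y j where "y \<in> F" "j \<in> F" "\<psi> = Dle (10 * r) y j"
      | s y where "s \<in> S" "y \<in> F" "\<psi> = Col s y"
      | y J \<tau> where "y \<in> J" "J \<subseteq> F" "\<tau> \<subseteq> LJ J" "\<psi> = NB y J \<tau>"
      unfolding L'_def LE_def LD_def LN_def LB_def by auto
    then have "strongly_local (20 * r + 1) \<psi> \<and> fvars \<psi> \<subseteq> fvars (Ex x \<phi>) \<and> symbols \<psi> \<subseteq> {..<n'}"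
    proof cases
      case 1
      then show ?thesis
        using strongly_local_mono[OF loc, of \<psi> "20 * r + 1"] fv[of \<psi>] symL[of \<psi>] \<open>n1 \<le> n'\<close> by auto
    next
      case 2
      then show ?thesis
        using strongly_local_mono[OF strongly_local_Dle, of "10 * r" "20 * r + 1"]
        by (auto simp: fvars_Dle symbols_Dle F_def)
    next
      case 3
      then show ?thesis
        using strongly_local_mono[OF strongly_local_Col, of "20 * r + 1"] n'[of s]
        by (auto simp: F_def)
    next
      case 4
      then show ?thesis
        using strongly_local_mono[OF NB(1), of y J \<tau> "20 * r + 1"] NB(2,3)[of y J \<tau>] \<open>n1 \<le> n'\<close>
        by (auto simp: F_def)
    qed
    then show "strongly_local (20 * r + 1) \<psi>" "fvars \<psi> \<subseteq> fvars (Ex x \<phi>)" "symbols \<psi> \<subseteq> {..<n'}"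
      by simp_all
  next
    fix G :: ngraph and C assume G: "pair_graph G"
    obtain C1 where C1: "\<forall>s<n. C1 s = C s" "determines G C1 L \<phi>"
      using base G unfolding local_base_def by metis
    define cls where "cls v = idx {\<psi> \<in> L. fvars \<psi> \<subseteq> {x} \<and> sat G C1 (\<lambda>_. v) \<psi>}" for v
    \<comment> \<open>Each unary class plays the role of \<open>A\<close>. A number that is not the
      code of a class occurring in \<open>G\<close> gives the empty set, for which the claim is
      vacuous.\<close>
    have "\<forall>t. \<exists>N :: nat \<Rightarrow> nat set. \<forall>W W' v.
        W \<subseteq> pverts G \<longrightarrow> W' \<subseteq> pverts G \<longrightarrow> card W' \<le> card F \<longrightarrow>
        (\<forall>j<card F. W \<inter> N j = {} \<longrightarrow> W' \<inter> N j = {}) \<longrightarrow>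
        v \<in> {v \<in> pverts G. cls v = t} \<longrightarrow> (\<forall>u\<in>W. \<not> near G (5 * r) v u) \<longrightarrow>
        (\<exists>v'\<in>{v \<in> pverts G. cls v = t}. \<forall>u\<in>W'. \<not> near G r v' u)"
      by (intro allI far_vertex_transfer[OF G]) simp
    from choice[OF this] obtain N :: "nat \<Rightarrow> nat \<Rightarrow> nat set" where N: "\<forall>t W W' v.
        W \<subseteq> pverts G \<longrightarrow> W' \<subseteq> pverts G \<longrightarrow> card W' \<le> card F \<longrightarrow>
        (\<forall>j<card F. W \<inter> N t j = {} \<longrightarrow> W' \<inter> N t j = {}) \<longrightarrow>
        v \<in> {v \<in> pverts G. cls v = t} \<longrightarrow> (\<forall>u\<in>W. \<not> near G (5 * r) v u) \<longrightarrow>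
        (\<exists>v'\<in>{v \<in> pverts G. cls v = t}. \<forall>u\<in>W'. \<not> near G r v' u)"
      by blast
    \<comment> \<open>Symbol \<open>n1 + prod_encode (t, j)\<close> names \<open>N t j\<close>, so
      agreement on the atoms in \<open>LN\<close> means membership in the same sets.\<close>
    define C2 where "C2 s = (if s < n1 then C1 s else case_prod N (prod_decode (s - n1)))" for s
    have agree: "\<forall>s<n1. C2 s = C1 s" by (simp add: C2_def)
    have det: "determines G C2 L \<phi>"
      by (rule determines_agree[OF C1(2) _ symL fv agree]) (use sym n in auto)
    have cls2: "cls v = idx {\<psi> \<in> L. fvars \<psi> \<subseteq> {x} \<and> sat G C2 (\<lambda>_. v) \<psi>}" if "v \<in> pverts G" for v
    proof -
      have "sat G C2 (\<lambda>_. v) \<psi> = sat G C1 (\<lambda>_. v) \<psi>" if "\<psi> \<in> L" for \<psi>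
        by (rule sat_agree[OF symL[OF that] agree]) (use \<open>v \<in> pverts G\<close> in auto)
      then show ?thesis unfolding cls_def by (intro arg_cong[of _ _ idx]) auto
    qed
    have "determines G C2 L' (Ex x \<phi>)"
      unfolding determines_def
    proof (intro allI impI)
      fix e e'
      assume e: "e ` fvars (Ex x \<phi>) \<subseteq> pverts G" "e' ` fvars (Ex x \<phi>) \<subseteq> pverts G"
        and L: "\<forall>\<psi>\<in>L'. sat G C2 e \<psi> = sat G C2 e' \<psi>" and sat: "sat G C2 e (Ex x \<phi>)"
      show "sat G C2 e' (Ex x \<phi>)"
      proof (rule determines_Ex[where idx = idx and N = N and e = e and F = F and L = L and r = r, OF G det fin loc fv F_def])
        show "inj_on idx (Pow {\<psi> \<in> L. fvars \<psi> \<subseteq> {x}})" using idx by (simp add: U_def)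
      next
        fix t W W' v
        assume W: "W \<subseteq> pverts G" "W' \<subseteq> pverts G" "card W' \<le> card F"
          "\<forall>j<card F. W \<inter> N t j = {} \<longrightarrow> W' \<inter> N t j = {}" "v \<in> pverts G"
          "idx {\<psi> \<in> L. fvars \<psi> \<subseteq> {x} \<and> sat G C2 (\<lambda>_. v) \<psi>} = t" "\<forall>u\<in>W. \<not> near G (5 * r) v u"
        then have "v \<in> {v \<in> pverts G. cls v = t}" using cls2 by simp
        from N[THEN spec, THEN spec, THEN spec, THEN spec, THEN mp, THEN mp, THEN mp, THEN mp,
            THEN mp, THEN mp, OF W(1-4) this W(7)]
        obtain v' where "v' \<in> pverts G" "cls v' = t" "\<forall>u\<in>W'. \<not> near G r v' u" by blast
        then show "\<exists>v'\<in>pverts G. idx {\<psi> \<in> L. fvars \<psi> \<subseteq> {x} \<and> sat G C2 (\<lambda>_. v') \<psi>} = t \<and>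
            (\<forall>u\<in>W'. \<not> near G r v' u)"
          using cls2[of v'] by (intro bexI[of _ v']) simp_all
      next
        show "e ` F \<subseteq> pverts G" "e' ` F \<subseteq> pverts G" using e by (simp_all add: F_def)
      next
        fix \<psi> assume "\<psi> \<in> L" "x \<notin> fvars \<psi>"
        then show "sat G C2 e \<psi> = sat G C2 e' \<psi>" using L by (simp add: L'_def LE_def)
      next
        fix y j assume "y \<in> F" "j \<in> F"
        then have "Dle (10 * r) y j \<in> L'" by (auto simp: L'_def LD_def)
        then have "sat G C2 e (Dle (10 * r) y j) = sat G C2 e' (Dle (10 * r) y j)" using L by blast
        then show "near G (10 * r) (e y) (e j) = near G (10 * r) (e' y) (e' j)" by (simp add: sat_Dle)
      next
        fix y t j assume *: "y \<in> F" "t \<in> idx ` Pow {\<psi> \<in> L. fvars \<psi> \<subseteq> {x}}" "j < card F"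
        then have "n1 + prod_encode (t, j) \<in> S" unfolding S_def U_def by (auto simp: image_iff)
        then have "Col (n1 + prod_encode (t, j)) y \<in> L'" using * by (auto simp: L'_def LN_def)
        then have "sat G C2 e (Col (n1 + prod_encode (t, j)) y) =
            sat G C2 e' (Col (n1 + prod_encode (t, j)) y)" using L by blast
        then show "(e y \<in> N t j) = (e' y \<in> N t j)" by (simp add: C2_def)
      next
        fix y J \<tau>
        assume *: "y \<in> J" "J \<subseteq> F" "\<tau> \<subseteq> {\<psi> \<in> L. fvars \<psi> \<subseteq> insert x J}"
          "sat G C2 e (Nearby (5 * r) x y J \<tau> ({\<psi> \<in> L. fvars \<psi> \<subseteq> insert x J} - \<tau>))"
        have "NB y J \<tau> \<in> LB"
          unfolding LB_def using *(1-3) by (intro image_eqI[of _ _ "(y, J, \<tau>)"]) (simp_all add: LJ_def)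
        then have "NB y J \<tau> \<in> L'" by (simp add: L'_def)
        then show "sat G C2 e' (Nearby (5 * r) x y J \<tau> ({\<psi> \<in> L. fvars \<psi> \<subseteq> insert x J} - \<tau>))"
          using * L unfolding NB_def LJ_def by blast
      qed (use sat in blast)+
    qed
    moreover have "\<forall>s<n. C2 s = C s" using agree C1(1) n by simp
    ultimately show "\<exists>C'. (\<forall>s<n. C' s = C s) \<and> determines G C' L' (Ex x \<phi>)" by blast
  qed
  then show ?thesis by blast
qed

lemma local_base_exists:
  "symbols \<phi> \<subseteq> {..<n} \<Longrightarrow> \<exists>n' L r. local_base \<phi> n n' L r"
proof (induction \<phi> arbitrary: n)
  case (Eq x y)
  show ?case using local_base_self[OF Eq strongly_local_Eq] by blast
next
  case (Adj x y)
  show ?case using local_base_self[OF Adj strongly_local_Adj] by blast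
next
  case (Col s x)
  show ?case using local_base_self[OF Col strongly_local_Col] by blast
next
  case (Neg \<phi>)
  then have "\<exists>n' L r. local_base \<phi> n n' L r" by simp
  then show ?case using local_base_Neg by blast
next
  case (And \<phi> \<psi>)
  then have sym: "symbols \<phi> \<subseteq> {..<n}" "symbols \<psi> \<subseteq> {..<n}" by simp_all
  obtain n1 L1 r1 where 1: "local_base \<phi> n n1 L1 r1" using And.IH(1)[OF sym(1)] by blast
  then have "symbols \<psi> \<subseteq> {..<n1}" using sym(2) by (auto simp: local_base_def)
  then show ?case using And.IH(2) local_base_And[OF 1 _ sym(1)] by blast
next
  case (Ex x \<phi>)
  then have sym: "symbols \<phi> \<subseteq> {..<n}" by simp
  show ?case using Ex.IH[OF sym] local_base_Ex[OF _ sym] by blast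
qed

subsection \<open>Perturbations\<close>

text \<open>The parity of the number of sets containing both vertices, which is the net effect of
  successive complementations.\<close>

primrec flips :: "'a set list \<Rightarrow> 'a \<Rightarrow> 'a \<Rightarrow> bool" where
  "flips [] u v \<longleftrightarrow> False"
| "flips (M # Ms) u v \<longleftrightarrow> flips Ms u v \<noteq> (u \<in> M \<and> v \<in> M)"

text \<open>The perturbation depends only on the number \<open>k\<close> of sets; the sets
  themselves are the colours guessed in each of the \<open>k\<close> complementations, and hence may
  depend on the graph.\<close>

lemma perturbation_flips:
  "\<exists>P. perturbation P \<and> (\<forall>H Ms. pair_graph H \<longrightarrow> length Ms = k \<longrightarrow> (\<forall>M\<in>set Ms. M \<subseteq> pverts H) \<longrightarrow>
     \<lparr>pverts = pverts H, parcs = {(u, v). u \<in> pverts H \<and> v \<in> pverts H \<and> u \<noteq> v \<and>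
        ((u, v) \<in> parcs H) \<noteq> flips Ms u v}\<rparr> \<in> P H)"
proof (induction k)
  case 0
  have "\<lparr>pverts = pverts H, parcs = {(u, v). u \<in> pverts H \<and> v \<in> pverts H \<and> u \<noteq> v \<and>
        ((u, v) \<in> parcs H) \<noteq> flips [] u v}\<rparr> = H" if "pair_graph H" for H :: ngraph
  proof -
    have "{(u, v). u \<in> pverts H \<and> v \<in> pverts H \<and> u \<noteq> v \<and> (u, v) \<in> parcs H} = parcs H"
      using that by (auto simp: pair_graph_iff irrefl_def)
    then show ?thesis by simp
  qed
  then show ?case by (intro exI[of _ "\<lambda>G. {G}"] conjI perturbation.none) simp
next
  case (Suc k)
  then obtain P where P: "perturbation P" and PH: "\<And>H Ms. pair_graph H \<Longrightarrow> length Ms = k \<Longrightarrow>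
     \<forall>M\<in>set Ms. M \<subseteq> pverts H \<Longrightarrow>
     \<lparr>pverts = pverts H, parcs = {(u, v). u \<in> pverts H \<and> v \<in> pverts H \<and> u \<noteq> v \<and>
        ((u, v) \<in> parcs H) \<noteq> flips Ms u v}\<rparr> \<in> P H" by blast
  have "\<lparr>pverts = pverts H, parcs = {(u, v). u \<in> pverts H \<and> v \<in> pverts H \<and> u \<noteq> v \<and>
        ((u, v) \<in> parcs H) \<noteq> flips Ms u v}\<rparr> \<in> (subset_complementation \<circ>\<^sub>T P) H" (is "?K \<in> _")
    if H: "pair_graph H" and len: "length Ms = Suc k" and sub: "\<forall>M\<in>set Ms. M \<subseteq> pverts H"
    for H :: ngraph and Ms
  proof -
    obtain M Ms' where Ms: "Ms = M # Ms'" using len by (cases Ms) auto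
    define K where "K = \<lparr>pverts = pverts H, parcs = {(u, v). u \<in> pverts H \<and> v \<in> pverts H \<and> u \<noteq> v \<and>
        ((u, v) \<in> parcs H) \<noteq> flips Ms' u v}\<rparr>"
    have K: "K \<in> P H" using PH[OF H, of Ms'] len sub by (simp add: K_def Ms)
    have "?K = interpret_graph (Eq 0 0)
       (And (Neg (Eq 0 1)) (Neg (Iff (Adj 0 1) (And (Col 0 0) (Col 0 1))))) K (\<lambda>_. M)"
      by (auto simp: interpret_graph_def Let_def K_def Ms models_def Iff_def)
    moreover have "expansion {0} K (\<lambda>_. M)" using sub by (simp add: expansion_def K_def Ms)
    ultimately have "?K \<in> subset_complementation K"
      unfolding subset_complementation_def noncopying_map_def by blast
    then show ?thesis using K unfolding tcomp_def by blast
  qed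
  then show ?case using perturbation.step[OF P] by (intro exI[of _ "subset_complementation \<circ>\<^sub>T P"]) simp
qed

text \<open>Flipping the adjacency between two distinct classes \<open>A\<close>, \<open>B\<close> amounts to complementing inside
  \<open>A \<union> B\<close>, \<open>A\<close> and \<open>B\<close>. Empty sets pad the list to a length that does not depend on \<open>S\<close>.\<close>

lemma class_flips:
  fixes \<kappa> :: "'a \<Rightarrow> 'b"
  assumes "sym S"
  shows "\<exists>Ms. length Ms = 3 * length ps \<and> (\<forall>M\<in>set Ms. M \<subseteq> V) \<and>
    (\<forall>u\<in>V. \<forall>v\<in>V. flips Ms u v \<longleftrightarrow>
       (\<kappa> u, \<kappa> v) \<in> S \<and> ((\<kappa> u, \<kappa> v) \<in> set ps \<or> (\<kappa> v, \<kappa> u) \<in> set ps))"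
proof (induction ps)
  case Nil
  then show ?case by simp
next
  case (Cons p ps)
  then obtain Ms where Ms: "length Ms = 3 * length ps" "\<forall>M\<in>set Ms. M \<subseteq> V"
    and flips: "\<forall>u\<in>V. \<forall>v\<in>V. flips Ms u v \<longleftrightarrow>
       (\<kappa> u, \<kappa> v) \<in> S \<and> ((\<kappa> u, \<kappa> v) \<in> set ps \<or> (\<kappa> v, \<kappa> u) \<in> set ps)" by blast
  obtain a b where p: "p = (a, b)" by (cases p)
  define A where "A c = {v \<in> V. \<kappa> v = c}" for c
  \<comment> \<open>A pair whose reverse has already been treated must not be flipped again, as this
    would undo the flip.\<close>
  consider "(a, b) \<notin> S \<or> (a, b) \<in> set ps \<or> (b, a) \<in> set ps"
    | "a = b" "(a, b) \<in> S" "(a, b) \<notin> set ps"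
    | "a \<noteq> b" "(a, b) \<in> S" "(a, b) \<notin> set ps" "(b, a) \<notin> set ps" by blast
  then have "\<exists>Xs. length Xs = 3 \<and> (\<forall>M\<in>set Xs. M \<subseteq> V) \<and> (\<forall>u\<in>V. \<forall>v\<in>V. flips (Xs @ Ms) u v \<longleftrightarrow>
      (\<kappa> u, \<kappa> v) \<in> S \<and> ((\<kappa> u, \<kappa> v) \<in> set (p # ps) \<or> (\<kappa> v, \<kappa> u) \<in> set (p # ps)))"
  proof cases
    case 1
    then show ?thesis
      using assms by (intro exI[of _ "[{}, {}, {}]"]) (auto simp: p flips dest: symD)
  next
    case 2
    then show ?thesis
      using assms by (intro exI[of _ "[A a, {}, {}]"]) (auto simp: p A_def flips)
  next
    \<comment> \<open>Pairs inside \<open>A a\<close> or inside \<open>A b\<close> are complemented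
      twice, which cancels; pairs between the two classes lie only in the union.\<close>
    case 3
    then show ?thesis
      using assms by (intro exI[of _ "[A a \<union> A b, A a, A b]"])
        (auto simp: p A_def flips dest: symD)
  qed
  then obtain Xs where "length Xs = 3" "\<forall>M\<in>set Xs. M \<subseteq> V"
    "\<forall>u\<in>V. \<forall>v\<in>V. flips (Xs @ Ms) u v \<longleftrightarrow>
      (\<kappa> u, \<kappa> v) \<in> S \<and> ((\<kappa> u, \<kappa> v) \<in> set (p # ps) \<or> (\<kappa> v, \<kappa> u) \<in> set (p # ps))" by blast
  then show ?case using Ms(1,2) by (intro exI[of _ "Xs @ Ms"]) auto
qed

subsection \<open>Non-copying transductions\<close>

text \<open>The half of strong locality that is closed under Boolean combinations. The balls are
  taken around the values of all variables below \<open>k\<close>, whether or not they occur, so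
  that all parts of a combination refer to the same \<open>W\<close>.\<close>

definition local_on :: "nat \<Rightarrow> nat \<Rightarrow> fm \<Rightarrow> bool" where
  "local_on k r \<phi> \<longleftrightarrow> fvars \<phi> \<subseteq> {..<k} \<and>
     (\<forall>(G :: ngraph) C e W. pair_graph G \<longrightarrow> (\<forall>i<k. e i \<in> pverts G) \<longrightarrow> W \<subseteq> pverts G \<longrightarrow>
        (\<forall>i<k. \<forall>v. near G r (e i) v \<longrightarrow> v \<in> W) \<longrightarrow> sat (induce G W) C e \<phi> = sat G C e \<phi>)"

lemma local_on_strongly_local:
  assumes "strongly_local r \<phi>" "fvars \<phi> \<subseteq> {..<k}"
  shows "local_on k r \<phi>"
  unfolding local_on_def
proof (intro conjI allI impI assms(2))
  fix G :: ngraph and C e W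
  assume *: "pair_graph G" "\<forall>i<k. e i \<in> pverts G" "W \<subseteq> pverts G"
    "\<forall>i<k. \<forall>v. near G r (e i) v \<longrightarrow> v \<in> W"
  show "sat (induce G W) C e \<phi> = sat G C e \<phi>"
    by (rule strongly_local_induce[OF assms(1) *(1)]) (use * assms(2) in auto)
qed

lemma local_on_Neg: "local_on k r \<phi> \<Longrightarrow> local_on k r (Neg \<phi>)"
  by (simp add: local_on_def)

lemma local_on_And: "local_on k r \<phi> \<Longrightarrow> local_on k r \<psi> \<Longrightarrow> local_on k r (And \<phi> \<psi>)"
  by (simp add: local_on_def)

lemma local_on_Conj: "finite S \<Longrightarrow> (\<And>\<phi>. \<phi> \<in> S \<Longrightarrow> local_on k r \<phi>) \<Longrightarrow> local_on k r (Conj S)"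
  by (auto simp: local_on_def sat_Conj fvars_Conj)

lemma local_on_Disj: "finite S \<Longrightarrow> (\<And>\<phi>. \<phi> \<in> S \<Longrightarrow> local_on k r \<phi>) \<Longrightarrow> local_on k r (Disj S)"
  unfolding Disj_def by (intro local_on_Neg local_on_Conj) (auto intro: local_on_Neg)

lemma local_on_sym_part:
  assumes "local_on 2 r \<phi>"
  shows "local_on 2 r (sym_part \<phi>)"
proof -
  have fv: "fvars \<phi> \<subseteq> {..<2}" using assms by (simp add: local_on_def)
  have eq: "local_on 2 r (Eq 0 1)" by (simp add: local_on_def)
  have "local_on 2 r (inst2 \<phi> 1 0)"
    unfolding local_on_def
  proof (intro conjI allI impI)
    show "fvars (inst2 \<phi> 1 0) \<subseteq> {..<2}" using fvars_inst2[OF fv, of 1 0] by auto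
    fix G :: ngraph and C and e :: "nat \<Rightarrow> nat" and W
    assume *: "pair_graph G" "\<forall>i<2. e i \<in> pverts G" "W \<subseteq> pverts G"
      "\<forall>i<2. \<forall>v. near G r (e i) v \<longrightarrow> v \<in> W"
    define e' where "e' = (\<lambda>i. [e 1, e 0] ! i)"
    have "e 0 \<in> W" "e 1 \<in> W" using *(2,4) near_refl[of _ G r] by (metis one_less_numeral_iff pos2 semiring_norm(76))+
    then have "e 0 \<in> pverts (induce G W)" "e 1 \<in> pverts (induce G W)" using *(3) by (auto simp: induce_def)
    then have "sat (induce G W) C e (inst2 \<phi> 1 0) = sat (induce G W) C e' \<phi>"
      using sat_inst2[OF fv, of e 1 "induce G W" 0 C] by (simp add: models_def e'_def)
    moreover have "sat G C e (inst2 \<phi> 1 0) = sat G C e' \<phi>"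
      using sat_inst2[OF fv, of e 1 G 0 C] *(2) by (simp add: models_def e'_def)
    moreover have "sat (induce G W) C e' \<phi> = sat G C e' \<phi>"
    proof -
      have "e' i \<in> {e 0, e 1}" if "i < 2" for i
        using that by (cases i) (auto simp: e'_def)
      then have "\<forall>i<2. e' i \<in> pverts G" "\<forall>i<2. \<forall>v. near G r (e' i) v \<longrightarrow> v \<in> W"
        using *(2,4) by (metis insert_iff one_less_numeral_iff pos2 semiring_norm(76) singletonD)+
      then show ?thesis using assms *(1,3) unfolding local_on_def by blast
    qed
    ultimately show "sat (induce G W) C e (inst2 \<phi> 1 0) = sat G C e (inst2 \<phi> 1 0)" by simp
  qed
  then show ?thesis unfolding sym_part_def by (intro local_on_And local_on_Neg eq assms)
qed

text \<open>\<open>W\<close> is taken to be the union of the balls. Cutting the colours down to it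
  is harmless, because satisfaction depends only on colours at vertices of the graph.\<close>

lemma strongly_local_fm_if_local_on:
  assumes "local_on k r \<phi>" "symbols \<phi> \<subseteq> \<Sigma>"
    and near: "\<And>(G :: ngraph) C e i j. pair_graph G \<Longrightarrow> (\<forall>i<k. e i \<in> pverts G) \<Longrightarrow> sat G C e \<phi> \<Longrightarrow>
      i < j \<Longrightarrow> j < k \<Longrightarrow> near G r (e i) (e j)"
  shows "strongly_local_fm \<Sigma> k r \<phi>"
  unfolding strongly_local_fm_def local_fm_def
proof (intro conjI allI impI assms(2))
  show fv: "fvars \<phi> \<subseteq> {..<k}" using assms(1) by (simp add: local_on_def)
  fix G :: ngraph and C and vs :: "nat list"
  assume G: "pair_graph G" and vs: "length vs = k" "set vs \<subseteq> pverts G"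
  have e: "\<forall>i<k. vs ! i \<in> pverts G" using vs nth_mem by blast
  define B where "B = ball_verts G r (set vs)"
  have B: "v \<in> B \<longleftrightarrow> v \<in> pverts G \<and> (\<exists>u\<in>set vs. near G r u v)" for v
  proof -
    have "gdist G u v \<le> ereal (real r) \<longleftrightarrow> near G r u v" if "u \<in> set vs" for u
      using gdist_le_iff[OF G] vs(2) that by blast
    then show ?thesis unfolding B_def ball_verts_def by blast
  qed
  have BV: "B \<subseteq> pverts G" using B by auto
  have ball: "\<forall>i<k. \<forall>v. near G r (vs ! i) v \<longrightarrow> v \<in> B"
  proof (intro allI impI)
    fix i v assume "i < k" "near G r (vs ! i) v"
    then show "v \<in> B" unfolding B using e near_verts[of G r "vs ! i" v] vs(1) nth_mem by blast
  qed
  have "models (induce G B) C vs \<phi> = models G C vs \<phi>"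
    using assms(1) G e BV ball unfolding local_on_def models_def by blast
  moreover have "models (induce G B) (\<lambda>s. C s \<inter> B) vs \<phi> = models (induce G B) C vs \<phi>"
    unfolding models_def
  proof (rule sat_cong)
    fix x assume "x \<in> fvars \<phi>"
    then have x: "x < k" using fv by auto
    then have "vs ! x \<in> B" using ball e near_refl[of "vs ! x" G r] by auto
    then show "vs ! x \<in> pverts (induce G B) \<and> vs ! x = vs ! x" using BV by (auto simp: induce_def)
  qed (auto simp: induce_def)
  ultimately show "models G C vs \<phi> = models (induce G (ball_verts G r (set vs)))
      (\<lambda>s. C s \<inter> ball_verts G r (set vs)) vs \<phi>"
    by (simp add: B_def)
next
  fix G :: ngraph and C and vs :: "nat list" and i j
  assume G: "pair_graph G" and vs: "length vs = k" "set vs \<subseteq> pverts G"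
    and sat: "models G C vs \<phi>" and ij: "i < j" "j < k"
  have e: "\<forall>i<k. vs ! i \<in> pverts G" using vs nth_mem by blast
  have "near G r (vs ! i) (vs ! j)"
    using near[OF G, of "\<lambda>i. vs ! i" C i j] e sat ij unfolding models_def by simp
  then show "gdist G (vs ! i) (vs ! j) \<le> ereal (real r)"
    using gdist_le_iff[OF G, of "vs ! i"] e ij by simp
qed

text \<open>Formulas with both variables are false at distant pairs by strong locality. The
  remaining ones see only one of the two vertices, so their values can be read off from its
  class.\<close>

lemma determines_far_pairs:
  fixes G :: ngraph
  assumes G: "pair_graph G" and det: "determines G C L \<eta>" and fv\<eta>: "fvars \<eta> \<subseteq> {..<2}"
    and loc: "\<And>\<psi>. \<psi> \<in> L \<Longrightarrow> strongly_local r \<psi>" and fv: "\<And>\<psi>. \<psi> \<in> L \<Longrightarrow> fvars \<psi> \<subseteq> fvars \<eta>"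
    and U: "U = {\<psi> \<in> L. \<not> {0, 1} \<subseteq> fvars \<psi>}"
    and V: "u \<in> pverts G" "v \<in> pverts G" "u' \<in> pverts G" "v' \<in> pverts G"
    and far: "\<not> near G r u v" "\<not> near G r u' v'"
    and cls: "{\<psi> \<in> U. sat G C (\<lambda>_. u) \<psi>} = {\<psi> \<in> U. sat G C (\<lambda>_. u') \<psi>}"
      "{\<psi> \<in> U. sat G C (\<lambda>_. v) \<psi>} = {\<psi> \<in> U. sat G C (\<lambda>_. v') \<psi>}"
  shows "models G C [u, v] \<eta> = models G C [u', v'] \<eta>"
proof -
  define p where "p a b = (\<lambda>i::nat. if i = 0 then a else b)" for a b :: nat
  have m: "models G C [a, b] \<eta> = sat G C (p a b) \<eta>" if "a \<in> pverts G" "b \<in> pverts G" for a b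
    by (rule models_Cons2[OF fv\<eta>]) (use that in \<open>auto simp: p_def\<close>)
  have "sat G C (p u v) \<psi> = sat G C (p u' v') \<psi>" if \<psi>: "\<psi> \<in> L" for \<psi>
  proof -
    have sub: "fvars \<psi> \<subseteq> {0, 1}" using fv[OF \<psi>] fv\<eta> by fastforce
    have pV: "p a b ` fvars \<psi> \<subseteq> pverts G" if "a \<in> pverts G" "b \<in> pverts G" for a b
      using that by (auto simp: p_def)
    consider "{0, 1} \<subseteq> fvars \<psi>" | "\<psi> \<in> U" "fvars \<psi> \<subseteq> {0}" | "\<psi> \<in> U" "fvars \<psi> \<subseteq> {1}"
      using sub \<psi> unfolding U by blast
    then show ?thesis
    proof cases
      case 1
      have "\<not> sat G C (p a b) \<psi>" if "a \<in> pverts G" "b \<in> pverts G" "\<not> near G r a b" for a b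
        using strongly_local_near[OF loc[OF \<psi>] G pV[OF that(1,2)], of C 0 1] 1 that
        by (auto simp: p_def)
      then show ?thesis using V far by blast
    next
      case 2
      have "sat G C (p a b) \<psi> = sat G C (\<lambda>_. a) \<psi>" if "a \<in> pverts G" for a b
        by (rule sat_cong) (use that 2 in \<open>auto simp: p_def\<close>)
      then show ?thesis using V cls(1) 2(1) by blast
    next
      case 3
      have "sat G C (p a b) \<psi> = sat G C (\<lambda>_. b) \<psi>" if "b \<in> pverts G" for a b
        by (rule sat_cong) (use that 3 in \<open>auto simp: p_def\<close>)
      then show ?thesis using V cls(2) 3(1) by blast
    qed
  qed
  then show ?thesis
    unfolding m[OF V(1,2)] m[OF V(3,4)]
    by (intro determinesD[OF det]) (use V in \<open>auto simp: p_def\<close>)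
qed

theorem noncopying_subsumed_by_immersive:
  assumes "noncopying T"
  shows "\<exists>P T_imm. perturbation P \<and> immersive T_imm \<and> subsumes (P \<circ>\<^sub>T T_imm) T"
proof -
  obtain \<Sigma> \<nu> \<eta> where fin: "finite \<Sigma>" and simple: "simple_interpretation \<Sigma> \<nu> \<eta>"
    and T: "T = noncopying_map \<Sigma> \<nu> \<eta>"
    using assms unfolding noncopying_def by blast
  have fv\<nu>: "fvars \<nu> \<subseteq> {..<1}" and fv\<eta>: "fvars \<eta> \<subseteq> {..<2}" and sym\<eta>: "symbols \<eta> \<subseteq> \<Sigma>"
    using simple by (simp_all add: simple_interpretation_def)
  obtain n where "\<Sigma> \<subseteq> {..<n}" using fin finite_nat_set_iff_bounded by (metis lessThan_iff subsetI)
  with sym\<eta> have sym_n: "symbols \<eta> \<subseteq> {..<n}" by blast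
  obtain n1 L r where base: "local_base \<eta> n n1 L r" using local_base_exists[OF sym_n] by blast
  then have finL: "finite L" and n: "n \<le> n1"
    and loc: "\<And>\<psi>. \<psi> \<in> L \<Longrightarrow> strongly_local r \<psi>" and fv: "\<And>\<psi>. \<psi> \<in> L \<Longrightarrow> fvars \<psi> \<subseteq> fvars \<eta>"
    and symL: "\<And>\<psi>. \<psi> \<in> L \<Longrightarrow> symbols \<psi> \<subseteq> {..<n1}"
    by (auto simp: local_base_def)
  define U where "U = {\<psi> \<in> L. \<not> {0, 1} \<subseteq> fvars \<psi>}"
  have finU: "finite (Pow U)" using finL by (simp add: U_def)
  obtain idx :: "fm set \<Rightarrow> nat" and m where idx: "inj_on idx (Pow U)" "idx ` Pow U = {i. i < m}"
    using finite_imp_inj_to_nat_seg[OF finU] by metis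
  \<comment> \<open>At least r for the formulas in \<open>L\<close>, and at least 1 for the colour
    atoms.\<close>
  define R where "R = r + 1"
  \<comment> \<open>The correction that the immersive part has to compute depends on the classes of
    both vertices as well, so atoms naming the classes join the local types.\<close>
  define L2 where "L2 = L \<union> (\<lambda>(a, x). Col (n1 + a) x) ` ({..<m} \<times> {0, 1})"
  have finL2: "finite L2" using finL by (simp add: L2_def)
  then have finPL2: "finite (Pow L2)" by simp
  obtain idx2 :: "fm set \<Rightarrow> nat" where idx2: "inj_on idx2 (Pow L2)"
    using finite_imp_inj_to_nat_seg[OF finPL2] by metis
  have L2: "strongly_local R \<psi> \<and> fvars \<psi> \<subseteq> {..<2} \<and> symbols \<psi> \<subseteq> {..<n1 + m}"
    if \<psi>: "\<psi> \<in> L2" for \<psi>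
  proof -
    consider "\<psi> \<in> L" | a x where "\<psi> = Col (n1 + a) x" "a < m" "x < 2"
      using \<psi> by (auto simp: L2_def)
    then show ?thesis
    proof cases
      case 1
      then show ?thesis
        using strongly_local_mono[OF loc[OF 1], of R] fv[OF 1] fv\<eta> symL[OF 1] by (auto simp: R_def)
    next
      case 2
      then show ?thesis
        using strongly_local_mono[OF strongly_local_Col, of R] by (simp add: R_def)
    qed
  qed
  \<comment> \<open>The colour atom is a switch: it is meant to hold at all vertices or at none,
    according to whether pairs of type \<open>\<tau>\<close> are to be adjacent in the given
    graph.\<close>
  define tp where "tp \<tau> = And (Col (n1 + m + 1 + idx2 \<tau>) 0) (And (Conj \<tau>) (Conj (Neg ` (L2 - \<tau>))))" for \<tau>
  define core where "core = Disj (tp ` Pow L2)"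
  define \<eta>' where "\<eta>' = sym_part (And (Dle R 0 1) core)"
  \<comment> \<open>The original vertex formula may be global; its extension is simply guessed as a
    colour.\<close>
  define \<nu>' where "\<nu>' = Col (n1 + m) 0"
  define \<Sigma>' where "\<Sigma>' = symbols \<nu>' \<union> symbols \<eta>'"
  have "local_on 2 R (tp \<tau>)" if "\<tau> \<subseteq> L2" for \<tau>
  proof -
    have "finite \<tau>" "finite (Neg ` (L2 - \<tau>))" using that finL2 finite_subset by auto
    moreover have "local_on 2 R \<psi>" if "\<psi> \<in> L2" for \<psi> using local_on_strongly_local L2[OF that] by blast
    moreover have "local_on 2 R (Col s 0)" for s
      by (rule local_on_strongly_local[OF strongly_local_mono[OF strongly_local_Col]]) (auto simp: R_def)
    ultimately show ?thesis
      unfolding tp_def using that by (intro local_on_And local_on_Conj) (auto intro: local_on_Neg)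
  qed
  then have "local_on 2 R core"
    unfolding core_def using finPL2 by (intro local_on_Disj) auto
  moreover have "local_on 2 R (Dle R 0 1)"
    by (rule local_on_strongly_local[OF strongly_local_Dle]) (auto simp: fvars_Dle)
  ultimately have loc_body: "local_on 2 R (And (Dle R 0 1) core)" by (intro local_on_And)
  then have fv_body: "fvars (And (Dle R 0 1) core) \<subseteq> {..<2}" by (simp add: local_on_def)
  have m\<eta>': "models G C [u, v] \<eta>' \<longleftrightarrow> u \<noteq> v \<and> (near G R u v \<and> models G C [u, v] core) \<and>
      (near G R v u \<and> models G C [v, u] core)"
    if "u \<in> pverts G" "v \<in> pverts G" for G :: ngraph and C u v
    unfolding \<eta>'_def models_sym_part[OF fv_body that] by (simp add: models_def sat_Dle)
  have simple': "simple_interpretation \<Sigma>' \<nu>' \<eta>'"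
    unfolding \<eta>'_def
    by (rule simple_interpretation_sym_part[OF _ _ fv_body])
      (auto simp: \<nu>'_def \<Sigma>'_def \<eta>'_def symbols_sym_part[OF fv_body] simp del: One_nat_def)
  have "local_on 1 R \<nu>'"
    unfolding \<nu>'_def
    by (rule local_on_strongly_local[OF strongly_local_mono[OF strongly_local_Col]]) (auto simp: R_def)
  then have "strongly_local_fm \<Sigma>' 1 R \<nu>'"
    by (rule strongly_local_fm_if_local_on) (auto simp: \<Sigma>'_def)
  moreover have "strongly_local_fm \<Sigma>' 2 R \<eta>'"
  proof (rule strongly_local_fm_if_local_on)
    show "local_on 2 R \<eta>'" unfolding \<eta>'_def by (rule local_on_sym_part[OF loc_body])
    show "symbols \<eta>' \<subseteq> \<Sigma>'" by (simp add: \<Sigma>'_def)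
    fix G :: ngraph and C and e :: "nat \<Rightarrow> nat" and i j :: nat
    assume "\<forall>i<2. e i \<in> pverts G" and sat: "sat G C e \<eta>'" and "i < j" "j < 2"
    moreover from this have "i = 0" "j = 1" by auto
    moreover have "near G R (e 0) (e 1)" using sat by (simp add: \<eta>'_def sym_part_def sat_Dle)
    ultimately show "near G R (e i) (e j)" by simp
  qed
  moreover have "finite \<Sigma>'" by (simp add: \<Sigma>'_def finite_symbols)
  ultimately have imm: "immersive (noncopying_map \<Sigma>' \<nu>' \<eta>')"
    unfolding immersive_def using simple' by blast
  \<comment> \<open>All pairs of possible class numbers, so that the number of complementations,
    three for each pair, is independent of the graph.\<close>
  define ps where "ps = List.product [0..<m] [0..<m]"
  obtain P where P: "perturbation P" and flip: "\<And>H Ms. pair_graph H \<Longrightarrow> length Ms = 3 * length ps \<Longrightarrow>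
     \<forall>M\<in>set Ms. M \<subseteq> pverts H \<Longrightarrow>
     \<lparr>pverts = pverts H, parcs = {(u, v). u \<in> pverts H \<and> v \<in> pverts H \<and> u \<noteq> v \<and>
        ((u, v) \<in> parcs H) \<noteq> flips Ms u v}\<rparr> \<in> P H"
    using perturbation_flips[of "3 * length ps"] by blast
  have "interpret_graph \<nu> \<eta> G C \<in> (P \<circ>\<^sub>T noncopying_map \<Sigma>' \<nu>' \<eta>') G"
    if G: "pair_graph G" and C: "expansion \<Sigma> G C" for G :: ngraph and C
  proof -
    have irr: "\<not> models G C [u, u] \<eta>" if "u \<in> pverts G" for u
      using simple G C that unfolding simple_interpretation_def by blast
    have symm: "models G C [u, v] \<eta> \<longleftrightarrow> models G C [v, u] \<eta>" if "u \<in> pverts G" "v \<in> pverts G" for u v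
      using simple G C that unfolding simple_interpretation_def by blast
    obtain C1 where C1: "\<forall>s<n. C1 s = C s" "determines G C1 L \<eta>"
      using base G unfolding local_base_def by metis
    define cls where "cls u = {\<psi> \<in> U. sat G C1 (\<lambda>_. u) \<psi>}" for u
    define \<kappa> where "\<kappa> u = idx (cls u)" for u
    have cls: "cls u \<in> Pow U" for u by (auto simp: cls_def)
    have \<kappa>: "\<kappa> u < m" for u using idx(2) cls[of u] by (auto simp: \<kappa>_def)
    \<comment> \<open>Pairs of classes that are adjacent at large distance. One distant pair decides
      for all distant pairs of the same classes.\<close>
    define S where "S = {(\<kappa> u, \<kappa> v) | u v. u \<in> pverts G \<and> v \<in> pverts G \<and> \<not> near G r u v \<and>
      models G C [u, v] \<eta>}"
    have "sym S"
    proof (rule symI)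
      fix a b assume "(a, b) \<in> S"
      then obtain u v where "a = \<kappa> u" "b = \<kappa> v" "u \<in> pverts G" "v \<in> pverts G" "\<not> near G r u v"
        "models G C [u, v] \<eta>" unfolding S_def by blast
      moreover from this have "\<not> near G r v u" using near_sym[OF G, of r v u] by blast
      ultimately show "(b, a) \<in> S" using symm unfolding S_def by blast
    qed
    have m1: "models G C1 [u, v] \<eta> = models G C [u, v] \<eta>" if "u \<in> pverts G" "v \<in> pverts G" for u v
    proof -
      have "[u, v] ! i \<in> pverts G" if "i < 2" for i
        using that \<open>u \<in> pverts G\<close> \<open>v \<in> pverts G\<close> by (cases i) auto
      then show ?thesis
        unfolding models_def by (intro sat_agree[OF sym_n C1(1)]) (use fv\<eta> in auto)
    qed
    have far: "models G C [u, v] \<eta> \<longleftrightarrow> (\<kappa> u, \<kappa> v) \<in> S"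
      if uv: "u \<in> pverts G" "v \<in> pverts G" "\<not> near G r u v" for u v
    proof
      assume "(\<kappa> u, \<kappa> v) \<in> S"
      then obtain u' v' where w: "\<kappa> u = \<kappa> u'" "\<kappa> v = \<kappa> v'" "u' \<in> pverts G" "v' \<in> pverts G"
        "\<not> near G r u' v'" "models G C [u', v'] \<eta>" unfolding S_def by auto
      have "cls u = cls u'" "cls v = cls v'"
        using w(1,2) cls inj_onD[OF idx(1)] unfolding \<kappa>_def by blast+
      then have "models G C1 [u, v] \<eta> = models G C1 [u', v'] \<eta>"
        by (intro determines_far_pairs[OF G C1(2) fv\<eta> loc fv U_def uv(1,2) w(3,4) uv(3) w(5)])
          (simp_all add: cls_def)
      then show "models G C [u, v] \<eta>" using w m1 uv by simp
    qed (use uv in \<open>auto simp: S_def\<close>)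
    \<comment> \<open>The error made by the flips alone. It vanishes at distant pairs, so the
      immersive part only has to produce it at pairs within \<open>R\<close>.\<close>
    define D where "D u v \<longleftrightarrow> models G C [u, v] \<eta> \<noteq> ((\<kappa> u, \<kappa> v) \<in> S)" for u v
    have D_sym: "D u v = D v u" if "u \<in> pverts G" "v \<in> pverts G" for u v
      using symm[OF that] \<open>sym S\<close> unfolding D_def sym_def by blast
    have D_near: "near G R u v" if "D u v" "u \<in> pverts G" "v \<in> pverts G" for u v
      using far[OF that(2,3)] that near_mono[of G r u v R] unfolding D_def R_def by auto
    define p where "p u v = (\<lambda>i. [u, v] ! i)" for u v :: nat
    have p: "p u v ` fvars \<psi> \<subseteq> pverts G"
      if "u \<in> pverts G" "v \<in> pverts G" "fvars \<psi> \<subseteq> {..<2}" for u v \<psi>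
    proof -
      have "p u v i \<in> pverts G" if "i < 2" for i
        using that \<open>u \<in> pverts G\<close> \<open>v \<in> pverts G\<close> by (cases i) (auto simp: p_def)
      then show ?thesis using that(3) by auto
    qed
    define C2 where "C2 s = (if s < n1 then C1 s else {v. \<kappa> v = s - n1})" for s
    have det2: "determines G C2 L \<eta>"
      by (rule determines_agree[OF C1(2) _ symL fv]) (use sym_n n in \<open>auto simp: C2_def\<close>)
    define ty where "ty u v = {\<psi> \<in> L2. sat G C2 (p u v) \<psi>}" for u v
    have ty: "ty u v \<in> Pow L2" for u v by (auto simp: ty_def)
    \<comment> \<open>The type contains the classes, which decide membership in \<open>S\<close>,
      and the formulas in \<open>L\<close>, which determine \<open>\<eta>\<close>; hence it decides
      \<open>D\<close>.\<close>
    have D_ty: "D u v = D u' v'"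
      if uv: "u \<in> pverts G" "v \<in> pverts G" and uv': "u' \<in> pverts G" "v' \<in> pverts G"
        and eq: "ty u v = ty u' v'" for u v u' v'
    proof -
      have agree: "sat G C2 (p u v) \<psi> = sat G C2 (p u' v') \<psi>" if "\<psi> \<in> L2" for \<psi>
        using eq that unfolding ty_def by blast
      have "Col (n1 + \<kappa> u') 0 \<in> L2" "Col (n1 + \<kappa> v') 1 \<in> L2" using \<kappa> by (auto simp: L2_def image_iff)
      from this[THEN agree] have "\<kappa> u = \<kappa> u'" "\<kappa> v = \<kappa> v'" by (simp_all add: p_def C2_def)
      moreover have "sat G C2 (p u v) \<eta> = sat G C2 (p u' v') \<eta>"
        by (rule determinesD[OF det2 p[OF uv fv\<eta>] p[OF uv' fv\<eta>]]) (use agree in \<open>auto simp: L2_def\<close>)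
      moreover have "sat G C2 (p a b) \<eta> = models G C [a, b] \<eta>" if "a \<in> pverts G" "b \<in> pverts G" for a b
        unfolding models_def p_def[symmetric]
        by (rule sat_agree[OF sym_n _ p[OF that fv\<eta>]]) (use C1(1) n in \<open>simp add: C2_def\<close>)
      ultimately show ?thesis using uv uv' by (simp add: D_def)
    qed
    define W where "W = {v \<in> pverts G. models G C [v] \<nu>}"
    \<comment> \<open>The condition in the last branch does not mention \<open>w\<close>: such a
      colour is everything or nothing. Intersecting with the vertex set yields a genuine
      expansion.\<close>
    define C3 where "C3 s = pverts G \<inter> (if s < n1 + m then C2 s else if s = n1 + m then W
      else {w. \<exists>u\<in>pverts G. \<exists>v\<in>pverts G. s = n1 + m + 1 + idx2 (ty u v) \<and> D u v})" for s
    have C3: "sat G C3 (p u v) \<psi> = sat G C2 (p u v) \<psi>"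
      if "u \<in> pverts G" "v \<in> pverts G" "\<psi> \<in> L2" for u v \<psi>
    proof (rule sat_cong)
      fix s w assume "s \<in> symbols \<psi>" "w \<in> pverts G"
      then show "w \<in> C3 s \<longleftrightarrow> w \<in> C2 s" using L2[OF that(3)] by (auto simp: C3_def)
    next
      fix x assume "x \<in> fvars \<psi>"
      then show "p u v x \<in> pverts G \<and> p u v x = p u v x"
        using p[OF that(1,2), of \<psi>] L2[OF that(3)] by blast
    qed
    have sat_tp: "sat G C3 (p u v) (tp \<tau>) \<longleftrightarrow>
        (\<exists>u'\<in>pverts G. \<exists>v'\<in>pverts G. ty u' v' = \<tau> \<and> D u' v') \<and> ty u v = \<tau>"
      if uv: "u \<in> pverts G" "v \<in> pverts G" and \<tau>: "\<tau> \<subseteq> L2" for u v \<tau>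
    proof -
      have fin\<tau>: "finite \<tau>" "finite (Neg ` (L2 - \<tau>))" using \<tau> finL2 finite_subset by auto
      have "(\<forall>\<psi>\<in>\<tau>. sat G C3 (p u v) \<psi>) \<and> (\<forall>\<psi>\<in>L2 - \<tau>. \<not> sat G C3 (p u v) \<psi>) \<longleftrightarrow> ty u v = \<tau>"
        using C3[OF uv] \<tau> unfolding ty_def by blast
      moreover have "idx2 \<tau> = idx2 (ty u' v') \<longleftrightarrow> ty u' v' = \<tau>" for u' v'
        using inj_onD[OF idx2, of \<tau> "ty u' v'"] \<tau> ty by blast
      moreover have "p u v 0 \<in> pverts G" using uv by (simp add: p_def)
      ultimately show ?thesis
        by (simp add: tp_def sat_Conj fin\<tau> C3_def)
    qed
    have core: "models G C3 [u, v] core \<longleftrightarrow> D u v" if uv: "u \<in> pverts G" "v \<in> pverts G" for u v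
    proof -
      have ex: "models G C3 [u, v] core \<longleftrightarrow> (\<exists>\<tau>\<subseteq>L2. sat G C3 (p u v) (tp \<tau>))"
        unfolding core_def models_def p_def using finPL2 by (auto simp: sat_Disj)
      show ?thesis
      proof
        assume "models G C3 [u, v] core"
        then obtain \<tau> where \<tau>: "\<tau> \<subseteq> L2" "sat G C3 (p u v) (tp \<tau>)" using ex by blast
        then obtain u' v' where "u' \<in> pverts G" "v' \<in> pverts G" "ty u' v' = \<tau>" "D u' v'" "ty u v = \<tau>"
          using sat_tp[OF uv \<tau>(1)] by auto
        then show "D u v" using D_ty[OF uv, of u' v'] by simp
      next
        assume "D u v"
        then have "sat G C3 (p u v) (tp (ty u v))" using sat_tp[OF uv, of "ty u v"] uv ty by auto
        then show "models G C3 [u, v] core" using ex ty by auto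
      qed
    qed
    define H where "H = interpret_graph \<nu>' \<eta>' G C3"
    have "models G C3 [v] \<nu>' \<longleftrightarrow> v \<in> W" if "v \<in> pverts G" for v
      using that by (auto simp: \<nu>'_def models_def C3_def)
    then have VH: "pverts H = W" by (auto simp: H_def interpret_graph_def Let_def W_def)
    \<comment> \<open>Symmetrisation and the distance bound in \<open>\<eta>'\<close> lose nothing,
      because \<open>D\<close> is symmetric and holds only at near pairs.\<close>
    have EH: "(u, v) \<in> parcs H \<longleftrightarrow> u \<noteq> v \<and> D u v" if "u \<in> W" "v \<in> W" for u v
    proof -
      have uv: "u \<in> pverts G" "v \<in> pverts G" using that by (auto simp: W_def)
      have "(u, v) \<in> parcs H \<longleftrightarrow> models G C3 [u, v] \<eta>'"
        using that VH by (auto simp: H_def interpret_graph_def Let_def)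
      then show ?thesis
        using m\<eta>'[OF uv] core uv D_sym[OF uv] D_near[OF _ uv] D_near[OF _ uv(2,1)] by auto
    qed
    have "expansion \<Sigma>' G C3" by (auto simp: expansion_def C3_def)
    then have H: "H \<in> noncopying_map \<Sigma>' \<nu>' \<eta>' G" unfolding noncopying_map_def H_def by blast
    then have "pair_graph H" using pair_graph_noncopying_map simple' G by blast
    obtain Ms where Ms: "length Ms = 3 * length ps" "\<forall>M\<in>set Ms. M \<subseteq> W"
      and "\<forall>u\<in>W. \<forall>v\<in>W. flips Ms u v \<longleftrightarrow>
         (\<kappa> u, \<kappa> v) \<in> S \<and> ((\<kappa> u, \<kappa> v) \<in> set ps \<or> (\<kappa> v, \<kappa> u) \<in> set ps)"
      using class_flips[OF \<open>sym S\<close>, of ps W \<kappa>] by blast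
    then have fl: "flips Ms u v \<longleftrightarrow> (\<kappa> u, \<kappa> v) \<in> S" if "u \<in> W" "v \<in> W" for u v
      using that \<kappa> by (simp add: ps_def)
    \<comment> \<open>Flipping along \<open>S\<close> turns \<open>D\<close> back into
      \<open>\<eta>\<close>. The diagonal, where \<open>D\<close> may hold, is excluded on the left
      and false for \<open>\<eta>\<close> on the right.\<close>
    have "{(u, v). u \<in> W \<and> v \<in> W \<and> u \<noteq> v \<and> ((u, v) \<in> parcs H) \<noteq> flips Ms u v} =
        {(u, v). u \<in> W \<and> v \<in> W \<and> models G C [u, v] \<eta>}"
    proof -
      have "u \<noteq> v \<and> ((u, v) \<in> parcs H) \<noteq> flips Ms u v \<longleftrightarrow> models G C [u, v] \<eta>"
        if "u \<in> W" "v \<in> W" for u v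
      proof -
        have "u \<in> pverts G" using that by (simp add: W_def)
        then show ?thesis using EH[OF that] fl[OF that] irr[of u] unfolding D_def by blast
      qed
      then show ?thesis by blast
    qed
    then have "interpret_graph \<nu> \<eta> G C = \<lparr>pverts = pverts H, parcs = {(u, v). u \<in> pverts H \<and>
        v \<in> pverts H \<and> u \<noteq> v \<and> ((u, v) \<in> parcs H) \<noteq> flips Ms u v}\<rparr>"
      by (simp add: interpret_graph_def Let_def VH W_def)
    then have "interpret_graph \<nu> \<eta> G C \<in> P H"
      using flip[OF \<open>pair_graph H\<close> Ms(1)] Ms(2) VH by simp
    then show ?thesis using H unfolding tcomp_def by blast
  qed
  then have "subsumes (P \<circ>\<^sub>T noncopying_map \<Sigma>' \<nu>' \<eta>') T"
    unfolding subsumes_def T noncopying_map_def[of \<Sigma> \<nu> \<eta>] by blast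
  then show ?thesis using P imm by blast
qed

subsection \<open>Interpretations with several copies\<close>

text \<open>No well-formedness is demanded, since an interpretation with several copies need not
  define a symmetric or loop-free relation.\<close>

definition graph_iso_by :: "('a \<Rightarrow> 'b) \<Rightarrow> 'a pair_pre_digraph \<Rightarrow> 'b pair_pre_digraph \<Rightarrow> bool" where
  "graph_iso_by f G H \<longleftrightarrow> bij_betw f (pverts G) (pverts H) \<and>
     (\<forall>u\<in>pverts G. \<forall>v\<in>pverts G. (u, v) \<in> parcs G \<longleftrightarrow> (f u, f v) \<in> parcs H)"

definition graph_iso :: "'a pair_pre_digraph \<Rightarrow> 'b pair_pre_digraph \<Rightarrow> bool" where
  "graph_iso G H \<longleftrightarrow> (\<exists>f. graph_iso_by f G H)"

lemma graph_iso_by_comp: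
  assumes "graph_iso_by f G H" "graph_iso_by g H K"
  shows "graph_iso_by (g \<circ> f) G K"
proof -
  have "f u \<in> pverts H" if "u \<in> pverts G" for u
    using assms(1) that bij_betwE unfolding graph_iso_by_def by metis
  then show ?thesis
    using assms bij_betw_trans unfolding graph_iso_by_def by (metis comp_apply)
qed

lemma graph_iso_trans: "graph_iso G H \<Longrightarrow> graph_iso H K \<Longrightarrow> graph_iso G K"
  unfolding graph_iso_def using graph_iso_by_comp by blast

lemma digraph_iso_if_graph_iso:
  assumes "pair_graph G" "pair_graph H" "graph_iso G H"
  shows "digraph_iso (with_proj G) (with_proj H)"
proof -
  interpret pair_graph G by fact
  obtain f where f: "bij_betw f (pverts G) (pverts H)"
    "\<And>u v. u \<in> pverts G \<Longrightarrow> v \<in> pverts G \<Longrightarrow> (u, v) \<in> parcs G \<longleftrightarrow> (f u, f v) \<in> parcs H"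
    using assms(3) unfolding graph_iso_def graph_iso_by_def by blast
  have inj: "inj_on f (pverts G)" and im: "f ` pverts G = pverts H"
    using f(1) by (simp_all add: bij_betw_def)
  have arcs: "parcs G \<subseteq> pverts G \<times> pverts G" "parcs H \<subseteq> pverts H \<times> pverts H"
    using assms(1,2) by (simp_all add: pair_graph_iff)
  define h where "h = \<lparr>iso_verts = f, iso_arcs = map_prod f f, iso_head = snd, iso_tail = fst\<rparr>"
  have "inj_on (map_prod f f) (pverts G \<times> pverts G)" using inj by (intro map_prod_inj_on)
  then have "inj_on (map_prod f f) (parcs G)" using arcs(1) inj_on_subset by blast
  then have "digraph_isomorphism h"
    unfolding digraph_isomorphism_def using inj wf_digraph_axioms by (simp add: h_def)
  moreover have "map_prod f f ` parcs G = parcs H"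
  proof (intro subset_antisym subsetI)
    fix p assume "p \<in> map_prod f f ` parcs G"
    then obtain u v where "(u, v) \<in> parcs G" "p = (f u, f v)" by auto
    then show "p \<in> parcs H" using f(2)[of u v] arcs(1) by auto
  next
    fix p assume p: "p \<in> parcs H"
    then obtain a b where ab: "p = (a, b)" "a \<in> f ` pverts G" "b \<in> f ` pverts G"
      using arcs(2) im by auto
    then obtain u v where "u \<in> pverts G" "v \<in> pverts G" "a = f u" "b = f v" by blast
    then show "p \<in> map_prod f f ` parcs G"
      using f(2)[of u v] p ab(1) by (intro image_eqI[of _ _ "(u, v)"]) auto
  qed
  then have "with_proj H = app_iso h (with_proj G)"
    by (simp add: app_iso_def h_def im with_proj_def)
  ultimately show ?thesis unfolding digraph_iso_def by blast
qed

text \<open>Several copies are modelled without auxiliary vertices: the \<open>i\<close>-th copy of \<open>v\<close> is \<open>(v, i)\<close>,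
  \<open>\<zeta> i\<close> defines the vertices that have an \<open>i\<close>-th copy, and \<open>\<theta> i j\<close> the adjacency between the
  \<open>i\<close>-th and the \<open>j\<close>-th copies.\<close>

definition multi_interpret ::
    "nat set \<Rightarrow> (nat \<Rightarrow> fm) \<Rightarrow> (nat \<Rightarrow> nat \<Rightarrow> fm) \<Rightarrow> 'a pair_pre_digraph \<Rightarrow> (nat \<Rightarrow> 'a set) \<Rightarrow>
      ('a \<times> nat) pair_pre_digraph" where
  "multi_interpret I \<zeta> \<theta> G C =
     (let W = {(v, i). v \<in> pverts G \<and> i \<in> I \<and> models G C [v] (\<zeta> i)}
      in \<lparr>pverts = W,
          parcs = {((u, i), (v, j)). (u, i) \<in> W \<and> (v, j) \<in> W \<and> models G C [u, v] (\<theta> i j)}\<rparr>)"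

lemma multi_interpret_simps:
  "(v, i) \<in> pverts (multi_interpret I \<zeta> \<theta> G C) \<longleftrightarrow>
     v \<in> pverts G \<and> i \<in> I \<and> models G C [v] (\<zeta> i)"
  "((u, i), (v, j)) \<in> parcs (multi_interpret I \<zeta> \<theta> G C) \<longleftrightarrow>
     (u, i) \<in> pverts (multi_interpret I \<zeta> \<theta> G C) \<and> (v, j) \<in> pverts (multi_interpret I \<zeta> \<theta> G C) \<and>
     models G C [u, v] (\<theta> i j)"
  by (auto simp: multi_interpret_def Let_def)

definition binary_system :: "nat set \<Rightarrow> (nat \<Rightarrow> fm) \<Rightarrow> (nat \<Rightarrow> nat \<Rightarrow> fm) \<Rightarrow> bool" where
  "binary_system I \<zeta> \<theta> \<longleftrightarrow> finite I \<and> (\<forall>i. fvars (\<zeta> i) \<subseteq> {..<1}) \<and> (\<forall>i j. fvars (\<theta> i j) \<subseteq> {..<2})"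

lemma models_iso:
  assumes f: "graph_iso_by f G H" and C: "\<And>s v. v \<in> pverts G \<Longrightarrow> v \<in> C s \<longleftrightarrow> f v \<in> D s"
    and vs: "set vs \<subseteq> pverts G" "fvars \<phi> \<subseteq> {..<length vs}"
  shows "models G C vs \<phi> = models H D (map f vs) \<phi>"
  unfolding models_def
proof (rule sat_iso[of f])
  fix x assume "x \<in> fvars \<phi>"
  then have "x < length vs" using vs by auto
  then show "vs ! x \<in> pverts G \<and> map f vs ! x = f (vs ! x)" using vs(1) nth_mem by force
qed (use f C in \<open>auto simp: graph_iso_by_def\<close>)

lemma multi_interpret_iso:
  assumes sys: "binary_system I \<zeta> \<theta>"
    and f: "graph_iso_by f G H" and C: "\<And>s v. v \<in> pverts G \<Longrightarrow> v \<in> C s \<longleftrightarrow> f v \<in> D s"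
  shows "graph_iso_by (map_prod f id) (multi_interpret I \<zeta> \<theta> G C) (multi_interpret I \<zeta> \<theta> H D)"
proof -
  have bij: "bij_betw f (pverts G) (pverts H)" using f by (simp add: graph_iso_by_def)
  have fV: "f v \<in> pverts H" if "v \<in> pverts G" for v using bij that bij_betwE by metis
  have \<zeta>: "models G C [v] (\<zeta> i) = models H D [f v] (\<zeta> i)" if "v \<in> pverts G" for v i
    using models_iso[OF f C, of "[v]" "\<zeta> i"] sys that by (simp add: binary_system_def)
  have \<theta>: "models G C [u, v] (\<theta> i j) = models H D [f u, f v] (\<theta> i j)"
    if "u \<in> pverts G" "v \<in> pverts G" for u v i j
    using models_iso[OF f C, of "[u, v]" "\<theta> i j"] sys that
    by (simp add: binary_system_def numeral_2_eq_2)
  have V: "(f v, i) \<in> pverts (multi_interpret I \<zeta> \<theta> H D) \<longleftrightarrow>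
      (v, i) \<in> pverts (multi_interpret I \<zeta> \<theta> G C)" if "v \<in> pverts G" for v i
    using \<zeta>[OF that] that fV[OF that] by (simp add: multi_interpret_simps)
  show ?thesis
    unfolding graph_iso_by_def
  proof (intro conjI ballI)
    show "bij_betw (map_prod f id) (pverts (multi_interpret I \<zeta> \<theta> G C))
        (pverts (multi_interpret I \<zeta> \<theta> H D))"
    proof (rule bij_betw_imageI)
      show "inj_on (map_prod f id) (pverts (multi_interpret I \<zeta> \<theta> G C))"
        using bij by (auto simp: inj_on_def bij_betw_def multi_interpret_simps)
      show "map_prod f id ` pverts (multi_interpret I \<zeta> \<theta> G C) = pverts (multi_interpret I \<zeta> \<theta> H D)"
      proof (intro subset_antisym subsetI)
        fix p assume "p \<in> map_prod f id ` pverts (multi_interpret I \<zeta> \<theta> G C)"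
        then obtain v i where vi: "(v, i) \<in> pverts (multi_interpret I \<zeta> \<theta> G C)" "p = (f v, i)" by auto
        then have "v \<in> pverts G" by (simp add: multi_interpret_simps)
        then show "p \<in> pverts (multi_interpret I \<zeta> \<theta> H D)" using V vi by blast
      next
        fix p assume p: "p \<in> pverts (multi_interpret I \<zeta> \<theta> H D)"
        obtain w i where w: "p = (w, i)" by (cases p)
        then have "w \<in> pverts H" using p by (simp add: multi_interpret_simps)
        then obtain v where v: "v \<in> pverts G" "w = f v" using bij by (auto simp: bij_betw_def)
        then show "p \<in> map_prod f id ` pverts (multi_interpret I \<zeta> \<theta> G C)"
          using p w V[OF v(1)] by (intro image_eqI[of _ _ "(v, i)"]) auto
      qed
    qed
  next
    fix p q assume pq: "p \<in> pverts (multi_interpret I \<zeta> \<theta> G C)" "q \<in> pverts (multi_interpret I \<zeta> \<theta> G C)"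
    obtain u i v j where "p = (u, i)" "q = (v, j)" by (cases p, cases q)
    then show "(p, q) \<in> parcs (multi_interpret I \<zeta> \<theta> G C) \<longleftrightarrow>
        (map_prod f id p, map_prod f id q) \<in> parcs (multi_interpret I \<zeta> \<theta> H D)"
      using pq V \<theta> by (simp add: multi_interpret_simps(1)[of _ _ I \<zeta> \<theta> G] multi_interpret_simps(2))
  qed
qed

section \<open>Translating formulas back through an interpretation\<close>

primrec translate ::
    "nat set \<Rightarrow> (nat \<Rightarrow> fm) \<Rightarrow> (nat \<Rightarrow> nat \<Rightarrow> fm) \<Rightarrow> nat \<Rightarrow> fm \<Rightarrow> (nat \<Rightarrow> nat) \<Rightarrow> fm" where
  "translate I \<zeta> \<theta> n (Eq x y) \<iota> = (if \<iota> x = \<iota> y then Eq x y else Neg Tr)"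
| "translate I \<zeta> \<theta> n (Adj x y) \<iota> = inst2 (\<theta> (\<iota> x) (\<iota> y)) x y"
| "translate I \<zeta> \<theta> n (Col s x) \<iota> = Col (n + prod_encode (s, \<iota> x)) x"
| "translate I \<zeta> \<theta> n (Neg \<phi>) \<iota> = Neg (translate I \<zeta> \<theta> n \<phi> \<iota>)"
| "translate I \<zeta> \<theta> n (And \<phi> \<psi>) \<iota> = And (translate I \<zeta> \<theta> n \<phi> \<iota>) (translate I \<zeta> \<theta> n \<psi> \<iota>)"
| "translate I \<zeta> \<theta> n (Ex x \<phi>) \<iota> =
     Disj ((\<lambda>i. Ex x (And (inst2 (\<zeta> i) x x) (translate I \<zeta> \<theta> n \<phi> (\<iota>(x := i))))) ` I)"

definition merge_colours :: "nat \<Rightarrow> (nat \<Rightarrow> 'a set) \<Rightarrow> (nat \<Rightarrow> ('a \<times> nat) set) \<Rightarrow> nat \<Rightarrow> 'a set" where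
  "merge_colours n C D t =
     (if t < n then C t else case prod_decode (t - n) of (s, i) \<Rightarrow> {v. (v, i) \<in> D s})"

lemma fvars_translate:
  assumes "binary_system I \<zeta> \<theta>"
  shows "fvars (translate I \<zeta> \<theta> n \<phi> \<iota>) \<subseteq> fvars \<phi>"
proof (induction \<phi> arbitrary: \<iota>)
  case (Adj x y)
  then show ?case using assms fvars_inst2 by (simp add: binary_system_def)
next
  case (Ex x \<phi>)
  have "fvars (inst2 (\<zeta> i) x x) \<subseteq> {x}" for i
  proof -
    have "fvars (\<zeta> i) \<subseteq> {..<1}" using assms by (simp add: binary_system_def)
    then have "fvars (\<zeta> i) \<subseteq> {..<2}" by auto
    from fvars_inst2[OF this, of x x] show ?thesis by simp
  qed
  then show ?case using Ex assms by (auto simp: binary_system_def fvars_Disj)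
qed (auto simp: Tr_def)

text \<open>A variable ranging over pairs splits into a variable for the vertex and an index
  recorded in \<open>\<iota>\<close> during translation. A quantifier becomes a finite disjunction
  over the indices, and a colour on pairs becomes one colour for each index. Symbols below
  \<open>n\<close> stay reserved for the interpretation itself.\<close>

lemma sat_translate:
  assumes sys: "binary_system I \<zeta> \<theta>"
    and sym: "\<And>i. i \<in> I \<Longrightarrow> symbols (\<zeta> i) \<subseteq> {..<n}"
      "\<And>i j. i \<in> I \<Longrightarrow> j \<in> I \<Longrightarrow> symbols (\<theta> i j) \<subseteq> {..<n}"
    and "\<And>x. x \<in> fvars \<phi> \<Longrightarrow> (e x, \<iota> x) \<in> pverts (multi_interpret I \<zeta> \<theta> G C)"
  shows "sat (multi_interpret I \<zeta> \<theta> G C) D (\<lambda>x. (e x, \<iota> x)) \<phi> =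
    sat G (merge_colours n C D) e (translate I \<zeta> \<theta> n \<phi> \<iota>)"
  using assms(4)
proof (induction \<phi> arbitrary: e \<iota>)
  case (Eq x y)
  then show ?case by (auto simp: Tr_def)
next
  case (Adj x y)
  then have xy: "(e x, \<iota> x) \<in> pverts (multi_interpret I \<zeta> \<theta> G C)"
    "(e y, \<iota> y) \<in> pverts (multi_interpret I \<zeta> \<theta> G C)" by simp_all
  then have V: "e x \<in> pverts G" "e y \<in> pverts G" "\<iota> x \<in> I" "\<iota> y \<in> I" by (simp_all add: multi_interpret_simps)
  have fv: "fvars (\<theta> (\<iota> x) (\<iota> y)) \<subseteq> {..<2}" using sys by (simp add: binary_system_def)
  have "models G C [e x, e y] (\<theta> (\<iota> x) (\<iota> y)) =
      models G (merge_colours n C D) [e x, e y] (\<theta> (\<iota> x) (\<iota> y))"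
    unfolding models_def
  proof (rule sat_cong)
    fix s v assume "s \<in> symbols (\<theta> (\<iota> x) (\<iota> y))"
    then show "v \<in> C s \<longleftrightarrow> v \<in> merge_colours n C D s" using sym(2) V by (auto simp: merge_colours_def)
  next
    fix z assume "z \<in> fvars (\<theta> (\<iota> x) (\<iota> y))"
    then have "z < 2" using fv by auto
    then show "[e x, e y] ! z \<in> pverts G \<and> [e x, e y] ! z = [e x, e y] ! z"
      using V by (cases z) auto
  qed
  then show ?case using xy sat_inst2[OF fv V(1,2)] by (simp add: multi_interpret_simps(2))
next
  case (Col s x)
  then show ?case by (simp add: merge_colours_def)
next
  case (Neg \<phi>)
  have "sat (multi_interpret I \<zeta> \<theta> G C) D (\<lambda>x. (e x, \<iota> x)) \<phi> =
    sat G (merge_colours n C D) e (translate I \<zeta> \<theta> n \<phi> \<iota>)" by (rule Neg.IH) (use Neg.prems in simp)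
  then show ?case by simp
next
  case (And \<phi> \<psi>)
  have "sat (multi_interpret I \<zeta> \<theta> G C) D (\<lambda>x. (e x, \<iota> x)) \<phi> =
    sat G (merge_colours n C D) e (translate I \<zeta> \<theta> n \<phi> \<iota>)" by (rule And.IH) (use And.prems in simp)
  moreover have "sat (multi_interpret I \<zeta> \<theta> G C) D (\<lambda>x. (e x, \<iota> x)) \<psi> =
    sat G (merge_colours n C D) e (translate I \<zeta> \<theta> n \<psi> \<iota>)" by (rule And.IH) (use And.prems in simp)
  ultimately show ?case by simp
next
  case (Ex x \<phi>)
  have finI: "finite I" using sys by (simp add: binary_system_def)
  have upd: "(\<lambda>y. (e y, \<iota> y))(x := (v, i)) = (\<lambda>y. ((e(x := v)) y, (\<iota>(x := i)) y))" for v i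
    by auto
  have step: "sat (multi_interpret I \<zeta> \<theta> G C) D ((\<lambda>y. (e y, \<iota> y))(x := (v, i))) \<phi> =
      sat G (merge_colours n C D) (e(x := v)) (translate I \<zeta> \<theta> n \<phi> (\<iota>(x := i)))"
    if "(v, i) \<in> pverts (multi_interpret I \<zeta> \<theta> G C)" for v i
    unfolding upd by (rule Ex.IH) (use Ex.prems that in auto)
  \<comment> \<open>\<open>\<zeta> i\<close> has at most the free variable 0, so the second argument
    of \<open>inst2\<close> is arbitrary and \<open>x\<close> is repeated.\<close>
  have dom: "sat G (merge_colours n C D) (e(x := v)) (inst2 (\<zeta> i) x x) \<longleftrightarrow>
      (v, i) \<in> pverts (multi_interpret I \<zeta> \<theta> G C)" if v: "v \<in> pverts G" and i: "i \<in> I" for v i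
  proof -
    have fv: "fvars (\<zeta> i) \<subseteq> {..<1}" using sys by (simp add: binary_system_def)
    then have fv2: "fvars (\<zeta> i) \<subseteq> {..<2}" by auto
    have "sat G (merge_colours n C D) (e(x := v)) (inst2 (\<zeta> i) x x) =
        models G (merge_colours n C D) [v, v] (\<zeta> i)"
      using sat_inst2[OF fv2, of "e(x := v)" x G x] v by simp
    also have "\<dots> = models G C [v] (\<zeta> i)"
      unfolding models_def
      by (rule sat_cong) (use fv v sym(1)[OF i] in \<open>auto simp: merge_colours_def\<close>)
    finally show ?thesis using v i by (simp add: multi_interpret_simps)
  qed
  have "sat (multi_interpret I \<zeta> \<theta> G C) D (\<lambda>x. (e x, \<iota> x)) (Ex x \<phi>) \<longleftrightarrow>
      (\<exists>v i. (v, i) \<in> pverts (multi_interpret I \<zeta> \<theta> G C) \<and>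
        sat G (merge_colours n C D) (e(x := v)) (translate I \<zeta> \<theta> n \<phi> (\<iota>(x := i))))"
    using step by auto
  also have "\<dots> \<longleftrightarrow> (\<exists>i\<in>I. \<exists>v\<in>pverts G. sat G (merge_colours n C D) (e(x := v)) (inst2 (\<zeta> i) x x) \<and>
        sat G (merge_colours n C D) (e(x := v)) (translate I \<zeta> \<theta> n \<phi> (\<iota>(x := i))))"
    using dom by (auto simp: multi_interpret_simps)
  finally show ?case using finI by (simp add: sat_Disj)
qed

text \<open>Only one inclusion is recorded, as only subsumption is wanted: the interpretation may
  produce further graphs.\<close>

definition multi_interpretable :: "transd \<Rightarrow> bool" where
  "multi_interpretable T \<longleftrightarrow> (\<exists>I \<zeta> \<theta>. binary_system I \<zeta> \<theta> \<and>
     (\<forall>G H. pair_graph G \<longrightarrow> H \<in> T G \<longrightarrow> (\<exists>C. graph_iso H (multi_interpret I \<zeta> \<theta> G C))))"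

lemma multi_interpretable_copy:
  assumes "copy_operation T"
  shows "multi_interpretable T"
proof -
  obtain k where T: "T = (\<lambda>G. {copies k G})" using assms unfolding copy_operation_def by blast
  define \<theta> where "\<theta> i j = (if i = j then Adj 0 1 else Eq 0 1)" for i j :: nat
  let ?R = "\<lambda>G :: ngraph. multi_interpret {..<k} (\<lambda>_. Eq 0 0) \<theta> G (\<lambda>_. {})"
  have "graph_iso_by prod_decode (copies k G) (?R G)" if G: "pair_graph G" for G
    unfolding graph_iso_by_def
  proof (intro conjI ballI)
    have "pverts (copies k G) = prod_encode ` pverts (?R G)"
      by (auto simp: copies_def multi_interpret_simps models_def image_iff)
    then show "bij_betw prod_decode (pverts (copies k G)) (pverts (?R G))"
      by (simp add: bij_betw_def image_image inj_on_def)
  next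
    fix p q assume "p \<in> pverts (copies k G)" "q \<in> pverts (copies k G)"
    then obtain u i v j where p: "p = prod_encode (u, i)" "u \<in> pverts G" "i < k"
      and q: "q = prod_encode (v, j)" "v \<in> pverts G" "j < k" by (auto simp: copies_def)
    have "(p, q) \<in> parcs (copies k G) \<longleftrightarrow> (u, v) \<in> parcs G \<and> i = j \<or> u = v \<and> i \<noteq> j"
      using p q by (auto simp: copies_def)
    also have "\<dots> \<longleftrightarrow> models G (\<lambda>_. {}) [u, v] (\<theta> i j)" by (simp add: models_def \<theta>_def)
    also have "\<dots> \<longleftrightarrow> (prod_decode p, prod_decode q) \<in> parcs (?R G)"
      using p q by (simp add: multi_interpret_simps models_def)
    finally show "(p, q) \<in> parcs (copies k G) \<longleftrightarrow> (prod_decode p, prod_decode q) \<in> parcs (?R G)" .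
  qed
  then have "\<exists>C. graph_iso H (multi_interpret {..<k} (\<lambda>_. Eq 0 0) \<theta> G C)"
    if "pair_graph G" "H \<in> T G" for G H
    using that unfolding T graph_iso_def by auto
  moreover have "binary_system {..<k} (\<lambda>_. Eq 0 0) \<theta>"
    by (auto simp: binary_system_def \<theta>_def)
  ultimately show ?thesis unfolding multi_interpretable_def by blast
qed

lemma multi_interpretable_noncopying:
  assumes "noncopying T"
  shows "multi_interpretable T"
proof -
  obtain \<Sigma> \<nu> \<eta> where simple: "simple_interpretation \<Sigma> \<nu> \<eta>" and T: "T = noncopying_map \<Sigma> \<nu> \<eta>"
    using assms unfolding noncopying_def by blast
  have "graph_iso_by (\<lambda>v. (v, 0)) (interpret_graph \<nu> \<eta> G C) (multi_interpret {0} (\<lambda>_. \<nu>) (\<lambda>_ _. \<eta>) G C)"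
    for G :: ngraph and C
    by (auto simp: graph_iso_by_def bij_betw_def inj_on_def interpret_graph_def multi_interpret_def Let_def)
  then have "\<exists>C. graph_iso H (multi_interpret {0} (\<lambda>_. \<nu>) (\<lambda>_ _. \<eta>) G C)" if "H \<in> T G" for G H
    using that unfolding T noncopying_map_def graph_iso_def by blast
  moreover have "binary_system {0} (\<lambda>_. \<nu>) (\<lambda>_ _. \<eta>)"
    using simple by (simp add: binary_system_def simple_interpretation_def)
  ultimately show ?thesis unfolding multi_interpretable_def by blast
qed

lemma binary_system_symbols_bounded:
  assumes "finite I"
  obtains n where "\<And>i. i \<in> I \<Longrightarrow> symbols (\<zeta> i) \<subseteq> {..<n}"
    "\<And>i j. i \<in> I \<Longrightarrow> j \<in> I \<Longrightarrow> symbols (\<theta> i j) \<subseteq> {..<n}"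
proof -
  have "finite ((\<Union>i\<in>I. symbols (\<zeta> i)) \<union> (\<Union>i\<in>I. \<Union>j\<in>I. symbols (\<theta> i j)))"
    using assms finite_symbols by blast
  then obtain n where "\<forall>s\<in>(\<Union>i\<in>I. symbols (\<zeta> i)) \<union> (\<Union>i\<in>I. \<Union>j\<in>I. symbols (\<theta> i j)). s < n"
    using finite_nat_set_iff_bounded by blast
  then show thesis by (intro that[of n]) auto
qed

lemma models_translate:
  assumes sys: "binary_system I \<zeta> \<theta>"
    and sym: "\<And>i. i \<in> I \<Longrightarrow> symbols (\<zeta> i) \<subseteq> {..<n}"
      "\<And>i j. i \<in> I \<Longrightarrow> j \<in> I \<Longrightarrow> symbols (\<theta> i j) \<subseteq> {..<n}"
  shows "fvars \<phi> \<subseteq> {..<1} \<Longrightarrow> (v, j) \<in> pverts (multi_interpret I \<zeta> \<theta> G C) \<Longrightarrow>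
      models (multi_interpret I \<zeta> \<theta> G C) D [(v, j)] \<phi> =
      models G (merge_colours n C D) [v] (translate I \<zeta> \<theta> n \<phi> (\<lambda>_. j))" (is "_ \<Longrightarrow> ?A \<Longrightarrow> ?B")
    and "fvars \<phi> \<subseteq> {..<2} \<Longrightarrow> (u, i) \<in> pverts (multi_interpret I \<zeta> \<theta> G C) \<Longrightarrow>
      (v, j) \<in> pverts (multi_interpret I \<zeta> \<theta> G C) \<Longrightarrow>
      models (multi_interpret I \<zeta> \<theta> G C) D [(u, i), (v, j)] \<phi> =
      models G (merge_colours n C D) [u, v] (translate I \<zeta> \<theta> n \<phi> (\<lambda>x. if x = 0 then i else j))"
proof -
  assume fv: "fvars \<phi> \<subseteq> {..<1}" and v: "(v, j) \<in> pverts (multi_interpret I \<zeta> \<theta> G C)"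
  have "models (multi_interpret I \<zeta> \<theta> G C) D [(v, j)] \<phi> =
      sat (multi_interpret I \<zeta> \<theta> G C) D (\<lambda>x. (v, j)) \<phi>"
    by (rule models_Cons[OF fv v]) simp
  also have "\<dots> = sat G (merge_colours n C D) (\<lambda>_. v) (translate I \<zeta> \<theta> n \<phi> (\<lambda>_. j))"
    using sat_translate[OF sys sym, of \<phi> "\<lambda>_. v" "\<lambda>_. j" G C D] v by simp
  also have "\<dots> = models G (merge_colours n C D) [v] (translate I \<zeta> \<theta> n \<phi> (\<lambda>_. j))"
    by (rule models_Cons[OF subset_trans[OF fvars_translate[OF sys] fv], symmetric])
      (use v in \<open>simp_all add: multi_interpret_simps\<close>)
  finally show ?B .
next
  assume fv: "fvars \<phi> \<subseteq> {..<2}" and u: "(u, i) \<in> pverts (multi_interpret I \<zeta> \<theta> G C)"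
    and v: "(v, j) \<in> pverts (multi_interpret I \<zeta> \<theta> G C)"
  define e where "e = (\<lambda>x::nat. if x = 0 then u else v)"
  define \<iota> where "\<iota> = (\<lambda>x::nat. if x = 0 then i else j)"
  have "models (multi_interpret I \<zeta> \<theta> G C) D [(u, i), (v, j)] \<phi> =
      sat (multi_interpret I \<zeta> \<theta> G C) D (\<lambda>x. (e x, \<iota> x)) \<phi>"
    by (rule models_Cons2[OF fv u v]) (simp_all add: e_def \<iota>_def)
  also have "\<dots> = sat G (merge_colours n C D) e (translate I \<zeta> \<theta> n \<phi> \<iota>)"
    by (rule sat_translate[OF sys sym]) (use u v in \<open>auto simp: e_def \<iota>_def\<close>)
  also have "\<dots> = models G (merge_colours n C D) [u, v] (translate I \<zeta> \<theta> n \<phi> \<iota>)"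
    by (rule models_Cons2[OF subset_trans[OF fvars_translate[OF sys] fv], symmetric])
      (use u v in \<open>simp_all add: multi_interpret_simps e_def\<close>)
  finally show "models (multi_interpret I \<zeta> \<theta> G C) D [(u, i), (v, j)] \<phi> =
      models G (merge_colours n C D) [u, v] (translate I \<zeta> \<theta> n \<phi> (\<lambda>x. if x = 0 then i else j))"
    unfolding \<iota>_def .
qed

lemma models_merge_colours:
  assumes "symbols \<phi> \<subseteq> {..<n}" "fvars \<phi> \<subseteq> {..<length vs}" "set vs \<subseteq> pverts G"
  shows "models G (merge_colours n C D) vs \<phi> = models G C vs \<phi>"
  unfolding models_def
proof (rule sat_cong)
  fix x assume "x \<in> fvars \<phi>"
  then have "x < length vs" using assms(2) by auto
  then show "vs ! x \<in> pverts G \<and> vs ! x = vs ! x" using assms(3) nth_mem by blast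
qed (use assms(1) in \<open>auto simp: merge_colours_def\<close>)

text \<open>A copy of a copy is indexed by a pair, encoded as a number. The outer formulas are
  translated through the inner interpretation, and both colourings are merged into one. That
  \<open>T\<close> is a transduction makes its outputs genuine graphs, as needed to apply the
  assumption on \<open>S\<close>.\<close>

lemma multi_interpretable_comp:
  assumes S: "multi_interpretable S" and T: "multi_interpretable T" and "transduction T"
  shows "multi_interpretable (S \<circ>\<^sub>T T)"
proof -
  obtain I1 \<zeta>1 \<theta>1 where sys1: "binary_system I1 \<zeta>1 \<theta>1"
    and T: "\<And>G H. pair_graph G \<Longrightarrow> H \<in> T G \<Longrightarrow> \<exists>C. graph_iso H (multi_interpret I1 \<zeta>1 \<theta>1 G C)"
    using T unfolding multi_interpretable_def by blast
  obtain I2 \<zeta>2 \<theta>2 where sys2: "binary_system I2 \<zeta>2 \<theta>2"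
    and S: "\<And>G H. pair_graph G \<Longrightarrow> H \<in> S G \<Longrightarrow> \<exists>C. graph_iso H (multi_interpret I2 \<zeta>2 \<theta>2 G C)"
    using S unfolding multi_interpretable_def by blast
  have "finite I1" using sys1 by (simp add: binary_system_def)
  then obtain n where sym: "\<And>i. i \<in> I1 \<Longrightarrow> symbols (\<zeta>1 i) \<subseteq> {..<n}"
    "\<And>i j. i \<in> I1 \<Longrightarrow> j \<in> I1 \<Longrightarrow> symbols (\<theta>1 i j) \<subseteq> {..<n}"
    using binary_system_symbols_bounded[of I1 \<zeta>1 \<theta>1] by blast
  define tr where "tr = translate I1 \<zeta>1 \<theta>1 n"
  define I where "I = prod_encode ` (I1 \<times> I2)"
  define \<zeta> where "\<zeta> a = (case prod_decode a of (i, j) \<Rightarrow> And (\<zeta>1 i) (tr (\<zeta>2 j) (\<lambda>_. i)))" for a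
  define \<theta> where "\<theta> a b = (case prod_decode a of (i, j) \<Rightarrow> case prod_decode b of (i', j') \<Rightarrow>
    tr (\<theta>2 j j') (\<lambda>x. if x = 0 then i else i'))" for a b
  have fv1: "fvars (\<zeta>1 i) \<subseteq> {..<1}" "fvars (\<theta>1 i i') \<subseteq> {..<2}" for i i'
    using sys1 by (simp_all add: binary_system_def)
  have fv2: "fvars (\<zeta>2 j) \<subseteq> {..<1}" "fvars (\<theta>2 j j') \<subseteq> {..<2}" for j j'
    using sys2 by (simp_all add: binary_system_def)
  have "fvars (\<zeta> a) \<subseteq> {..<1}" for a
  proof -
    obtain i j where "prod_decode a = (i, j)" by (cases "prod_decode a")
    then show ?thesis
      using fv1(1)[of i] fv2(1)[of j] fvars_translate[OF sys1, of n "\<zeta>2 j" "\<lambda>_. i"]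
      unfolding \<zeta>_def tr_def by simp
  qed
  moreover have "fvars (\<theta> a b) \<subseteq> {..<2}" for a b
  proof -
    obtain i j where "prod_decode a = (i, j)" by (cases "prod_decode a")
    moreover obtain i' j' where "prod_decode b = (i', j')" by (cases "prod_decode b")
    ultimately show ?thesis
      using fv2(2)[of j j'] fvars_translate[OF sys1, of n "\<theta>2 j j'" "\<lambda>x. if x = 0 then i else i'"]
      unfolding \<theta>_def tr_def by simp
  qed
  moreover have "finite I" using sys1 sys2 by (simp add: I_def binary_system_def)
  ultimately have sys: "binary_system I \<zeta> \<theta>" by (simp add: binary_system_def)
  define g where "g = (\<lambda>((v, i), j). (v :: nat, prod_encode (i, j)))"
  have iso: "graph_iso_by g (multi_interpret I2 \<zeta>2 \<theta>2 (multi_interpret I1 \<zeta>1 \<theta>1 G C) D)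
      (multi_interpret I \<zeta> \<theta> G (merge_colours n C D))" (is "graph_iso_by g ?A ?B")
    for G :: ngraph and C D
  proof -
    have \<zeta>: "((v, i), j) \<in> pverts ?A \<longleftrightarrow> (v, prod_encode (i, j)) \<in> pverts ?B" for v i j
    proof (cases "v \<in> pverts G \<and> i \<in> I1 \<and> j \<in> I2 \<and> models G C [v] (\<zeta>1 i)")
      case True
      then have v: "(v, i) \<in> pverts (multi_interpret I1 \<zeta>1 \<theta>1 G C)" by (simp add: multi_interpret_simps)
      have "((v, i), j) \<in> pverts ?A \<longleftrightarrow> models G (merge_colours n C D) [v] (tr (\<zeta>2 j) (\<lambda>_. i))"
        using True v models_translate(1)[OF sys1 sym fv2(1) v] by (simp add: multi_interpret_simps(1) tr_def)
      moreover have "models G (merge_colours n C D) [v] (\<zeta>1 i)"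
        using models_merge_colours[of "\<zeta>1 i" n "[v]" G C D] True sym(1) fv1(1) by simp
      ultimately show ?thesis using True by (simp add: multi_interpret_simps(1) \<zeta>_def I_def models_def image_iff)
    next
      case False
      have "models G (merge_colours n C D) [v] (\<zeta>1 i) = models G C [v] (\<zeta>1 i)"
        if "v \<in> pverts G" "i \<in> I1"
        using models_merge_colours[of "\<zeta>1 i" n "[v]" G C D] that sym(1) fv1(1) by simp
      then show ?thesis
        using False by (auto simp: multi_interpret_simps(1) \<zeta>_def I_def models_def)
    qed
    show ?thesis
      unfolding graph_iso_by_def
    proof (intro conjI ballI)
      have "g ` pverts ?A = pverts ?B"
      proof (intro subset_antisym subsetI)
        fix p assume "p \<in> g ` pverts ?A"
        then show "p \<in> pverts ?B" using \<zeta> by (auto simp: g_def)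
      next
        fix p assume p: "p \<in> pverts ?B"
        obtain v a where va: "p = (v, a)" by (cases p)
        obtain i j where "a = prod_encode (i, j)" by (metis prod_decode_inverse surj_pair)
        then show "p \<in> g ` pverts ?A"
          using p va \<zeta> by (intro image_eqI[of _ _ "((v, i), j)"]) (simp_all add: g_def)
      qed
      moreover have "inj_on g (pverts ?A)" by (auto simp: inj_on_def g_def)
      ultimately show "bij_betw g (pverts ?A) (pverts ?B)" by (simp add: bij_betw_def)
    next
      fix p q assume p: "p \<in> pverts ?A" and q: "q \<in> pverts ?A"
      obtain u i j where pd: "p = ((u, i), j)" by (metis surj_pair)
      obtain v i' j' where qd: "q = ((v, i'), j')" by (metis surj_pair)
      have V: "(u, i) \<in> pverts (multi_interpret I1 \<zeta>1 \<theta>1 G C)" "(v, i') \<in> pverts (multi_interpret I1 \<zeta>1 \<theta>1 G C)"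
        using p q by (simp_all add: pd qd multi_interpret_simps(1)[of _ _ I2])
      have "(p, q) \<in> parcs ?A \<longleftrightarrow> models (multi_interpret I1 \<zeta>1 \<theta>1 G C) D [(u, i), (v, i')] (\<theta>2 j j')"
        using p q by (simp add: pd qd multi_interpret_simps(2))
      also have "\<dots> \<longleftrightarrow> models G (merge_colours n C D) [u, v] (\<theta> (prod_encode (i, j)) (prod_encode (i', j')))"
        using models_translate(2)[OF sys1 sym fv2(2) V] by (simp add: \<theta>_def tr_def)
      also have "\<dots> \<longleftrightarrow> (g p, g q) \<in> parcs ?B"
        using p q \<zeta> by (simp add: pd qd g_def multi_interpret_simps(2))
      finally show "(p, q) \<in> parcs ?A \<longleftrightarrow> (g p, g q) \<in> parcs ?B" .
    qed
  qed
  have "\<exists>C. graph_iso K (multi_interpret I \<zeta> \<theta> G C)" if G: "pair_graph G" and K: "K \<in> (S \<circ>\<^sub>T T) G" for G K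
  proof -
    obtain H where H: "H \<in> T G" "K \<in> S H" using K unfolding tcomp_def by blast
    have "pair_graph H" using transduction_pair_graph[OF \<open>transduction T\<close> G H(1)] .
    then obtain D where K: "graph_iso K (multi_interpret I2 \<zeta>2 \<theta>2 H D)" using S H(2) by blast
    obtain C f where f: "graph_iso_by f H (multi_interpret I1 \<zeta>1 \<theta>1 G C)"
      using T[OF G H(1)] unfolding graph_iso_def by blast
    \<comment> \<open>The intermediate graph is known only up to isomorphism, so the colours used by
      the second interpretation are carried along \<open>f\<close>.\<close>
    define D' where "D' s = f ` (D s \<inter> pverts H)" for s
    have "inj_on f (pverts H)" using f by (simp add: graph_iso_by_def bij_betw_def)
    then have D': "v \<in> D s \<longleftrightarrow> f v \<in> D' s" if "v \<in> pverts H" for s v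
      using that unfolding D'_def inj_on_def by blast
    have "graph_iso_by (map_prod f id) (multi_interpret I2 \<zeta>2 \<theta>2 H D)
        (multi_interpret I2 \<zeta>2 \<theta>2 (multi_interpret I1 \<zeta>1 \<theta>1 G C) D')"
      by (rule multi_interpret_iso[OF sys2 f]) (rule D')
    then have 1: "graph_iso (multi_interpret I2 \<zeta>2 \<theta>2 H D) (multi_interpret I2 \<zeta>2 \<theta>2 (multi_interpret I1 \<zeta>1 \<theta>1 G C) D')"
      unfolding graph_iso_def by blast
    have 2: "graph_iso (multi_interpret I2 \<zeta>2 \<theta>2 (multi_interpret I1 \<zeta>1 \<theta>1 G C) D')
        (multi_interpret I \<zeta> \<theta> G (merge_colours n C D'))"
      using iso unfolding graph_iso_def by blast
    show ?thesis using graph_iso_trans[OF graph_iso_trans[OF K 1] 2] by blast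
  qed
  then show ?thesis using sys unfolding multi_interpretable_def by blast
qed

lemma transduction_multi_interpretable: "transduction T \<Longrightarrow> multi_interpretable T"
proof (induction rule: transduction.induct)
  case (copy T)
  then show ?case by (rule multi_interpretable_copy)
next
  case (noncopy T)
  then show ?case by (rule multi_interpretable_noncopying)
next
  case (comp S T)
  then show ?case using multi_interpretable_comp by blast
qed

text \<open>\<open>K = copies k G\<close> contains \<open>G\<close> as its copy \<open>0\<close>, which a colour singles out. With a colour for
  each copy, the vertex of copy \<open>0\<close> belonging to a given vertex \<open>x\<close> of \<open>K\<close> is definable as \<open>x\<close>
  itself or its only neighbour in copy \<open>0\<close>.\<close>

definition base_vertex :: "nat \<Rightarrow> nat \<Rightarrow> fm" where
  "base_vertex a x =
     And (Col 0 a) (Neg (And (Neg (Eq a x)) (Neg (And (Neg (Col 0 x)) (Adj a x)))))"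

lemma sat_base_vertex:
  assumes "pair_graph G" "e a \<in> pverts (copies k G)" "e x = prod_encode (v, i)" "v \<in> pverts G" "i < k"
    and "\<And>w. w \<in> pverts (copies k G) \<Longrightarrow> w \<in> E 0 \<longleftrightarrow> (\<exists>u\<in>pverts G. w = prod_encode (u, 0))"
  shows "sat (copies k G) E e (base_vertex a x) \<longleftrightarrow> e a = prod_encode (v, 0)"
proof -
  have x: "e x \<in> pverts (copies k G)" using assms(3-5) by (auto simp: copies_def)
  have "(prod_encode (u, 0), prod_encode (v, i)) \<in> parcs (copies k G) \<longleftrightarrow> u = v"
    if "u \<in> pverts G" "i \<noteq> 0" for u
    using that assms(4,5) by (auto simp: copies_def)
  then show ?thesis
    using assms(2,4,5) x assms(6)[OF assms(2)] assms(6)[OF x]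
    by (cases "i = 0") (auto simp: base_vertex_def assms(3))
qed

lemma multi_interpretable_subsumed:
  assumes "multi_interpretable T"
  shows "\<exists>N C. noncopying N \<and> copy_operation C \<and>
    (\<forall>G. pair_graph G \<longrightarrow> (\<forall>H\<in>T G. pair_graph H \<longrightarrow> (\<exists>H'\<in>(N \<circ>\<^sub>T C) G. graph_iso H H')))"
proof -
  obtain I \<zeta> \<theta> where sys: "binary_system I \<zeta> \<theta>"
    and T: "\<And>G H. pair_graph G \<Longrightarrow> H \<in> T G \<Longrightarrow> \<exists>C. graph_iso H (multi_interpret I \<zeta> \<theta> G C)"
    using assms unfolding multi_interpretable_def by blast
  have finI: "finite I" using sys by (simp add: binary_system_def)
  then obtain k0 where "\<forall>i\<in>I. i < k0" using finite_nat_set_iff_bounded by blast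
  \<comment> \<open>The successor guarantees that copy 0 exists even if \<open>I\<close> is
    empty.\<close>
  define k where "k = Suc k0"
  have k: "i < k" if "i \<in> I" for i using \<open>\<forall>i\<in>I. i < k0\<close> that by (simp add: k_def less_SucI)
  have k0: "0 < k" by (simp add: k_def)
  \<comment> \<open>Interpretation with a single copy: its vertices are those of colour 0, its
    adjacency is inherited. Translating through it relativises quantifiers to copy 0, and the
    colours of \<open>G\<close> move above the \<open>k\<close> symbols that mark the
    copies.\<close>
  let ?\<zeta>0 = "\<lambda>_::nat. Col 0 0" and ?\<theta>0 = "\<lambda>(_::nat) (_::nat). Adj 0 1"
  define rel where "rel \<phi> \<iota> = translate {0} ?\<zeta>0 ?\<theta>0 k \<phi> \<iota>" for \<phi> \<iota>
  have sys0: "binary_system {0} ?\<zeta>0 ?\<theta>0" by (auto simp: binary_system_def)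
  have fv_rel: "fvars (rel \<phi> \<iota>) \<subseteq> {..<2}" if "fvars \<phi> \<subseteq> {..<2}" for \<phi> \<iota>
    using fvars_translate[OF sys0] that unfolding rel_def by blast
  define \<iota> where "\<iota> = (\<lambda>_::nat. 0::nat)"
  define \<nu> where "\<nu> = Disj ((\<lambda>i. And (Col i 0) (Ex 2 (And (base_vertex 2 0) (inst2 (rel (\<zeta> i) \<iota>) 2 2)))) ` I)"
  define \<eta> where "\<eta> = Disj ((\<lambda>(i, j). And (And (Col i 0) (Col j 1)) (Ex 2 (And (base_vertex 2 0)
      (Ex 3 (And (base_vertex 3 1) (inst2 (rel (\<theta> i j) \<iota>) 2 3)))))) ` (I \<times> I))"
  define \<Sigma> where "\<Sigma> = symbols \<nu> \<union> symbols \<eta>"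
  have fv\<zeta>: "fvars (\<zeta> i) \<subseteq> {..<2}" for i
  proof -
    have "fvars (\<zeta> i) \<subseteq> {..<1}" using sys by (simp add: binary_system_def)
    then show ?thesis by auto
  qed
  have fv\<theta>: "fvars (\<theta> i j) \<subseteq> {..<2}" for i j using sys by (simp add: binary_system_def)
  have fv_inst: "fvars (inst2 (rel \<phi> \<iota>) x y) \<subseteq> {x, y}" if "fvars \<phi> \<subseteq> {..<2}" for \<phi> x y
    using fvars_inst2[OF fv_rel[OF that]] .
  have "fvars (And (Col i 0) (Ex 2 (And (base_vertex 2 0) (inst2 (rel (\<zeta> i) \<iota>) 2 2)))) \<subseteq> {..<1}" for i
    using fv_inst[OF fv\<zeta>, of i 2 2] by (auto simp: base_vertex_def)
  then have fv\<nu>: "fvars \<nu> \<subseteq> {..<1}"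
    unfolding \<nu>_def using finI by (auto simp: fvars_Disj simp del: fvars.simps)
  have "fvars (And (And (Col i 0) (Col j 1)) (Ex 2 (And (base_vertex 2 0)
      (Ex 3 (And (base_vertex 3 1) (inst2 (rel (\<theta> i j) \<iota>) 2 3)))))) \<subseteq> {..<2}" for i j
    using fv_inst[OF fv\<theta>, of i j 2 3] by (auto simp: base_vertex_def)
  then have fv\<eta>: "fvars \<eta> \<subseteq> {..<2}"
    unfolding \<eta>_def using finI by (auto simp: fvars_Disj simp del: fvars.simps)
  have simple: "simple_interpretation \<Sigma> \<nu> (sym_part \<eta>)"
    by (rule simple_interpretation_sym_part[OF fv\<nu> _ fv\<eta>]) (auto simp: \<Sigma>_def)
  have "noncopying (noncopying_map \<Sigma> \<nu> (sym_part \<eta>))"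
    unfolding noncopying_def using simple finite_symbols by (metis \<Sigma>_def finite_Un)
  moreover have "copy_operation (\<lambda>G. {copies k G})"
    unfolding copy_operation_def k_def by (intro exI[of _ "Suc k0"]) simp
  moreover have "\<exists>H'\<in>(noncopying_map \<Sigma> \<nu> (sym_part \<eta>) \<circ>\<^sub>T (\<lambda>G. {copies k G})) G. graph_iso H H'"
    if G: "pair_graph G" and H: "H \<in> T G" "pair_graph H" for G H
  proof -
    obtain C f where f: "graph_iso_by f H (multi_interpret I \<zeta> \<theta> G C)"
      using T[OF G H(1)] unfolding graph_iso_def by blast
    define K where "K = copies k G"
    have VK: "w \<in> pverts K \<longleftrightarrow> (\<exists>v\<in>pverts G. \<exists>i<k. w = prod_encode (v, i))" for w
      by (auto simp: K_def copies_def)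
    define M where "M i = {w. \<exists>v\<in>pverts G. w = prod_encode (v, i)}" for i :: nat
    \<comment> \<open>The two zeros differ in meaning: the inner one selects copy 0 of
      \<open>G\<close>, the outer one is the only index of the relativising interpretation.\<close>
    define D where "D s = {(w, i :: nat). i = 0 \<and> (\<exists>v\<in>pverts G \<inter> C s. w = prod_encode (v, 0))}" for s
    define E where "E t = merge_colours k M D t \<inter> pverts K" for t
    have E0: "w \<in> E 0 \<longleftrightarrow> (\<exists>u\<in>pverts G. w = prod_encode (u, 0))" if "w \<in> pverts (copies k G)" for w
      using that k0 by (auto simp: E_def merge_colours_def M_def K_def)
    have EM: "w \<in> E i \<longleftrightarrow> w \<in> M i" if "w \<in> pverts K" "i \<in> I" for w i
      using that k by (simp add: E_def merge_colours_def)
    let ?K0 = "multi_interpret {0} ?\<zeta>0 ?\<theta>0 K M"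
    have V0: "(w, i) \<in> pverts ?K0 \<longleftrightarrow> i = 0 \<and> (\<exists>v\<in>pverts G. w = prod_encode (v, 0))" for w i
      using k0 by (auto simp: multi_interpret_simps models_def M_def VK)
    have iso0: "graph_iso_by (\<lambda>v. (prod_encode (v, 0), 0)) G ?K0"
      unfolding graph_iso_by_def
    proof (intro conjI ballI)
      have "(\<lambda>v. (prod_encode (v, 0), 0)) ` pverts G = pverts ?K0"
      proof (intro subset_antisym subsetI)
        fix p assume "p \<in> pverts ?K0"
        then show "p \<in> (\<lambda>v. (prod_encode (v, 0), 0)) ` pverts G" using V0 by (cases p) auto
      qed (use V0 in auto)
      then show "bij_betw (\<lambda>v. (prod_encode (v, 0), 0)) (pverts G) (pverts ?K0)"
        by (simp add: bij_betw_def inj_on_def)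
    next
      fix u v assume uv: "u \<in> pverts G" "v \<in> pverts G"
      then have "(u, v) \<in> parcs G \<longleftrightarrow> (prod_encode (u, 0), prod_encode (v, 0)) \<in> parcs K"
        using k0 by (auto simp: K_def copies_def)
      then show "(u, v) \<in> parcs G \<longleftrightarrow> ((prod_encode (u, 0), 0), (prod_encode (v, 0), 0)) \<in> parcs ?K0"
        using uv V0 by (simp add: multi_interpret_simps(2) models_def)
    qed
    have rel: "models K E [prod_encode (u, 0), prod_encode (v, 0)] (rel \<phi> \<iota>) = models G C [u, v] \<phi>"
      if uv: "u \<in> pverts G" "v \<in> pverts G" and \<phi>: "fvars \<phi> \<subseteq> {..<2}" for u v \<phi>
    proof -
      have D: "w \<in> C s \<longleftrightarrow> (prod_encode (w, 0), 0) \<in> D s" if "w \<in> pverts G" for w s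
        using that by (auto simp: D_def)
      have V: "(prod_encode (u, 0), 0) \<in> pverts ?K0" "(prod_encode (v, 0), 0) \<in> pverts ?K0"
        using uv V0 by auto
      have "models G C [u, v] \<phi> = models ?K0 D (map (\<lambda>v. (prod_encode (v, 0), 0)) [u, v]) \<phi>"
        by (rule models_iso[OF iso0]) (use D uv \<phi> in \<open>auto simp: numeral_2_eq_2\<close>)
      also have "\<dots> = models K (merge_colours k M D) [prod_encode (u, 0), prod_encode (v, 0)] (rel \<phi> \<iota>)"
        using models_translate(2)[OF sys0 _ _ \<phi> V, of k D] k0 unfolding rel_def \<iota>_def by simp
      also have "\<dots> = models K E [prod_encode (u, 0), prod_encode (v, 0)] (rel \<phi> \<iota>)"
        unfolding models_def
      proof (rule sat_cong)
        fix x assume "x \<in> fvars (rel \<phi> \<iota>)"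
        then have "x < 2" using fv_rel[OF \<phi>] by auto
        then show "[prod_encode (u, 0), prod_encode (v, 0)] ! x \<in> pverts K \<and>
            [prod_encode (u, 0), prod_encode (v, 0)] ! x = [prod_encode (u, 0), prod_encode (v, 0)] ! x"
          using uv k0 VK by (cases x) auto
      qed (simp add: E_def)
      finally show ?thesis by simp
    qed
    have base: "sat K E e (base_vertex a x) \<longleftrightarrow> e a = prod_encode (v, 0)"
      if "e a \<in> pverts K" "e x = prod_encode (v, i)" "v \<in> pverts G" "i < k" for e a x v i
      using sat_base_vertex[OF G, of e a k x v i E] that E0 unfolding K_def by blast
    have base_in: "prod_encode (v, 0) \<in> pverts K" if "v \<in> pverts G" for v using that k0 VK by blast
    have E_iff: "prod_encode (v, i) \<in> E j \<longleftrightarrow> i = j"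
      if "v \<in> pverts G" "i < k" "j \<in> I" for v i j
      using EM[of "prod_encode (v, i)" j] that VK by (auto simp: M_def)
    have m\<nu>: "models K E [prod_encode (v, i)] \<nu> \<longleftrightarrow> i \<in> I \<and> models G C [v] (\<zeta> i)"
      if v: "v \<in> pverts G" "i < k" for v i
    proof -
      define e where "e = (\<lambda>n. [prod_encode (v, i)] ! n)"
      have "sat K E e (Ex 2 (And (base_vertex 2 0) (inst2 (rel (\<zeta> j) \<iota>) 2 2))) \<longleftrightarrow>
          models G C [v, v] (\<zeta> j)" for j
      proof -
        have b: "sat K E (e(2 := w)) (base_vertex 2 0) \<longleftrightarrow> w = prod_encode (v, 0)" if "w \<in> pverts K" for w
          using base[of "e(2 := w)" 2 0 v i] that v by (simp add: e_def)
        have "sat K E (e(2 := w)) (inst2 (rel (\<zeta> j) \<iota>) 2 2) = models K E [w, w] (rel (\<zeta> j) \<iota>)"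
          if "w \<in> pverts K" for w
          using sat_inst2[OF fv_rel[OF fv\<zeta>], of "e(2 := w)" 2 K 2 E] that by simp
        then show ?thesis using b base_in[OF v(1)] rel[OF v(1,1) fv\<zeta>, of j] by auto
      qed
      moreover have "models G C [v, v] (\<zeta> j) = models G C [v] (\<zeta> j)" for j
        using models_Cons[of "\<zeta> j" v G "\<lambda>n. [v, v] ! n" C] sys v(1)
        by (simp add: binary_system_def models_def)
      ultimately have "sat K E e (And (Col j 0) (Ex 2 (And (base_vertex 2 0) (inst2 (rel (\<zeta> j) \<iota>) 2 2)))) \<longleftrightarrow>
          i = j \<and> models G C [v] (\<zeta> j)" if "j \<in> I" for j
        using E_iff[OF v that] by (simp add: e_def)
      then show ?thesis
        unfolding models_def[of K] e_def[symmetric] \<nu>_def using finI by (auto simp: sat_Disj)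
    qed
    have m\<eta>: "models K E [prod_encode (u, i), prod_encode (v, j)] \<eta> \<longleftrightarrow>
        i \<in> I \<and> j \<in> I \<and> models G C [u, v] (\<theta> i j)"
      if u: "u \<in> pverts G" "i < k" and v: "v \<in> pverts G" "j < k" for u i v j
    proof -
      define e where "e = (\<lambda>n. [prod_encode (u, i), prod_encode (v, j)] ! n)"
      have "sat K E e (Ex 2 (And (base_vertex 2 0)
          (Ex 3 (And (base_vertex 3 1) (inst2 (rel (\<theta> i' j') \<iota>) 2 3))))) \<longleftrightarrow>
          models G C [u, v] (\<theta> i' j')" for i' j'
      proof -
        have b: "sat K E (e(2 := w)) (base_vertex 2 0) \<longleftrightarrow> w = prod_encode (u, 0)"
          if "w \<in> pverts K" for w
          using base[of "e(2 := w)" 2 0 u i] that u by (simp add: e_def)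
        have b': "sat K E (e(2 := w, 3 := w')) (base_vertex 3 1) \<longleftrightarrow> w' = prod_encode (v, 0)"
          if "w' \<in> pverts K" for w w'
          using base[of "e(2 := w, 3 := w')" 3 1 v j] that v by (simp add: e_def)
        have "sat K E (e(2 := w, 3 := w')) (inst2 (rel (\<theta> i' j') \<iota>) 2 3) =
            models K E [w, w'] (rel (\<theta> i' j') \<iota>)" if "w \<in> pverts K" "w' \<in> pverts K" for w w'
          using sat_inst2[OF fv_rel[OF fv\<theta>], of "e(2 := w, 3 := w')" 2 K 3 E] that by simp
        then show ?thesis
          using b b' base_in[OF u(1)] base_in[OF v(1)] rel[OF u(1) v(1) fv\<theta>, of i' j'] by auto
      qed
      then have "sat K E e (And (And (Col i' 0) (Col j' 1)) (Ex 2 (And (base_vertex 2 0)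
          (Ex 3 (And (base_vertex 3 1) (inst2 (rel (\<theta> i' j') \<iota>) 2 3)))))) \<longleftrightarrow>
          i = i' \<and> j = j' \<and> models G C [u, v] (\<theta> i' j')" if "i' \<in> I" "j' \<in> I" for i' j'
        using E_iff[OF u that(1)] E_iff[OF v that(2)] by (simp add: e_def)
      then show ?thesis
        unfolding models_def[of K] e_def[symmetric] \<eta>_def using finI by (auto simp: sat_Disj)
    qed
    let ?R = "multi_interpret I \<zeta> \<theta> G C"
    have VR: "(v, i) \<in> pverts ?R \<Longrightarrow> v \<in> pverts G \<and> i < k" for v i
      using k by (auto simp: multi_interpret_simps(1))
    \<comment> \<open>The target is isomorphic to a genuine graph, hence symmetric and loop-free,
      and \<open>sym_part\<close> does not alter it.\<close>
    have R: "p \<noteq> q \<and> (q, p) \<in> parcs ?R" if "(p, q) \<in> parcs ?R" for p q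
    proof -
      have bij: "bij_betw f (pverts H) (pverts ?R)" using f by (simp add: graph_iso_by_def)
      obtain u i v j where pq: "p = (u, i)" "q = (v, j)" by (cases p, cases q)
      then have "p \<in> pverts ?R" "q \<in> pverts ?R" using that by (simp_all add: multi_interpret_simps(2))
      then obtain a b where ab: "a \<in> pverts H" "b \<in> pverts H" "p = f a" "q = f b"
        using bij unfolding bij_betw_def by blast
      then have "(a, b) \<in> parcs H" using f that by (simp add: graph_iso_by_def)
      then have "a \<noteq> b" "(b, a) \<in> parcs H" using H(2) by (auto simp: pair_graph_iff sym_def irrefl_def)
      then show ?thesis using ab f bij by (auto simp: graph_iso_by_def bij_betw_def inj_on_def)
    qed
    let ?H = "interpret_graph \<nu> (sym_part \<eta>) K E"
    have VH: "w \<in> pverts ?H \<longleftrightarrow> (\<exists>v i. w = prod_encode (v, i) \<and> (v, i) \<in> pverts ?R)" for w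
    proof -
      have "w \<in> pverts ?H \<longleftrightarrow> w \<in> pverts K \<and> models K E [w] \<nu>"
        by (simp add: interpret_graph_def Let_def)
      also have "\<dots> \<longleftrightarrow> (\<exists>v i. w = prod_encode (v, i) \<and> (v, i) \<in> pverts ?R)"
        unfolding VK multi_interpret_simps(1) using m\<nu> k by auto
      finally show ?thesis .
    qed
    have "graph_iso_by prod_encode ?R ?H"
      unfolding graph_iso_by_def
    proof (intro conjI ballI)
      have "prod_encode ` pverts ?R = pverts ?H" using VH by auto
      then show "bij_betw prod_encode (pverts ?R) (pverts ?H)" by (simp add: bij_betw_def inj_on_def)
    next
      fix p q assume pq: "p \<in> pverts ?R" "q \<in> pverts ?R"
      obtain u i v j where pd: "p = (u, i)" and qd: "q = (v, j)" by (cases p, cases q)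
      have u: "u \<in> pverts G" "i < k" and v: "v \<in> pverts G" "j < k" using VR pq pd qd by auto
      have IK: "prod_encode p \<in> pverts K" "prod_encode q \<in> pverts K" using VK u v pd qd by auto
      have I: "i \<in> I" "j \<in> I" using pq pd qd by (auto simp: multi_interpret_simps(1))
      have "(prod_encode p, prod_encode q) \<in> parcs ?H \<longleftrightarrow> models K E [prod_encode p, prod_encode q] (sym_part \<eta>)"
        using VH pq pd qd by (auto simp: interpret_graph_def Let_def)
      also have "\<dots> \<longleftrightarrow> p \<noteq> q \<and> models G C [u, v] (\<theta> i j) \<and> models G C [v, u] (\<theta> j i)"
        unfolding models_sym_part[OF fv\<eta> IK] using m\<eta>[OF u v] m\<eta>[OF v u] I by (simp add: pd qd)
      also have "\<dots> \<longleftrightarrow> p \<noteq> q \<and> (p, q) \<in> parcs ?R \<and> (q, p) \<in> parcs ?R"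
        using pq by (simp add: pd qd multi_interpret_simps(2))
      also have "\<dots> \<longleftrightarrow> (p, q) \<in> parcs ?R" using R[of p q] by blast
      finally show "(p, q) \<in> parcs ?R \<longleftrightarrow> (prod_encode p, prod_encode q) \<in> parcs ?H" by simp
    qed
    then have "graph_iso H ?H" using graph_iso_by_comp[OF f] unfolding graph_iso_def by blast
    moreover have "expansion \<Sigma> K E" by (simp add: expansion_def E_def)
    then have "?H \<in> (noncopying_map \<Sigma> \<nu> (sym_part \<eta>) \<circ>\<^sub>T (\<lambda>G. {copies k G})) G"
      unfolding tcomp_def noncopying_map_def K_def by blast
    ultimately show ?thesis by blast
  qed
  ultimately show ?thesis by blast
qed

theorem theorem1p7:
  shows "(\<forall>T. transduction T \<longrightarrow>
            (\<exists>P T_imm C. perturbation P \<and> immersive T_imm \<and> copy_operation C \<and>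
               subsumes_up_to_iso (P \<circ>\<^sub>T T_imm \<circ>\<^sub>T C) T)) \<and>
         (\<forall>T. noncopying T \<longrightarrow>
            (\<exists>P T_imm. perturbation P \<and> immersive T_imm \<and> subsumes (P \<circ>\<^sub>T T_imm) T))"
proof (intro conjI allI impI)
  fix T assume T: "transduction T"
  from multi_interpretable_subsumed[OF transduction_multi_interpretable[OF T]]
  obtain N C where N: "noncopying N" and C: "copy_operation C"
    and sub: "\<And>G H. pair_graph G \<Longrightarrow> H \<in> T G \<Longrightarrow> pair_graph H \<Longrightarrow> \<exists>H'\<in>(N \<circ>\<^sub>T C) G. graph_iso H H'"
    by blast
  \<comment> \<open>The non-copying case is applied to the graphs that \<open>C\<close> produces;
    there inclusion is literal, so isomorphism enters only through \<open>sub\<close>.\<close>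
  obtain P T_imm where P: "perturbation P" "immersive T_imm" and sub': "subsumes (P \<circ>\<^sub>T T_imm) N"
    using noncopying_subsumed_by_immersive[OF N] by blast
  have "\<exists>H'\<in>(P \<circ>\<^sub>T T_imm \<circ>\<^sub>T C) G. digraph_iso (with_proj H) (with_proj H')"
    if G: "pair_graph G" and H: "H \<in> T G" for G H
  proof -
    have pH: "pair_graph H" by (rule transduction_pair_graph[OF T G H])
    then obtain H' where H': "H' \<in> (N \<circ>\<^sub>T C) G" "graph_iso H H'" using sub G H by blast
    then obtain K where K: "K \<in> C G" "H' \<in> N K" unfolding tcomp_def by blast
    have pK: "pair_graph K" by (rule transduction_pair_graph[OF transduction.copy[OF C] G K(1)])
    have "pair_graph H'" by (rule transduction_pair_graph[OF transduction.noncopy[OF N] pK K(2)])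
    then have "digraph_iso (with_proj H) (with_proj H')"
      using digraph_iso_if_graph_iso pH H'(2) by blast
    moreover have "H' \<in> (P \<circ>\<^sub>T T_imm) K" using sub' pK K(2) unfolding subsumes_def by blast
    then have "H' \<in> (P \<circ>\<^sub>T T_imm \<circ>\<^sub>T C) G" using K(1) unfolding tcomp_def by blast
    ultimately show ?thesis by blast
  qed
  then have "subsumes_up_to_iso (P \<circ>\<^sub>T T_imm \<circ>\<^sub>T C) T" unfolding subsumes_up_to_iso_def by blast
  then show "\<exists>P T_imm C. perturbation P \<and> immersive T_imm \<and> copy_operation C \<and>
      subsumes_up_to_iso (P \<circ>\<^sub>T T_imm \<circ>\<^sub>T C) T"
    using P C by blast
next
  fix T assume "noncopying T"
  then show "\<exists>P T_imm. perturbation P \<and> immersive T_imm \<and> subsumes (P \<circ>\<^sub>T T_imm) T"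
    by (rule noncopying_subsumed_by_immersive)
qed

end
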